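(* There exist absolute constants $c_6,c_7,c_8,c_9>0$ such that the following holds. Let $K$ be an isotropic symmetric convex body in $\mathbb{R}^n$ with $R(K)\leq\gamma\sqrt nL_K$, where $\gamma>0$. Then there exists an isotropic symmetric convex body $C$ in $\mathbb{R}^n$ such that: (i) $L_C\leq c_6$; (ii) $c_7D_n\subseteq C\subseteq c_8\gamma D_n$; (iii) $I_1(K,Z_q^\circ(K))\leq c_9\,I_1(C,Z_q^\circ(C))\,L_K^2$ for all $1\leq q\leq n$.
   Context: A convex body $K$ in $\mathbb{R}^n$ (compact, convex, nonempty interior) is symmetric if $K=-K$, and isotropic if it has volume $1$, its center of mass is at the origin, and there is $L_K>0$ (the isotropic constant) with $\int_K\langle x,\theta\rangle^2dx=L_K^2$ for every $\theta\in S^{n-1}$. $R(K):=\max\{\|x\|_2:x\in K\}$. $D_n$ is the Euclidean ball of volume $1$ in $\mathbb{R}^n$ centered at the origin. For $q\geq1$ and $|K|=1$, $Z_q(K)$ is the symmetric convex body with support function $h_{Z_q(K)}(y)=\left(\int_K|\langle x,y\rangle|^qdx\right)^{1/q}$, $Z_q^\circ(K)$ is its polar body, and $I_1(K,Z_q^\circ(K))=\int_Kh_{Z_q(K)}(x)\,dx$. Absolute constants do not depend on $n$, $K$, $\gamma$ or $q$. *)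

theory Defs
  imports "HOL-Analysis.Analysis"
begin

text \<open>
  The constants of the theorem must not depend on the dimension, so the dimension has to be a
  number that can be quantified over inside the formula, and not a type. Hence the ambient space
  is the library's \<^const>\<open>Euclidean_space\<close> of dimension \<open>n\<close>: real sequences that vanish from
  index \<open>n\<close> on.
\<close>

abbreviation Rn :: "nat \<Rightarrow> (nat \<Rightarrow> real) set" where
  "Rn n \<equiv> topspace (Euclidean_space n)"

definition inner_n :: "nat \<Rightarrow> (nat \<Rightarrow> real) \<Rightarrow> (nat \<Rightarrow> real) \<Rightarrow> real" where
  "inner_n n x y = (\<Sum>i<n. x i * y i)"

definition norm_n :: "nat \<Rightarrow> (nat \<Rightarrow> real) \<Rightarrow> real" where
  "norm_n n x = sqrt (inner_n n x x)"

definition unit_sphere_n :: "nat \<Rightarrow> (nat \<Rightarrow> real) set" where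
  "unit_sphere_n n = {\<theta> \<in> Rn n. norm_n n \<theta> = 1}"

definition scale_set :: "real \<Rightarrow> (nat \<Rightarrow> real) set \<Rightarrow> (nat \<Rightarrow> real) set" where
  "scale_set c A = (\<lambda>x i. c * x i) ` A"

text \<open>
  Lebesgue measure of dimension \<open>n\<close>. The elements of \<open>space (\<Pi>\<^sub>M i\<in>{..<n}. lborel)\<close> are
  \<open>undefined\<close> outside \<open>{..<n}\<close>, so they are first made to vanish there. The result is a measure on
  all sequences, concentrated on \<open>Rn n\<close>.
\<close>

definition zero_ext :: "nat \<Rightarrow> (nat \<Rightarrow> real) \<Rightarrow> (nat \<Rightarrow> real)" where
  "zero_ext n x = (\<lambda>i. if i < n then x i else 0)"

definition lborel_n :: "nat \<Rightarrow> (nat \<Rightarrow> real) measure" where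
  "lborel_n n = distr (\<Pi>\<^sub>M i\<in>{..<n}. lborel) borel (zero_ext n)"

lemma measurable_zero_ext: "zero_ext n \<in> (\<Pi>\<^sub>M i\<in>{..<n}. lborel) \<rightarrow>\<^sub>M borel"
proof (rule measurable_coordinatewise_then_product)
  fix i
  show "(\<lambda>x. zero_ext n x i) \<in> borel_measurable (\<Pi>\<^sub>M i\<in>{..<n}. lborel)"
    by (cases "i < n") (auto simp: zero_ext_def)
qed

lemma emeasure_lborel_n_box:
  assumes "\<And>i. i < n \<Longrightarrow> a i \<le> b i"
  shows "emeasure (lborel_n n) {x \<in> Rn n. \<forall>i<n. a i \<le> x i \<and> x i \<le> b i}
    = ennreal (\<Prod>i<n. b i - a i)"
proof -
  interpret product_sigma_finite "\<lambda>_::nat. lborel :: real measure" ..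
  let ?B = "{x \<in> Rn n. \<forall>i<n. a i \<le> x i \<and> x i \<le> b i}"
  have eq: "?B = (\<Inter>i. {x. x i \<in> (if i < n then {a i..b i} else {0})})"
    by (auto simp: topspace_Euclidean_space split: if_splits)
  have "closed {x::nat \<Rightarrow> real. x i \<in> (if i < n then {a i..b i} else {0})}" for i
    by (rule closed_vimage[unfolded vimage_def])
       (auto intro: continuous_on_product_coordinates)
  then have "closed ?B"
    unfolding eq by (intro closed_INT) auto
  then have B: "?B \<in> sets borel"
    by (rule borel_closed)
  have pre: "zero_ext n -` ?B \<inter> space (\<Pi>\<^sub>M i\<in>{..<n}. lborel) = (\<Pi>\<^sub>E i\<in>{..<n}. {a i..b i})"
    by (auto simp: zero_ext_def topspace_Euclidean_space space_PiM PiE_def Pi_def)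
  have "emeasure (lborel_n n) ?B = (\<Prod>i<n. emeasure lborel {a i..b i})"
    unfolding lborel_n_def by (subst emeasure_distr[OF measurable_zero_ext B], subst pre, subst emeasure_PiM) auto
  also have "\<dots> = (\<Prod>i<n. ennreal (b i - a i))"
    using assms by (intro prod.cong) auto
  also have "\<dots> = ennreal (\<Prod>i<n. b i - a i)"
    using assms by (intro prod_ennreal) auto
  finally show ?thesis .
qed

definition convex_n :: "(nat \<Rightarrow> real) set \<Rightarrow> bool" where
  "convex_n K \<longleftrightarrow>
     (\<forall>x\<in>K. \<forall>y\<in>K. \<forall>u\<ge>0. \<forall>v\<ge>0. u + v = 1 \<longrightarrow> (\<lambda>i. u * x i + v * y i) \<in> K)"

definition convex_body :: "nat \<Rightarrow> (nat \<Rightarrow> real) set \<Rightarrow> bool" where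
  "convex_body n K \<longleftrightarrow>
     compactin (Euclidean_space n) K \<and> convex_n K \<and> Euclidean_space n interior_of K \<noteq> {}"

definition symmetric_body :: "(nat \<Rightarrow> real) set \<Rightarrow> bool" where
  "symmetric_body K \<longleftrightarrow> (\<lambda>x i. - x i) ` K = K"

definition has_isotropic_constant :: "nat \<Rightarrow> (nat \<Rightarrow> real) set \<Rightarrow> real \<Rightarrow> bool" where
  "has_isotropic_constant n K L \<longleftrightarrow>
     L > 0 \<and> (\<forall>\<theta>\<in>unit_sphere_n n. (LINT x:K|lborel_n n. (inner_n n x \<theta>)\<^sup>2) = L\<^sup>2)"

definition isotropic :: "nat \<Rightarrow> (nat \<Rightarrow> real) set \<Rightarrow> bool" where
  "isotropic n K \<longleftrightarrow>
     convex_body n K \<and>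
     emeasure (lborel_n n) K = 1 \<and>
     (\<forall>i<n. (LINT x:K|lborel_n n. x i) = 0) \<and>
     (\<exists>L. has_isotropic_constant n K L)"

text \<open>Unique for isotropic \<open>K\<close> and \<open>n \<ge> 1\<close>, as the sphere is then nonempty.\<close>

definition isotropic_constant :: "nat \<Rightarrow> (nat \<Rightarrow> real) set \<Rightarrow> real" where
  "isotropic_constant n K = (THE L. has_isotropic_constant n K L)"

text \<open>The supremum is a maximum when \<open>K\<close> is compact and nonempty.\<close>

definition circumradius :: "nat \<Rightarrow> (nat \<Rightarrow> real) set \<Rightarrow> real" where
  "circumradius n K = (SUP x\<in>K. norm_n n x)"

definition ball_n :: "nat \<Rightarrow> real \<Rightarrow> (nat \<Rightarrow> real) set" where
  "ball_n n r = {x \<in> Rn n. norm_n n x \<le> r}"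

definition volume_one_ball :: "nat \<Rightarrow> (nat \<Rightarrow> real) set" where
  "volume_one_ball n = ball_n n (THE r. r > 0 \<and> emeasure (lborel_n n) (ball_n n r) = 1)"

definition support_function :: "nat \<Rightarrow> (nat \<Rightarrow> real) set \<Rightarrow> (nat \<Rightarrow> real) \<Rightarrow> real" where
  "support_function n A y = (SUP x\<in>A. inner_n n x y)"

definition Lq_moment :: "nat \<Rightarrow> real \<Rightarrow> (nat \<Rightarrow> real) set \<Rightarrow> (nat \<Rightarrow> real) \<Rightarrow> real" where
  "Lq_moment n q K y = (LINT x:K|lborel_n n. \<bar>inner_n n x y\<bar> powr q) powr (1 / q)"

text \<open>
  For \<open>q \<ge> 1\<close> and a convex body \<open>K\<close> of volume 1, \<open>Lq_moment n q K\<close> is sublinear (Minkowski's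
  inequality), and \<open>Lq_centroid_body n q K\<close> is the convex body of which it is the support function. The body is
  given as the intersection of the half-spaces which that support function prescribes.
\<close>

definition Lq_centroid_body :: "nat \<Rightarrow> real \<Rightarrow> (nat \<Rightarrow> real) set \<Rightarrow> (nat \<Rightarrow> real) set" where
  "Lq_centroid_body n q K = {x \<in> Rn n. \<forall>y\<in>Rn n. inner_n n x y \<le> Lq_moment n q K y}"

text \<open>\<open>I\<^sub>1(K, Z\<^sub>q\<degree>(K))\<close>: the norm whose unit ball is the polar body of \<open>Z\<^sub>q(K)\<close> is the support
  function of \<open>Z\<^sub>q(K)\<close>.\<close>

definition I1_polar_Z :: "nat \<Rightarrow> real \<Rightarrow> (nat \<Rightarrow> real) set \<Rightarrow> real" where
  "I1_polar_Z n q K = (LINT x:K|lborel_n n. support_function n (Lq_centroid_body n q K) x)"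

end

theory Submission
  imports Defs
begin

text \<open>
  With \<open>R = 3 sqrt n L\<^sub>K\<close> and \<open>B\<close> the Euclidean ball of radius \<open>R\<close>, the sum of independent uniform
  points of \<open>K\<close> and \<open>B\<close> has the even density \<open>f / |B|\<close>, \<open>f x = |K \<inter> (x + B)|\<close>, whose covariance is a
  multiple of the identity between \<open>L\<^sub>K\<^sup>2\<close> and \<open>10 L\<^sub>K\<^sup>2\<close>. The body \<open>C\<close> is the volume-one dilate of Ball's
  body \<open>A = {x. N x \<le> 1}\<close>, \<open>N x ^ -(n + 2) = (n + 2) \<integral> r ^ (n + 1) f (r x) dr\<close>: the exponent
  \<open>n + 2\<close> makes \<open>\<integral> G f = \<integral>\<^sub>A G\<close> for every 2-homogeneous \<open>G\<close>, so \<open>C\<close> is isotropic.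

  Convexity of \<open>A\<close> and logarithmic concavity of \<open>f\<close> both come from the Borell--Brascamp--Lieb
  inequality. By Chebyshev \<open>f \<ge> 3/4\<close> near the origin, while \<open>f \<le> 1\<close>; this puts \<open>A\<close> between two balls and gives
  \<open>|B| \<le> |A| \<le> 11 |B|\<close>. Writing a \<open>q\<close>-homogeneous \<open>g\<close> as \<open>G N ^ (q - 2)\<close> yields
  \<open>\<integral> g f \<le> 8 ^ q \<integral>\<^sub>A g\<close>, and \<open>\<integral> g f \<ge> |B| \<integral>\<^sub>K g\<close> for even convex \<open>g\<close>. Applying this first to
  \<open>|\<langle>x, y\<rangle>| ^ q\<close> and then to the support function of \<open>Z\<^sub>q(K)\<close> proves (iii).
\<close>

section \<open>Lebesgue measure in coordinates\<close>

text \<open>No bound on \<open>L\<^sub>K\<close> is available, and yet \<open>L\<^sub>C\<close> must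
  be bounded. The smoothing achieves this: the density \<open>f / |B|\<close> never exceeds
  \<open>1 / |B|\<close>, and the n-th root of \<open>|B|\<close> has the same order
  \<open>L\<^sub>K\<close> as the standard deviation in every direction. Since \<open>B\<close> is
  symmetric, averaging over it cannot decrease integrals of convex functions, so the moments of
  \<open>K\<close> are not lost. Replacing the density by a body costs a factor exponential in q,
  which the q-th root makes a constant; \<open>q \<le> n\<close> lets the decay
  \<open>N ^ -(n + 2)\<close> of \<open>f\<close> beat the growth \<open>N ^ (q - 2)\<close>. The
  dilation from \<open>A\<close> to \<open>C\<close> has order \<open>1 / L\<^sub>K\<close> and
  enters \<open>I\<^sub>1\<close> twice, through the argument of the support function and through
  the body behind it: hence the square in (iii). \<open>B\<close> has radius
  \<open>3 sqrt n L\<^sub>K\<close> because 3/4 of \<open>K\<close> lies within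
  \<open>2 sqrt n L\<^sub>K\<close>, and the rest is room to move the centre. As the dimension is a
  variable, integrals are handled by coordinates: the n-dimensional inequality is reached by
  induction, and sign changes and transpositions take the place of rotations.\<close>

lemma sets_lborel_n [measurable_cong, simp]: "sets (lborel_n n) = sets borel"
  by (simp add: lborel_n_def)

lemma space_lborel_n [simp]: "space (lborel_n n) = UNIV"
  by (simp add: lborel_n_def)

lemma nn_integral_lborel_n:
  assumes "g \<in> borel_measurable borel"
  shows "(\<integral>\<^sup>+x. g x \<partial>lborel_n n) = (\<integral>\<^sup>+x. g (zero_ext n x) \<partial>(\<Pi>\<^sub>M i\<in>{..<n}. lborel))"
  unfolding lborel_n_def by (subst nn_integral_distr[OF measurable_zero_ext]) (use assms in simp_all)

lemma borel_measurable_coordinate: "(\<lambda>x::nat \<Rightarrow> real. x i) \<in> borel_measurable borel"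
  by (intro borel_measurable_continuous_onI continuous_on_product_coordinates)

lemma borel_measurable_fun_upd [measurable]:
  assumes [measurable]: "f \<in> M \<rightarrow>\<^sub>M (borel :: (nat \<Rightarrow> real) measure)" "t \<in> borel_measurable M"
  shows "(\<lambda>w. (f w)(n := t w)) \<in> M \<rightarrow>\<^sub>M borel"
proof (rule measurable_coordinatewise_then_product)
  fix i
  have "(\<lambda>w. f w i) \<in> borel_measurable M"
    by (rule measurable_compose[OF assms(1) borel_measurable_coordinate])
  then show "(\<lambda>w. ((f w)(n := t w)) i) \<in> borel_measurable M"
    by (cases "i = n") auto
qed

lemma coordinate_box_in_borel:
  assumes "\<And>i. S i \<in> sets borel"
  shows "(\<Inter>i. {x :: nat \<Rightarrow> real. x i \<in> S i}) \<in> sets borel"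
proof (rule sets.countable_INT'')
  show "{x :: nat \<Rightarrow> real. x i \<in> S i} \<in> sets borel" for i
    using measurable_sets[OF borel_measurable_coordinate[of i] assms[of i]] by (simp add: vimage_def)
qed auto

lemma nn_integral_lborel_n_0:
  assumes "g \<in> borel_measurable borel"
  shows "(\<integral>\<^sup>+x. g x \<partial>lborel_n 0) = g (\<lambda>_. 0)"
proof -
  interpret product_sigma_finite "\<lambda>_::nat. lborel :: real measure" ..
  show ?thesis
    unfolding nn_integral_lborel_n[OF assms] by (simp add: PiM_empty nn_integral_count_space_finite zero_ext_def)
qed

text \<open>The form of Fubini's theorem in which the inductions on \<open>n\<close> below peel off
  the last coordinate: \<open>x(n := t)\<close> overwrites whatever value \<open>x\<close> had
  there.\<close>

lemma nn_integral_lborel_n_Suc: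
  assumes [measurable]: "g \<in> borel_measurable borel"
  shows "(\<integral>\<^sup>+x. g x \<partial>lborel_n (Suc n)) = (\<integral>\<^sup>+x. \<integral>\<^sup>+t. g (x(n := t)) \<partial>lborel \<partial>lborel_n n)"
proof -
  interpret product_sigma_finite "\<lambda>_::nat. lborel :: real measure" ..
  note measurable_zero_ext[measurable]
  have ze: "zero_ext (Suc n) (x(n := t)) = (zero_ext n x)(n := t)" for x t
    by (auto simp: zero_ext_def)
  have "(\<integral>\<^sup>+x. g x \<partial>lborel_n (Suc n))
      = (\<integral>\<^sup>+x. g (zero_ext (Suc n) x) \<partial>(\<Pi>\<^sub>M i\<in>insert n {..<n}. lborel))"
    by (subst nn_integral_lborel_n) (auto simp: lessThan_Suc)
  also have "\<dots> = (\<integral>\<^sup>+x. \<integral>\<^sup>+t. g (zero_ext (Suc n) (x(n := t))) \<partial>lborel \<partial>(\<Pi>\<^sub>M i\<in>{..<n}. lborel))"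
  proof (rule product_nn_integral_insert)
    show "(\<lambda>x. g (zero_ext (Suc n) x)) \<in> borel_measurable (\<Pi>\<^sub>M i\<in>insert n {..<n}. lborel)"
      using measurable_compose[OF measurable_zero_ext[of "Suc n"] assms] by (simp add: lessThan_Suc)
  qed auto
  also have "\<dots> = (\<integral>\<^sup>+x. \<integral>\<^sup>+t. g (x(n := t)) \<partial>lborel \<partial>lborel_n n)"
    unfolding ze by (subst nn_integral_lborel_n) auto
  finally show ?thesis .
qed

section \<open>Concentration on \<open>Rn n\<close> and sigma-finiteness\<close>

lemma AE_lborel_n_Rn: "AE x in lborel_n n. x \<in> Rn n"
proof -
  have "Rn n = (\<Inter>i. {x. x i \<in> (if i < n then UNIV else {0})})"
    by (auto simp: topspace_Euclidean_space split: if_splits)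
  also have "\<dots> \<in> sets borel" by (rule coordinate_box_in_borel) auto
  finally have m: "Rn n \<in> sets borel" .
  show ?thesis
    unfolding lborel_n_def
    by (subst AE_distr_iff[OF measurable_zero_ext]) (use m in \<open>auto simp: zero_ext_def topspace_Euclidean_space\<close>)
qed

lemma box_n_in_borel: "{x \<in> Rn n. \<forall>i<n. a \<le> x i \<and> x i \<le> b} \<in> sets borel"
proof -
  have "{x \<in> Rn n. \<forall>i<n. a \<le> x i \<and> x i \<le> b} = (\<Inter>i. {x. x i \<in> (if i < n then {a..b} else {0})})"
    by (auto simp: topspace_Euclidean_space split: if_splits)
  also have "\<dots> \<in> sets borel" by (rule coordinate_box_in_borel) auto
  finally show ?thesis .
qed

text \<open>The coordinates from \<open>n\<close> on vanish almost everywhere, so up to a null set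
  \<open>S\<close> lies in a box. The maximum with 0 keeps the box formula applicable when
  \<open>t\<close> is negative.\<close>

lemma emeasure_bounded_coordinates_finite:
  assumes "\<And>x i. x \<in> S \<Longrightarrow> i < n \<Longrightarrow> \<bar>x i\<bar> \<le> t"
  shows "emeasure (lborel_n n) S < \<infinity>"
proof -
  let ?t = "max t 0"
  have "emeasure (lborel_n n) S \<le> emeasure (lborel_n n) {x \<in> Rn n. \<forall>i<n. - ?t \<le> x i \<and> x i \<le> ?t}"
  proof (rule emeasure_mono_AE)
    show "AE x in lborel_n n. x \<in> S \<longrightarrow> x \<in> {x \<in> Rn n. \<forall>i<n. - ?t \<le> x i \<and> x i \<le> ?t}"
      using AE_lborel_n_Rn[of n]
    proof eventually_elim
      fix x assume x: "x \<in> Rn n"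
      have "- ?t \<le> x i \<and> x i \<le> ?t" if "x \<in> S" "i < n" for i
        using assms[OF that] by linarith
      then show "x \<in> S \<longrightarrow> x \<in> {x \<in> Rn n. \<forall>i<n. - ?t \<le> x i \<and> x i \<le> ?t}"
        using x by blast
    qed
  qed (simp only: sets_lborel_n box_n_in_borel)
  also have "\<dots> < \<infinity>" by (subst emeasure_lborel_n_box) auto
  finally show ?thesis .
qed

text \<open>The measure lives on all sequences, so the exhausting sets constrain only the first
  \<open>n\<close> coordinates; in this way they cover the whole space.\<close>

lemma sigma_finite_lborel_n: "sigma_finite_measure (lborel_n n)"
proof
  define U where "U k = {x :: nat \<Rightarrow> real. \<forall>i<n. \<bar>x i\<bar> \<le> real k}" for k :: nat
  have U: "U k \<in> sets borel" for k
  proof -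
    have "U k = (\<Inter>i\<in>{..<n}. {x. \<bar>x i\<bar> \<le> real k})" by (auto simp: U_def)
    also have "\<dots> \<in> sets borel"
      by (cases "n = 0") (auto intro!: sets.finite_INT)
    finally show ?thesis .
  qed
  have fin: "emeasure (lborel_n n) (U k) \<noteq> \<infinity>" for k
    using emeasure_bounded_coordinates_finite[of "U k" n "real k"] by (auto simp: U_def)
  have cov: "(\<Union>k. U k) = UNIV"
  proof -
    have "\<exists>k. x \<in> U k" for x
    proof -
      obtain k where "(\<Sum>i<n. \<bar>x i\<bar>) \<le> real k" using real_arch_simple by blast
      moreover have "\<bar>x i\<bar> \<le> (\<Sum>i<n. \<bar>x i\<bar>)" if "i < n" for i
        using that by (intro member_le_sum) auto
      ultimately have "x \<in> U k" unfolding U_def by (auto intro: order_trans)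
      then show ?thesis ..
    qed
    then show ?thesis by auto
  qed
  show "\<exists>A. countable A \<and> A \<subseteq> sets (lborel_n n) \<and> \<Union> A = space (lborel_n n) \<and> (\<forall>a\<in>A. emeasure (lborel_n n) a \<noteq> \<infinity>)"
    by (rule exI[of _ "range U"]) (use U fin cov in auto)
qed

interpretation lborel_n: sigma_finite_measure "lborel_n n" for n
  by (rule sigma_finite_lborel_n)

section \<open>Changes of variables: diagonal affine maps and transpositions\<close>

lemma borel_measurable_affine_map [measurable]:
  "(\<lambda>(x::nat \<Rightarrow> real) i. c i * x i + a i) \<in> borel \<rightarrow>\<^sub>M (borel :: (nat \<Rightarrow> real) measure)"
  by (rule measurable_coordinatewise_then_product) measurable

lemma nn_integral_lborel_n_affine:
  fixes a c :: "nat \<Rightarrow> real"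
  assumes g: "g \<in> borel_measurable borel" and a: "a \<in> Rn n" and c: "\<And>i. c i \<noteq> 0"
  shows "(\<integral>\<^sup>+x. g x \<partial>lborel_n n) = ennreal (\<Prod>i<n. \<bar>c i\<bar>) * (\<integral>\<^sup>+x. g (\<lambda>i. c i * x i + a i) \<partial>lborel_n n)"
  using g a
proof (induction n arbitrary: g a)
  case 0
  note [measurable] = 0(1)
  have "a = (\<lambda>_. 0)" using 0(2) by (auto simp: topspace_Euclidean_space)
  moreover have "(\<lambda>x. g (\<lambda>i. c i * x i + a i)) \<in> borel_measurable borel"
    by measurable
  ultimately show ?case
    by (simp add: nn_integral_lborel_n_0)
next
  case (Suc n)
  note [measurable] = Suc.prems(1)
  \<comment> \<open>The last entry of \<open>a\<close> is split off so that \<open>a'\<close> lies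
    in \<open>Rn n\<close> and the induction hypothesis applies to it.\<close>
  define a' where "a' = a(n := 0)"
  have a': "a' \<in> Rn n" using Suc.prems(2) by (auto simp: a'_def topspace_Euclidean_space)
  have eq: "(\<lambda>i. c i * x i + a' i)(n := a n + c n * t) = (\<lambda>i. c i * (x(n := t)) i + a i)" for x t
    by (auto simp: a'_def)
  let ?P = "ennreal (\<Prod>i<n. \<bar>c i\<bar>)"
  have "(\<integral>\<^sup>+x. g x \<partial>lborel_n (Suc n)) = (\<integral>\<^sup>+x. \<integral>\<^sup>+t. g (x(n := t)) \<partial>lborel \<partial>lborel_n n)"
    by (rule nn_integral_lborel_n_Suc) measurable
  also have "\<dots> = ?P * (\<integral>\<^sup>+x. \<integral>\<^sup>+t. g ((\<lambda>i. c i * x i + a' i)(n := t)) \<partial>lborel \<partial>lborel_n n)"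
    by (rule Suc.IH[OF _ a']) measurable
  also have "(\<lambda>x. \<integral>\<^sup>+t. g ((\<lambda>i. c i * x i + a' i)(n := t)) \<partial>lborel)
    = (\<lambda>x. ennreal \<bar>c n\<bar> * (\<integral>\<^sup>+t. g ((\<lambda>i. c i * x i + a' i)(n := a n + c n * t)) \<partial>lborel))"
    by (rule ext, rule nn_integral_real_affine) (use c in measurable)
  also have "(\<integral>\<^sup>+x. ennreal \<bar>c n\<bar> * (\<integral>\<^sup>+t. g ((\<lambda>i. c i * x i + a' i)(n := a n + c n * t)) \<partial>lborel) \<partial>lborel_n n)
    = ennreal \<bar>c n\<bar> * (\<integral>\<^sup>+x. \<integral>\<^sup>+t. g ((\<lambda>i. c i * x i + a' i)(n := a n + c n * t)) \<partial>lborel \<partial>lborel_n n)"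
    by (rule nn_integral_cmult) measurable
  also have "\<dots> = ennreal \<bar>c n\<bar> * (\<integral>\<^sup>+x. g (\<lambda>i. c i * x i + a i) \<partial>lborel_n (Suc n))"
    unfolding eq by (subst nn_integral_lborel_n_Suc) measurable
  finally show ?case
    by (simp add: ennreal_mult prod_nonneg mult.assoc[symmetric] mult.commute)
qed

lemma nn_integral_lborel_n_translate:
  assumes "g \<in> borel_measurable borel" "a \<in> Rn n"
  shows "(\<integral>\<^sup>+x. g (\<lambda>i. x i + a i) \<partial>lborel_n n) = (\<integral>\<^sup>+x. g x \<partial>lborel_n n)"
  using nn_integral_lborel_n_affine[OF assms, of "\<lambda>_. 1"] by simp

lemma nn_integral_lborel_n_scale:
  assumes "g \<in> borel_measurable borel" "c > 0"
  shows "(\<integral>\<^sup>+x. g x \<partial>lborel_n n) = ennreal (c ^ n) * (\<integral>\<^sup>+x. g (\<lambda>i. c * x i) \<partial>lborel_n n)"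
  using nn_integral_lborel_n_affine[OF assms(1), of "\<lambda>_. 0" n "\<lambda>_. c"] assms(2)
  by (simp add: topspace_Euclidean_space)

lemma nn_integral_lborel_n_reflect:
  assumes "g \<in> borel_measurable borel"
  shows "(\<integral>\<^sup>+x. g (\<lambda>i. - x i) \<partial>lborel_n n) = (\<integral>\<^sup>+x. g x \<partial>lborel_n n)"
  using nn_integral_lborel_n_affine[OF assms(1), of "\<lambda>_. 0" n "\<lambda>_. -1"]
  by (simp add: topspace_Euclidean_space)

lemma nn_integral_lborel_n_reflect_coordinate:
  assumes "g \<in> borel_measurable borel"
  shows "(\<integral>\<^sup>+x. g (x(i := - x i)) \<partial>lborel_n n) = (\<integral>\<^sup>+x. g x \<partial>lborel_n n)"
proof -
  have "(\<lambda>j. (if j = i then -1 else 1) * x j + 0) = x(i := - x i)" for x :: "nat \<Rightarrow> real"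
    by auto
  then show ?thesis
    using nn_integral_lborel_n_affine[OF assms(1), of "\<lambda>_. 0" n "\<lambda>j. if j = i then -1 else 1"]
    by (simp add: topspace_Euclidean_space if_distrib cong: if_cong)
qed

text \<open>The product measure is determined by its values on boxes, and a transposition merely
  permutes the sides of a box. Together with sign changes of single coordinates this stands in for
  rotation invariance when the second moments of a ball are computed.\<close>

lemma nn_integral_lborel_n_transpose:
  assumes [measurable]: "g \<in> borel_measurable borel" and ij: "i < n" "j < n"
  shows "(\<integral>\<^sup>+x. g (x \<circ> Transposition.transpose i j) \<partial>lborel_n n) = (\<integral>\<^sup>+x. g x \<partial>lborel_n n)"
proof -
  interpret product_sigma_finite "\<lambda>_::nat. lborel :: real measure" ..
  let ?s = "Transposition.transpose i j"
  let ?P = "(\<Pi>\<^sub>M i\<in>{..<n}. lborel) :: (nat \<Rightarrow> real) measure"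
  let ?h = "\<lambda>x::nat \<Rightarrow> real. \<lambda>k\<in>{..<n}. x (?s k)"
  have s: "?s k < n \<longleftrightarrow> k < n" for k
    using ij by (auto simp: Transposition.transpose_def)
  have h [measurable]: "?h \<in> ?P \<rightarrow>\<^sub>M ?P"
    by (rule measurable_restrict, rule measurable_component_singleton) (use s in simp)
  have P: "distr ?P ?P ?h = ?P"
  proof (rule PiM_eqI)
    fix A assume A: "\<And>i. i \<in> {..<n} \<Longrightarrow> A i \<in> sets (lborel :: real measure)"
    have "?h -` Pi\<^sub>E {..<n} A \<inter> space ?P = Pi\<^sub>E {..<n} (\<lambda>k. A (?s k))"
    proof (intro equalityI subsetI)
      fix x assume x: "x \<in> ?h -` Pi\<^sub>E {..<n} A \<inter> space ?P"
      show "x \<in> Pi\<^sub>E {..<n} (\<lambda>k. A (?s k))"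
      proof (rule PiE_I)
        fix k assume "k \<in> {..<n}"
        then have "?s k \<in> {..<n}" using s by auto
        with x have "?h x (?s k) \<in> A (?s k)" by blast
        then show "x k \<in> A (?s k)" using \<open>?s k \<in> {..<n}\<close> by simp
      qed (use x in \<open>auto simp: space_PiM PiE_def extensional_def\<close>)
    next
      fix x assume x: "x \<in> Pi\<^sub>E {..<n} (\<lambda>k. A (?s k))"
      have "x (?s k) \<in> A k" if "k < n" for k
      proof -
        have "x (?s k) \<in> A (?s (?s k))" using x s that by (intro PiE_mem[OF x]) auto
        then show ?thesis by simp
      qed
      with x show "x \<in> ?h -` Pi\<^sub>E {..<n} A \<inter> space ?P"
        by (auto simp: space_PiM PiE_def)
    qed
    then have "emeasure (distr ?P ?P ?h) (Pi\<^sub>E {..<n} A) = (\<Prod>k<n. emeasure lborel (A (?s k)))"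
      using A s by (subst emeasure_distr) (auto intro!: sets_PiM_I_finite emeasure_PiM)
    also have "\<dots> = (\<Prod>k<n. emeasure lborel (A k))"
      by (rule prod.reindex_bij_witness[of _ ?s ?s]) (use s in auto)
    finally show "emeasure (distr ?P ?P ?h) (Pi\<^sub>E {..<n} A) = (\<Prod>k\<in>{..<n}. emeasure lborel (A k))" .
  qed auto
  have c: "(\<lambda>x::nat \<Rightarrow> real. x \<circ> ?s) \<in> borel \<rightarrow>\<^sub>M borel"
    unfolding o_def by (rule measurable_coordinatewise_then_product) (rule borel_measurable_coordinate)
  have z: "zero_ext n (?h x) = zero_ext n x \<circ> ?s" for x
    by (rule ext) (simp add: zero_ext_def s)
  note measurable_zero_ext[measurable]
  have "(\<integral>\<^sup>+x. g x \<partial>lborel_n n) = (\<integral>\<^sup>+x. g (zero_ext n x) \<partial>distr ?P ?P ?h)"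
    by (simp add: P nn_integral_lborel_n)
  also have "\<dots> = (\<integral>\<^sup>+x. g (zero_ext n (?h x)) \<partial>?P)"
    by (rule nn_integral_distr) measurable
  also have "\<dots> = (\<integral>\<^sup>+x. g (x \<circ> ?s) \<partial>lborel_n n)"
    unfolding z by (rule nn_integral_lborel_n[symmetric]) (rule measurable_compose[OF c assms(1)])
  finally show ?thesis by simp
qed

section \<open>The Borell--Brascamp--Lieb inequality\<close>

lemma lborel_inner_compact:
  fixes A :: "real set"
  assumes A: "A \<in> sets borel" and c: "c < emeasure lborel A"
  obtains K where "compact K" "K \<subseteq> A" "c < emeasure lborel K"
proof -
  define I where "I k = A \<inter> {- real k..real k}" for k :: nat
  have "(SUP k. emeasure lborel (I k)) = emeasure lborel (\<Union>k. I k)"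
  proof (rule SUP_emeasure_incseq)
    show "incseq I" by (auto simp: I_def incseq_def)
    show "range I \<subseteq> sets lborel" using A by (auto simp: I_def)
  qed
  also have "(\<Union>k. I k) = A"
  proof -
    have "\<exists>k. x \<in> {- real k..real k}" for x
      using real_arch_simple[of "\<bar>x\<bar>"] by (auto simp: abs_le_iff minus_le_iff)
    then show ?thesis by (auto simp: I_def)
  qed
  finally obtain k where k: "c < emeasure lborel (I k)"
    using c by (metis less_SUP_iff)
  \<comment> \<open>Inner regularity is applied to a finite measure: Lebesgue measure restricted to
    an interval that already captures more than \<open>c\<close> of the set
    \<open>A\<close>.\<close>
  define M where "M = density lborel (indicator {- real k..real k})"
  have M: "emeasure M X = emeasure lborel (X \<inter> {- real k..real k})" if "X \<in> sets borel" for X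
    using that unfolding M_def by (subst emeasure_density)
      (auto simp: indicator_inter_arith[symmetric] Int_commute mult.commute)
  have "emeasure M A = (SUP K\<in>{K. K \<subseteq> A \<and> compact K}. emeasure M K)"
  proof (rule inner_regular)
    show "emeasure M (space M) \<noteq> \<infinity>"
      using M[of UNIV] by (simp add: M_def)
  qed (use A in \<open>auto simp: M_def\<close>)
  moreover have "c < emeasure M A" using k M[OF A] by (simp add: I_def)
  ultimately obtain K where K: "K \<subseteq> A" "compact K" "c < emeasure M K"
    by (auto simp: less_SUP_iff)
  have KB: "K \<in> sets borel" using K(2) by (simp add: borel_compact)
  have "emeasure M K \<le> emeasure lborel K"
    unfolding M[OF KB] using KB by (intro emeasure_mono) auto
  then show thesis using K that by (auto intro: less_le_trans)
qed

lemma emeasure_lborel_shift: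
  fixes A :: "real set"
  assumes "A \<in> sets borel"
  shows "{t. t - c \<in> A} \<in> sets borel" "emeasure lborel {t. t - c \<in> A} = emeasure lborel A"
proof -
  have eq: "{t. t - c \<in> A} = (+) (-c) -` A \<inter> space lborel" by auto
  show "{t. t - c \<in> A} \<in> sets borel"
    unfolding eq using measurable_sets[of "(+) (-c)" lborel borel A] assms by simp
  have "emeasure lborel A = emeasure (distr lborel borel ((+) (-c))) A"
    by (simp only: lborel_distr_plus)
  also have "\<dots> = emeasure lborel ((+) (-c) -` A \<inter> space lborel)"
    by (rule emeasure_distr) (use assms in auto)
  finally show "emeasure lborel {t. t - c \<in> A} = emeasure lborel A" unfolding eq ..
qed

text \<open>With \<open>a\<close> the maximum of \<open>A\<close> and \<open>b\<close> the minimum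
  of \<open>B\<close>, the translates \<open>A + b\<close> and \<open>a + B\<close> consist of sums
  of the two sets and meet only in \<open>a + b\<close>.\<close>

lemma brunn_minkowski_real_compact:
  fixes A B S :: "real set"
  assumes "compact A" "compact B" "A \<noteq> {}" "B \<noteq> {}" and S: "S \<in> sets borel"
    and sum: "\<And>a b. a \<in> A \<Longrightarrow> b \<in> B \<Longrightarrow> a + b \<in> S"
  shows "emeasure lborel A + emeasure lborel B \<le> emeasure lborel S"
proof -
  obtain a where a: "a \<in> A" "\<And>x. x \<in> A \<Longrightarrow> x \<le> a"
    using compact_attains_sup[OF assms(1,3)] by blast
  obtain b where b: "b \<in> B" "\<And>x. x \<in> B \<Longrightarrow> b \<le> x"
    using compact_attains_inf[OF assms(2,4)] by blast
  have AB: "A \<in> sets borel" "B \<in> sets borel" using assms by (auto intro: borel_compact)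
  \<comment> \<open>Removing \<open>a\<close> from \<open>A\<close> deletes the single common point
    of the translates. This makes them disjoint and costs no measure.\<close>
  let ?T1 = "{t. t - b \<in> A - {a}}" and ?T2 = "{t. t - a \<in> B}"
  have T1: "?T1 \<in> sets borel" "emeasure lborel ?T1 = emeasure lborel (A - {a})"
    using emeasure_lborel_shift[of "A - {a}" b] AB sets.Diff[of A borel "{a}"] by auto
  have T2: "?T2 \<in> sets borel" "emeasure lborel ?T2 = emeasure lborel B"
    using emeasure_lborel_shift[of B a] AB by auto
  have "emeasure lborel (A - {a}) = emeasure lborel A"
    using AB by (intro emeasure_Diff_null_set) auto
  then have "emeasure lborel A + emeasure lborel B = emeasure lborel ?T1 + emeasure lborel ?T2"
    using T1 T2 by simp
  also have "\<dots> = emeasure lborel (?T1 \<union> ?T2)"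
  proof (rule plus_emeasure)
    show "?T1 \<inter> ?T2 = {}"
    proof -
      have "t - b < a" if "t - b \<in> A - {a}" for t using a(2)[of "t - b"] that by force
      moreover have "b \<le> t - a" if "t - a \<in> B" for t using b(2) that by blast
      ultimately show ?thesis by fastforce
    qed
  qed (use T1 T2 in auto)
  also have "\<dots> \<le> emeasure lborel S"
  proof (rule emeasure_mono)
    show "?T1 \<union> ?T2 \<subseteq> S"
    proof
      fix t assume "t \<in> ?T1 \<union> ?T2"
      then show "t \<in> S" using sum[of "t - b" b] sum[of a "t - a"] a(1) b(1) by auto
    qed
  qed (use S in auto)
  finally show ?thesis .
qed

text \<open>Lets one summand be replaced by smaller approximants even if measures are infinite. The
  argument subtracts \<open>b\<close> from \<open>s\<close>, which is sound for finite
  \<open>b\<close>; an infinite \<open>b\<close> forces \<open>s\<close> to be infinite.\<close>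

lemma ennreal_add_le_approx:
  fixes a b s :: ennreal
  assumes b: "b \<le> s" and a: "\<And>x. x < a \<Longrightarrow> \<exists>y\<ge>x. y + b \<le> s"
  shows "a + b \<le> s"
proof (cases "b = \<infinity>")
  case False
  have "a \<le> s - b"
  proof (rule dense_le)
    fix x assume "x < a"
    then obtain y where y: "x \<le> y" "y + b \<le> s" using a by blast
    have "y = (y + b) - b" using False by simp
    also have "\<dots> \<le> s - b" using y by (intro ennreal_minus_mono) auto
    finally show "x \<le> s - b" using y by simp
  qed
  then have "a + b \<le> (s - b) + b" by (rule add_right_mono)
  then show ?thesis using diff_add_cancel_ennreal[OF b] by simp
qed (use b in \<open>simp add: top_unique\<close>)

text \<open>Compact approximation from inside, one set at a time. A measurable \<open>S\<close> that
  contains all sums replaces the sumset itself, so the measurability of the sumset never comes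
  up.\<close>

lemma brunn_minkowski_real:
  fixes A B S :: "real set"
  assumes A: "A \<in> sets borel" "A \<noteq> {}" and B: "B \<in> sets borel" "B \<noteq> {}" and S: "S \<in> sets borel"
    and sum: "\<And>a b. a \<in> A \<Longrightarrow> b \<in> B \<Longrightarrow> a + b \<in> S"
  shows "emeasure lborel A + emeasure lborel B \<le> emeasure lborel S"
proof -
  have comp: "emeasure lborel K + emeasure lborel L \<le> emeasure lborel S"
    if K: "compact K" "K \<subseteq> A" and L: "compact L" "L \<subseteq> B" for K L
  proof -
    obtain a b where ab: "a \<in> A" "b \<in> B" using A B by blast
    \<comment> \<open>The approximating compact sets may be empty; one point of each set is added to
      keep them nonempty.\<close>
    have "emeasure lborel (insert a K) + emeasure lborel (insert b L) \<le> emeasure lborel S"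
      by (rule brunn_minkowski_real_compact) (use K L S sum ab in auto)
    moreover have "emeasure lborel K \<le> emeasure lborel (insert a K)" "emeasure lborel L \<le> emeasure lborel (insert b L)"
      using K L by (auto intro!: emeasure_mono borel_compact)
    ultimately show ?thesis by (meson add_mono order_trans)
  qed
  have one: "emeasure lborel A + emeasure lborel L \<le> emeasure lborel S" if L: "compact L" "L \<subseteq> B" for L
  proof (rule ennreal_add_le_approx)
    show "emeasure lborel L \<le> emeasure lborel S" using comp[OF _ _ L, of "{}"] by simp
    show "\<exists>y\<ge>x. y + emeasure lborel L \<le> emeasure lborel S" if "x < emeasure lborel A" for x
      using lborel_inner_compact[OF A(1) that] comp[OF _ _ L] by (metis less_imp_le)
  qed
  have "emeasure lborel B + emeasure lborel A \<le> emeasure lborel S"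
  proof (rule ennreal_add_le_approx)
    show "emeasure lborel A \<le> emeasure lborel S" using one[of "{}"] by simp
    show "\<exists>y\<ge>x. y + emeasure lborel A \<le> emeasure lborel S" if "x < emeasure lborel B" for x
      using lborel_inner_compact[OF B(1) that] one by (metis less_imp_le add.commute)
  qed
  then show ?thesis by (simp add: add.commute)
qed

section \<open>From level sets to functions, and from one dimension to \<open>n\<close>\<close>

lemma layer_cake_truncated:
  fixes F :: "real \<Rightarrow> ennreal"
  assumes [measurable]: "F \<in> borel_measurable borel" and M: "M > 0"
  shows "(\<integral>\<^sup>+t. min (F t) (ennreal M) \<partial>lborel)
    = ennreal M * (\<integral>\<^sup>+w. indicator {0<..<1} w * emeasure lborel {t. ennreal (M * w) < F t} \<partial>lborel)"
proof -
  \<comment> \<open>The normalised level \<open>w\<close> runs through (0, 1) whatever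
    \<open>M\<close> is, so functions with different suprema can be compared at the same
    \<open>w\<close>.\<close>
  have pt: "min (F t) (ennreal M) = ennreal M * (\<integral>\<^sup>+w. indicator {0<..<1} w * indicator {t. ennreal (M * w) < F t} t \<partial>lborel)" for t
  proof (cases "F t")
    case (real x)
    have "(\<integral>\<^sup>+w. indicator {0<..<1} w * indicator {t. ennreal (M * w) < F t} t \<partial>lborel)
        = (\<integral>\<^sup>+w. indicator {0<..<min 1 (x / M)} w \<partial>lborel)"
      using M real by (intro nn_integral_cong) (auto simp: indicator_def ennreal_less_iff field_simps)
    also have "\<dots> = ennreal (min 1 (x / M))" using M real by (subst nn_integral_indicator) auto
    finally show ?thesis
      using M real by (simp add: ennreal_mult[symmetric] min_def field_simps)
  next
    case top
    then show ?thesis using M by simp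
  qed
  have "(\<integral>\<^sup>+t. min (F t) (ennreal M) \<partial>lborel)
     = ennreal M * (\<integral>\<^sup>+t. \<integral>\<^sup>+w. indicator {0<..<1} w * indicator {t. ennreal (M * w) < F t} t \<partial>lborel \<partial>lborel)"
    unfolding pt by (rule nn_integral_cmult) measurable
  also have "(\<integral>\<^sup>+t. \<integral>\<^sup>+w. indicator {0<..<1} w * indicator {t. ennreal (M * w) < F t} t \<partial>lborel \<partial>lborel)
     = (\<integral>\<^sup>+w. \<integral>\<^sup>+t. indicator {0<..<1} w * indicator {t. ennreal (M * w) < F t} t \<partial>lborel \<partial>lborel)"
    by (rule lborel_pair.Fubini'[symmetric]) (simp add: indicator_def[abs_def] cong: if_cong)
  also have "\<dots> = (\<integral>\<^sup>+w. indicator {0<..<1} w * emeasure lborel {t. ennreal (M * w) < F t} \<partial>lborel)"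
    by (subst nn_integral_cmult) auto
  finally show ?thesis .
qed

text \<open>Radon's inequality: convexity of \<open>t ^ (k + 1)\<close> at \<open>a0 / b0\<close>
  and \<open>a1 / b1\<close>, with weights proportional to \<open>b0\<close> and \<open>b1\<close>.
  It recombines the two normalised level-set integrals into one power of
  \<open>b0 + b1\<close>.\<close>

lemma power_mediant_inequality:
  fixes a0 a1 b0 b1 :: real
  assumes "a0 > 0" "a1 > 0" "b0 > 0" "b1 > 0"
  shows "(a0 + a1) ^ (k + 1) \<le> (a0 ^ (k + 1) / b0 ^ k + a1 ^ (k + 1) / b1 ^ k) * (b0 + b1) ^ k"
proof -
  let ?u = "b1 / (b0 + b1)"
  have b: "b0 + b1 > 0" using assms by simp
  have cv: "convex_on {0::real..} (\<lambda>x. x ^ (k + 1))"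
    by (cases "even (k + 1)") (blast intro: convex_on_subset[OF convex_power_even], rule convex_power_odd)
  have u: "1 - ?u = b0 / (b0 + b1)" using b by (simp add: field_simps)
  have "((1 - ?u) *\<^sub>R (a0 / b0) + ?u *\<^sub>R (a1 / b1)) ^ (k + 1) \<le> (1 - ?u) * (a0 / b0) ^ (k + 1) + ?u * (a1 / b1) ^ (k + 1)"
    by (rule convex_onD[OF cv]) (use assms in \<open>auto simp: field_simps\<close>)
  then have "((a0 + a1) / (b0 + b1)) ^ (k + 1) \<le> (b0 * (a0 / b0) ^ (k + 1) + b1 * (a1 / b1) ^ (k + 1)) / (b0 + b1)"
    unfolding u using assms by (simp add: add_divide_distrib)
  also have "\<dots> = (a0 ^ (k + 1) / b0 ^ k + a1 ^ (k + 1) / b1 ^ k) / (b0 + b1)"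
    using assms by (simp add: power_divide)
  finally have "((a0 + a1) / (b0 + b1)) ^ (k + 1) * (b0 + b1) ^ (k + 1)
      \<le> (a0 ^ (k + 1) / b0 ^ k + a1 ^ (k + 1) / b1 ^ k) / (b0 + b1) * (b0 + b1) ^ (k + 1)"
    using b by (intro mult_right_mono) auto
  also have "((a0 + a1) / (b0 + b1)) ^ (k + 1) * (b0 + b1) ^ (k + 1) = (a0 + a1) ^ (k + 1)"
    using b unfolding power_mult_distrib[symmetric] by simp
  also have "(a0 ^ (k + 1) / b0 ^ k + a1 ^ (k + 1) / b1 ^ k) / (b0 + b1) * (b0 + b1) ^ (k + 1)
    = (a0 ^ (k + 1) / b0 ^ k + a1 ^ (k + 1) / b1 ^ k) * (b0 + b1) ^ k"
    using b by (simp only: power_add power_one_right) simp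
  finally show ?thesis .
qed

lemma min_SUP_of_nat_ennreal: "(SUP c. min x (of_nat (Suc c))) = (x :: ennreal)"
proof -
  have "(SUP c. min x (of_nat (Suc c))) = min x (SUP c. of_nat (Suc c))"
    unfolding inf_min[symmetric] by (rule inf_SUP[symmetric])
  also have "(SUP c. of_nat (Suc c)) = (top :: ennreal)"
    unfolding SUP_eq_top_iff
  proof (intro allI impI)
    fix y :: ennreal assume "y < top"
    then obtain c :: nat where "y < of_nat c" using ennreal_Ex_less_of_nat by (metis infinity_ennreal_def)
    then show "\<exists>c\<in>UNIV. y < of_nat (Suc c)"
      by (intro bexI[of _ c]) (auto intro: less_trans simp: of_nat_Suc)
  qed
  finally show ?thesis by simp
qed

(* In this form, with F ^ (-1/m) subadditive stated through lower bounds F >= 1 / b ^ m, no roots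
   occur and the exponent simply drops by one with every integration. The level sets are compared
   after normalising both suprema, so that the two of them are nonempty at the same time. *)
lemma borell_brascamp_lieb_real_bounded:
  fixes F0 F1 F2 :: "real \<Rightarrow> ennreal"
  assumes [measurable]: "F0 \<in> borel_measurable borel" "F1 \<in> borel_measurable borel" "F2 \<in> borel_measurable borel"
    and bound: "\<And>t. F0 t \<le> ennreal c0" "\<And>t. F1 t \<le> ennreal c1"
    and F: "\<And>t0 t1 b0 b1. b0 > 0 \<Longrightarrow> b1 > 0 \<Longrightarrow> ennreal (1 / b0 ^ (k + 1)) \<le> F0 t0 \<Longrightarrow>
        ennreal (1 / b1 ^ (k + 1)) \<le> F1 t1 \<Longrightarrow> ennreal (1 / (b0 + b1) ^ (k + 1)) \<le> F2 (t0 + t1)"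
    and b: "b0 > 0" "b1 > 0"
    and I: "ennreal (1 / b0 ^ k) \<le> (\<integral>\<^sup>+t. F0 t \<partial>lborel)" "ennreal (1 / b1 ^ k) \<le> (\<integral>\<^sup>+t. F1 t \<partial>lborel)"
  shows "ennreal (1 / (b0 + b1) ^ k) \<le> (\<integral>\<^sup>+t. F2 t \<partial>lborel)"
proof -
  \<comment> \<open>The supremum of \<open>G\<close> is written as \<open>1 / a ^ (k + 1)\<close>.
    It is finite by boundedness and positive because the integral is.\<close>
  have sup: "\<exists>a>0. (\<forall>t. G t \<le> ennreal (1 / a ^ (k + 1))) \<and> (\<forall>M < 1 / a ^ (k + 1). \<exists>t. ennreal M < G t)"
    if bd: "\<And>t. G t \<le> ennreal c" and pos: "ennreal (1 / b ^ k) \<le> (\<integral>\<^sup>+t. G t \<partial>lborel)" "b > 0"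
    for G :: "real \<Rightarrow> ennreal" and c b :: real
  proof -
    let ?S = "SUP t. G t"
    have "?S \<le> ennreal c" by (rule SUP_least) (rule bd)
    then have fin: "?S < top" by (rule order_le_less_trans) simp
    have ne0: "?S \<noteq> 0"
    proof
      assume "?S = 0"
      then have "G t = 0" for t using SUP_upper[of t UNIV G] by simp
      then have "ennreal (1 / b ^ k) \<le> 0" using pos(1) by simp
      then show False using pos(2) by simp
    qed
    define S where "S = enn2real ?S"
    have S: "S > 0" "ennreal S = ?S" using fin ne0 by (auto simp: S_def enn2real_positive_iff top.not_eq_extremum zero_less_iff_neq_zero)
    define a where "a = 1 / root (k + 1) S"
    have a: "a > 0" "1 / a ^ (k + 1) = S"
      using S(1) unfolding a_def by (auto simp: power_one_over real_root_pow_pos2 simp del: power_Suc)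
    have "G t \<le> ennreal S" for t unfolding S by (rule SUP_upper) simp
    moreover have "\<exists>t. ennreal M < G t" if "M < S" for M
    proof -
      have "ennreal M < ?S" using that S by (metis ennreal_lessI)
      then show ?thesis by (auto simp: less_SUP_iff)
    qed
    ultimately show ?thesis using a by metis
  qed
  obtain a0 where a0: "a0 > 0" "\<And>t. F0 t \<le> ennreal (1 / a0 ^ (k + 1))" "\<And>M. M < 1 / a0 ^ (k + 1) \<Longrightarrow> \<exists>t. ennreal M < F0 t"
    using sup[OF bound(1) I(1) b(1)] by blast
  obtain a1 where a1: "a1 > 0" "\<And>t. F1 t \<le> ennreal (1 / a1 ^ (k + 1))" "\<And>M. M < 1 / a1 ^ (k + 1) \<Longrightarrow> \<exists>t. ennreal M < F1 t"
    using sup[OF bound(2) I(2) b(2)] by blast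
  define M where "M a = 1 / a ^ (k + 1)" for a :: real
  have Mpos: "M a > 0" if "a > 0" for a using that by (simp add: M_def)
  define A where "A = a0 + a1"
  have A: "A > 0" using a0 a1 by (simp add: A_def)
  define l where "l F a w = indicator {0<..<1::real} w * emeasure lborel {t. ennreal (M a * w) < F t}"
    for F :: "real \<Rightarrow> ennreal" and a w
  have lm [measurable]: "l F a \<in> borel_measurable borel" if [measurable]: "F \<in> borel_measurable borel" for F a
  proof -
    have "Measurable.pred (borel \<Otimes>\<^sub>M lborel) (\<lambda>p. ennreal (M a * fst p) < F (snd p))" by measurable
    then have "(\<lambda>w. emeasure lborel {t. ennreal (M a * w) < F t}) \<in> borel_measurable borel"
      using lborel.measurable_emeasure_Pair[of "{p \<in> space (borel \<Otimes>\<^sub>M lborel). ennreal (M a * fst p) < F (snd p)}" borel]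
      by (simp add: space_pair_measure vimage_def)
    then show ?thesis unfolding l_def by measurable
  qed
  have level: "l F0 a0 w + l F1 a1 w \<le> l F2 A w" for w
  proof (cases "w \<in> {0<..<1}")
    case True
    have "emeasure lborel {t. ennreal (M a0 * w) < F0 t} + emeasure lborel {t. ennreal (M a1 * w) < F1 t}
        \<le> emeasure lborel {t. ennreal (M A * w) < F2 t}"
    proof (rule brunn_minkowski_real)
      show "{t. ennreal (M a0 * w) < F0 t} \<noteq> {}"
        using a0(3)[of "M a0 * w", folded M_def] True Mpos[OF a0(1)] by auto
      show "{t. ennreal (M a1 * w) < F1 t} \<noteq> {}"
        using a1(3)[of "M a1 * w", folded M_def] True Mpos[OF a1(1)] by auto
      fix t0 t1 assume t: "t0 \<in> {t. ennreal (M a0 * w) < F0 t}" "t1 \<in> {t. ennreal (M a1 * w) < F1 t}"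
      \<comment> \<open>The hypothesis on \<open>F2\<close> gives only a weak inequality, while
        level sets are strict. The level is therefore raised slightly above \<open>w\<close> first,
        and strictness is regained from \<open>w < v\<close>.\<close>
      have lev: "\<exists>v>w. ennreal (M a * v) \<le> G s" if less: "ennreal (M a * w) < G s" and a: "a > 0" for G :: "real \<Rightarrow> ennreal" and a s
      proof -
        obtain y where y: "ennreal (M a * w) < y" "y < G s" using dense[OF less] by blast
        have "y < top" by (rule less_le_trans[OF y(2) top_greatest])
        then obtain r where r: "y = ennreal r" "r \<ge> 0" by (cases y) auto
        have "M a * w < r" using y(1) r True Mpos[OF a] by (simp add: ennreal_less_iff)
        then show ?thesis using y r Mpos[OF a]
          by (intro exI[of _ "r / M a"]) (auto simp: field_simps)
      qed
      obtain v0 where v0: "v0 > w" "ennreal (M a0 * v0) \<le> F0 t0" using lev[of a0 F0 t0] t a0 by auto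
      obtain v1 where v1: "v1 > w" "ennreal (M a1 * v1) \<le> F1 t1" using lev[of a1 F1 t1] t a1 by auto
      define v where "v = min v0 v1"
      have v: "v > w" "v > 0" "ennreal (M a0 * v) \<le> F0 t0" "ennreal (M a1 * v) \<le> F1 t1"
        using v0 v1 True Mpos[OF a0(1)] Mpos[OF a1(1)]
        by (auto simp: v_def intro: order_trans[OF ennreal_leI v0(2)] order_trans[OF ennreal_leI v1(2)] less_trans)
      \<comment> \<open>Dividing \<open>a0\<close> and \<open>a1\<close> by this root of
        \<open>v\<close> turns both suprema into the fraction \<open>v\<close> of themselves. Since
        \<open>a0 / u + a1 / u = A / u\<close>, the conclusion concerns the same fraction of
        \<open>1 / A ^ (k + 1)\<close>.\<close>
      define u where "u = root (k + 1) v"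
      have u: "u > 0" "u ^ (k + 1) = v"
        using v(2) by (auto simp: u_def real_root_pow_pos2 simp del: power_Suc)
      have eq: "1 / (a / u) ^ (k + 1) = M a * v" for a
        by (simp add: M_def power_divide u(2)[symmetric])
      have "ennreal (1 / (a0 / u + a1 / u) ^ (k + 1)) \<le> F2 (t0 + t1)"
        by (rule F) (use a0 a1 u v in \<open>auto simp only: eq zero_less_divide_iff\<close>)
      then have "ennreal (M A * v) \<le> F2 (t0 + t1)"
        by (simp only: add_divide_distrib[symmetric] A_def[symmetric] eq)
      moreover have "ennreal (M A * w) < ennreal (M A * v)"
        using v True Mpos[OF A] by (intro ennreal_lessI) auto
      ultimately show "t0 + t1 \<in> {t. ennreal (M A * w) < F2 t}" by auto
    qed measurable
    then show ?thesis using True by (simp add: l_def)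
  qed (simp add: l_def)
  have J: "(\<integral>\<^sup>+t. G t \<partial>lborel) = ennreal (M a) * integral\<^sup>N lborel (l G a)"
    if "\<And>t. G t \<le> ennreal (1 / a ^ (k + 1))" "a > 0" "G \<in> borel_measurable borel" for G a
    using layer_cake_truncated[OF that(3) Mpos[OF that(2)]] that(1)
    by (simp add: l_def[abs_def] M_def min_absorb1)
  have lb: "ennreal (a ^ (k + 1) / b ^ k) \<le> integral\<^sup>N lborel (l G a)"
    if "a > 0" "\<And>t. G t \<le> ennreal (1 / a ^ (k + 1))" "G \<in> borel_measurable borel"
      "b > 0" "ennreal (1 / b ^ k) \<le> (\<integral>\<^sup>+t. G t \<partial>lborel)" for a b G
  proof -
    have "ennreal (a ^ (k + 1) / b ^ k) = ennreal (a ^ (k + 1)) * ennreal (1 / b ^ k)"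
      using that by (simp add: ennreal_mult[symmetric])
    also have "\<dots> \<le> ennreal (a ^ (k + 1)) * (ennreal (M a) * integral\<^sup>N lborel (l G a))"
      using that(5) J[OF that(2,1,3)] by (intro mult_left_mono) auto
    also have "\<dots> = integral\<^sup>N lborel (l G a)"
      using that(1) by (simp add: mult.assoc[symmetric] ennreal_mult[symmetric] M_def)
    finally show ?thesis .
  qed
  note l0 = lb[OF a0(1,2) assms(1) b(1) I(1)] and l1 = lb[OF a1(1,2) assms(2) b(2) I(2)]
  have "1 / (b0 + b1) ^ k \<le> M A * (a0 ^ (k + 1) / b0 ^ k + a1 ^ (k + 1) / b1 ^ k)"
    using power_mediant_inequality[OF a0(1) a1(1) b, of k] A b
    by (simp add: M_def A_def[symmetric] field_simps)
  then have "ennreal (1 / (b0 + b1) ^ k) \<le> ennreal (M A) * (ennreal (a0 ^ (k + 1) / b0 ^ k) + ennreal (a1 ^ (k + 1) / b1 ^ k))"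
    using a0 a1 b Mpos[OF A] by (simp add: ennreal_mult[symmetric] ennreal_plus[symmetric] del: ennreal_plus power_Suc)
  also have "\<dots> \<le> ennreal (M A) * (integral\<^sup>N lborel (l F0 a0) + integral\<^sup>N lborel (l F1 a1))"
    by (intro mult_left_mono add_mono l0 l1) auto
  also have "\<dots> = ennreal (M A) * (\<integral>\<^sup>+w. l F0 a0 w + l F1 a1 w \<partial>lborel)"
    by (subst nn_integral_add) auto
  also have "\<dots> \<le> ennreal (M A) * integral\<^sup>N lborel (l F2 A)"
    by (intro mult_left_mono nn_integral_mono level) auto
  \<comment> \<open>\<open>F2\<close> may exceed the height \<open>M A\<close>; only the part below
    it is counted.\<close>
  also have "\<dots> = (\<integral>\<^sup>+t. min (F2 t) (ennreal (M A)) \<partial>lborel)"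
    using layer_cake_truncated[OF assms(3) Mpos[OF A]] by (simp add: l_def[abs_def])
  also have "\<dots> \<le> (\<integral>\<^sup>+t. F2 t \<partial>lborel)"
    by (intro nn_integral_mono) auto
  finally show ?thesis .
qed

text \<open>Truncating \<open>F0\<close> and \<open>F1\<close> at a constant preserves the
  hypothesis but lowers the integrals. The loss is paid for by stretching \<open>b0\<close> and
  \<open>b1\<close> by a factor \<open>s > 1\<close>, which then tends to 1.\<close>

lemma borell_brascamp_lieb_real:
  fixes F0 F1 F2 :: "real \<Rightarrow> ennreal"
  assumes [measurable]: "F0 \<in> borel_measurable borel" "F1 \<in> borel_measurable borel" "F2 \<in> borel_measurable borel"
    and k: "k > 0"
    and F: "\<And>t0 t1 b0 b1. b0 > 0 \<Longrightarrow> b1 > 0 \<Longrightarrow> ennreal (1 / b0 ^ (k + 1)) \<le> F0 t0 \<Longrightarrow>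
        ennreal (1 / b1 ^ (k + 1)) \<le> F1 t1 \<Longrightarrow> ennreal (1 / (b0 + b1) ^ (k + 1)) \<le> F2 (t0 + t1)"
    and b: "b0 > 0" "b1 > 0"
    and I: "ennreal (1 / b0 ^ k) \<le> (\<integral>\<^sup>+t. F0 t \<partial>lborel)" "ennreal (1 / b1 ^ k) \<le> (\<integral>\<^sup>+t. F1 t \<partial>lborel)"
  shows "ennreal (1 / (b0 + b1) ^ k) \<le> (\<integral>\<^sup>+t. F2 t \<partial>lborel)"
proof -
  have trunc: "\<exists>c. ennreal (1 / (b * s) ^ k) \<le> (\<integral>\<^sup>+t. min (G t) (of_nat (Suc c)) \<partial>lborel)"
    if [measurable]: "G \<in> borel_measurable borel" and G: "ennreal (1 / b ^ k) \<le> (\<integral>\<^sup>+t. G t \<partial>lborel)"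
      and "b > 0" "s > 1" for G :: "real \<Rightarrow> ennreal" and b s :: real
  proof -
    have "(\<integral>\<^sup>+t. G t \<partial>lborel) = (\<integral>\<^sup>+t. (SUP c. min (G t) (of_nat (Suc c))) \<partial>lborel)"
      by (simp only: min_SUP_of_nat_ennreal)
    also have "\<dots> = (SUP c. \<integral>\<^sup>+t. min (G t) (of_nat (Suc c)) \<partial>lborel)"
    proof (rule nn_integral_monotone_convergence_SUP[where f = "\<lambda>c t. min (G t) (of_nat (Suc c))"])
      show "incseq (\<lambda>c t. min (G t) (of_nat (Suc c)))"
        by (intro monoI le_funI min.mono) auto
      show "(\<lambda>t. min (G t) (of_nat (Suc c))) \<in> borel_measurable lborel" for c
        by (intro borel_measurable_min) auto
    qed
    finally have *: "(\<integral>\<^sup>+t. G t \<partial>lborel) = (SUP c. \<integral>\<^sup>+t. min (G t) (of_nat (Suc c)) \<partial>lborel)" .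
    \<comment> \<open>The strict gap, which uses \<open>k > 0\<close>, is what makes some truncation
      reach the stretched bound.\<close>
    have "b ^ k < (b * s) ^ k" using that k by (intro power_strict_mono) auto
    then have "ennreal (1 / (b * s) ^ k) < ennreal (1 / b ^ k)"
      using that by (intro ennreal_lessI) (auto simp: field_simps)
    then have "ennreal (1 / (b * s) ^ k) < (SUP c. \<integral>\<^sup>+t. min (G t) (of_nat (Suc c)) \<partial>lborel)"
      using G * by simp
    then show ?thesis unfolding less_SUP_iff using less_imp_le by blast
  qed
  have scaled: "ennreal (1 / ((b0 + b1) * s) ^ k) \<le> (\<integral>\<^sup>+t. F2 t \<partial>lborel)" if s: "s > 1" for s
  proof -
    obtain c0 where c0: "ennreal (1 / (b0 * s) ^ k) \<le> (\<integral>\<^sup>+t. min (F0 t) (of_nat (Suc c0)) \<partial>lborel)"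
      using trunc[OF assms(1) I(1) b(1) s] by blast
    obtain c1 where c1: "ennreal (1 / (b1 * s) ^ k) \<le> (\<integral>\<^sup>+t. min (F1 t) (of_nat (Suc c1)) \<partial>lborel)"
      using trunc[OF assms(2) I(2) b(2) s] by blast
    have "ennreal (1 / (b0 * s + b1 * s) ^ k) \<le> (\<integral>\<^sup>+t. F2 t \<partial>lborel)"
    proof (rule borell_brascamp_lieb_real_bounded[where ?F0.0 = "\<lambda>t. min (F0 t) (of_nat (Suc c0))"
          and ?F1.0 = "\<lambda>t. min (F1 t) (of_nat (Suc c1))" and ?c0.0 = "real (Suc c0)" and ?c1.0 = "real (Suc c1)"])
      show "0 < b0 * s" "0 < b1 * s" using b s by auto
    qed (use c0 c1 F in \<open>simp_all add: ennreal_of_nat_eq_real_of_nat del: of_nat_Suc\<close>)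
    then show ?thesis by (simp add: distrib_right)
  qed
  have "(\<lambda>j. ennreal (1 / ((b0 + b1) * (1 + inverse (real (Suc j)))) ^ k)) \<longlonglongrightarrow> ennreal (1 / ((b0 + b1) * (1 + 0)) ^ k)"
    using b by (intro tendsto_ennrealI tendsto_intros LIMSEQ_inverse_real_of_nat) auto
  then have "ennreal (1 / ((b0 + b1) * (1 + 0)) ^ k) \<le> (\<integral>\<^sup>+t. F2 t \<partial>lborel)"
    by (rule LIMSEQ_le_const2) (use scaled in auto)
  then show ?thesis by simp
qed

text \<open>Integrating out a coordinate preserves the hypothesis and lowers its exponent by one:
  the fibre integrals satisfy it again by the one-dimensional case. The induction thus leads from
  \<open>k + n\<close> down to \<open>k\<close>.\<close>

lemma borell_brascamp_lieb:
  fixes F0 F1 F2 :: "(nat \<Rightarrow> real) \<Rightarrow> ennreal"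
  assumes "F0 \<in> borel_measurable borel" "F1 \<in> borel_measurable borel" "F2 \<in> borel_measurable borel"
    and k: "k > 0"
    and F: "\<And>x0 x1 b0 b1. b0 > 0 \<Longrightarrow> b1 > 0 \<Longrightarrow> ennreal (1 / b0 ^ (k + n)) \<le> F0 x0 \<Longrightarrow>
        ennreal (1 / b1 ^ (k + n)) \<le> F1 x1 \<Longrightarrow> ennreal (1 / (b0 + b1) ^ (k + n)) \<le> F2 (\<lambda>i. x0 i + x1 i)"
    and b: "b0 > 0" "b1 > 0"
    and I: "ennreal (1 / b0 ^ k) \<le> (\<integral>\<^sup>+x. F0 x \<partial>lborel_n n)" "ennreal (1 / b1 ^ k) \<le> (\<integral>\<^sup>+x. F1 x \<partial>lborel_n n)"
  shows "ennreal (1 / (b0 + b1) ^ k) \<le> (\<integral>\<^sup>+x. F2 x \<partial>lborel_n n)"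
  using assms(1-3) F I
proof (induction n arbitrary: F0 F1 F2)
  case 0
  then show ?case using 0(4)[of b0 b1 "\<lambda>_. 0" "\<lambda>_. 0"] b by (simp add: nn_integral_lborel_n_0)
next
  case (Suc n)
  note [measurable] = Suc.prems(1-3)
  have eq: "(\<integral>\<^sup>+x. G x \<partial>lborel_n (Suc n)) = (\<integral>\<^sup>+x. \<integral>\<^sup>+t. G (x(n := t)) \<partial>lborel \<partial>lborel_n n)"
    if "G \<in> borel_measurable borel" for G
    by (rule nn_integral_lborel_n_Suc[OF that])
  have m: "(\<lambda>x. \<integral>\<^sup>+t. G (x(n := t)) \<partial>lborel) \<in> borel_measurable borel"
    if [measurable]: "G \<in> borel_measurable borel" for G :: "(nat \<Rightarrow> real) \<Rightarrow> ennreal"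
    by measurable
  show ?case
    unfolding eq[OF Suc.prems(3)]
  proof (rule Suc.IH[OF m[OF Suc.prems(1)] m[OF Suc.prems(2)] m[OF Suc.prems(3)] _
        Suc.prems(5)[unfolded eq[OF Suc.prems(1)]] Suc.prems(6)[unfolded eq[OF Suc.prems(2)]]])
    fix x0 x1 :: "nat \<Rightarrow> real" and b0 b1 :: real
    assume *: "b0 > 0" "b1 > 0" "ennreal (1 / b0 ^ (k + n)) \<le> (\<integral>\<^sup>+t. F0 (x0(n := t)) \<partial>lborel)"
      "ennreal (1 / b1 ^ (k + n)) \<le> (\<integral>\<^sup>+t. F1 (x1(n := t)) \<partial>lborel)"
    show "ennreal (1 / (b0 + b1) ^ (k + n)) \<le> (\<integral>\<^sup>+t. F2 ((\<lambda>i. x0 i + x1 i)(n := t)) \<partial>lborel)"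
    proof (rule borell_brascamp_lieb_real[where ?F0.0 = "\<lambda>t. F0 (x0(n := t))" and ?F1.0 = "\<lambda>t. F1 (x1(n := t))"])
      fix t0 t1 c0 c1 :: real
      assume c: "c0 > 0" "c1 > 0" "ennreal (1 / c0 ^ (k + n + 1)) \<le> F0 (x0(n := t0))"
        "ennreal (1 / c1 ^ (k + n + 1)) \<le> F1 (x1(n := t1))"
      have "(\<lambda>i. (x0(n := t0)) i + (x1(n := t1)) i) = (\<lambda>i. x0 i + x1 i)(n := t0 + t1)" by auto
      moreover have "ennreal (1 / (c0 + c1) ^ (k + Suc n)) \<le> F2 (\<lambda>i. (x0(n := t0)) i + (x1(n := t1)) i)"
        by (rule Suc.prems(4)[of c0 c1 "x0(n := t0)" "x1(n := t1)"])
          (use c in \<open>simp_all only: add.assoc Suc_eq_plus1\<close>)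
      ultimately show "ennreal (1 / (c0 + c1) ^ (k + n + 1)) \<le> F2 ((\<lambda>i. x0 i + x1 i)(n := t0 + t1))"
        by (simp only: add_Suc_right Suc_eq_plus1[symmetric] add_0_right One_nat_def)
    qed (use * k in auto)
  qed
qed

section \<open>Smoothing a convex body\<close>

lemma inner_n_measurable [measurable]:
  assumes "f \<in> M \<rightarrow>\<^sub>M (borel :: (nat \<Rightarrow> real) measure)" "g \<in> M \<rightarrow>\<^sub>M (borel :: (nat \<Rightarrow> real) measure)"
  shows "(\<lambda>w. inner_n n (f w) (g w)) \<in> borel_measurable M"
  unfolding inner_n_def
  by (intro borel_measurable_sum borel_measurable_times measurable_compose[OF assms(1) borel_measurable_coordinate]
      measurable_compose[OF assms(2) borel_measurable_coordinate])

lemma norm_n_measurable [measurable]: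
  assumes [measurable]: "f \<in> M \<rightarrow>\<^sub>M (borel :: (nat \<Rightarrow> real) measure)"
  shows "(\<lambda>w. norm_n n (f w)) \<in> borel_measurable M"
  unfolding norm_n_def by measurable

lemma pointwise_diff_measurable [measurable]:
  assumes "f \<in> M \<rightarrow>\<^sub>M (borel :: (nat \<Rightarrow> real) measure)" "g \<in> M \<rightarrow>\<^sub>M (borel :: (nat \<Rightarrow> real) measure)"
  shows "(\<lambda>w i. f w i - g w i) \<in> M \<rightarrow>\<^sub>M borel"
  by (intro measurable_coordinatewise_then_product borel_measurable_diff
      measurable_compose[OF assms(1) borel_measurable_coordinate] measurable_compose[OF assms(2) borel_measurable_coordinate])

lemma pointwise_add_measurable [measurable]:
  assumes "f \<in> M \<rightarrow>\<^sub>M (borel :: (nat \<Rightarrow> real) measure)" "g \<in> M \<rightarrow>\<^sub>M (borel :: (nat \<Rightarrow> real) measure)"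
  shows "(\<lambda>w i. f w i + g w i) \<in> M \<rightarrow>\<^sub>M borel"
  by (intro measurable_coordinatewise_then_product borel_measurable_add
      measurable_compose[OF assms(1) borel_measurable_coordinate] measurable_compose[OF assms(2) borel_measurable_coordinate])

lemma pointwise_scale_measurable [measurable]:
  assumes "c \<in> borel_measurable M" "f \<in> M \<rightarrow>\<^sub>M (borel :: (nat \<Rightarrow> real) measure)"
  shows "(\<lambda>w i. c w * f w i) \<in> M \<rightarrow>\<^sub>M borel"
  by (intro measurable_coordinatewise_then_product borel_measurable_times assms(1)
      measurable_compose[OF assms(2) borel_measurable_coordinate])

lemma pointwise_divide_measurable [measurable]:
  assumes "c \<in> borel_measurable M" "f \<in> M \<rightarrow>\<^sub>M (borel :: (nat \<Rightarrow> real) measure)"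
  shows "(\<lambda>w i. f w i / c w) \<in> M \<rightarrow>\<^sub>M borel"
  by (intro measurable_coordinatewise_then_product borel_measurable_divide assms(1)
      measurable_compose[OF assms(2) borel_measurable_coordinate])

lemma pointwise_uminus_measurable [measurable]:
  assumes "f \<in> M \<rightarrow>\<^sub>M (borel :: (nat \<Rightarrow> real) measure)"
  shows "(\<lambda>w i. - f w i) \<in> M \<rightarrow>\<^sub>M borel"
  by (intro measurable_coordinatewise_then_product borel_measurable_uminus
      measurable_compose[OF assms(1) borel_measurable_coordinate])

lemma Rn_in_borel [measurable]: "Rn n \<in> sets borel"
  using closedin_Euclidean_imp_closed[OF closedin_topspace[of "Euclidean_space n"]] by (rule borel_closed)

lemma norm_n_eq_L2_set: "norm_n n x = L2_set x {..<n}"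
  by (simp add: norm_n_def inner_n_def L2_set_def power2_eq_square)

lemma norm_n_nonneg [simp]: "0 \<le> norm_n n x"
  by (simp add: norm_n_eq_L2_set)

lemma norm_n_power2: "(norm_n n x)\<^sup>2 = (\<Sum>i<n. (x i)\<^sup>2)"
  by (simp add: norm_n_eq_L2_set L2_set_def sum_nonneg)

lemma norm_n_triangle: "norm_n n (\<lambda>i. x i + y i) \<le> norm_n n x + norm_n n y"
  unfolding norm_n_eq_L2_set by (rule L2_set_triangle_ineq)

lemma norm_n_scale: "norm_n n (\<lambda>i. c * x i) = \<bar>c\<bar> * norm_n n x"
  unfolding norm_n_eq_L2_set by (simp add: L2_set_def power_mult_distrib sum_distrib_left[symmetric] real_sqrt_mult)

lemma norm_n_divide: "norm_n n (\<lambda>i. x i / c) = norm_n n x / \<bar>c\<bar>"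
  using norm_n_scale[of n "1 / c" x] by simp

lemma norm_n_minus: "norm_n n (\<lambda>i. - x i) = norm_n n x"
  using norm_n_scale[of n "-1" x] by simp

lemma norm_n_diff_commute: "norm_n n (\<lambda>i. x i - y i) = norm_n n (\<lambda>i. y i - x i)"
  using norm_n_minus[of n "\<lambda>i. x i - y i"] by simp

lemma norm_n_triangle_sub: "norm_n n x \<le> norm_n n y + norm_n n (\<lambda>i. x i - y i)"
  using norm_n_triangle[of n y "\<lambda>i. x i - y i"] by simp

lemma inner_n_Cauchy_Schwarz: "\<bar>inner_n n x y\<bar> \<le> norm_n n x * norm_n n y"
  unfolding norm_n_eq_L2_set inner_n_def
  by (rule order_trans[OF sum_abs]) (use L2_set_mult_ineq[of x y "{..<n}"] in \<open>simp add: abs_mult\<close>)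

lemma norm_n_coordinate: "i < n \<Longrightarrow> \<bar>x i\<bar> \<le> norm_n n x"
  unfolding norm_n_eq_L2_set using member_le_L2_set[where A = "{..<n}" and i = i and f = "\<lambda>i. \<bar>x i\<bar>"] by (simp add: L2_set_def)

lemma norm_n_eq_0_iff: "x \<in> Rn n \<Longrightarrow> norm_n n x = 0 \<longleftrightarrow> x = (\<lambda>_. 0)"
  unfolding norm_n_eq_L2_set by (auto simp: L2_set_eq_0_iff topspace_Euclidean_space fun_eq_iff not_less[symmetric])

lemma norm_n_zero [simp]: "norm_n n (\<lambda>_. 0) = 0"
  by (simp add: norm_n_eq_L2_set L2_set_eq_0_iff)

lemma Rn_zero [simp]: "(\<lambda>_. 0) \<in> Rn n"
  by (simp add: topspace_Euclidean_space)

lemma Rn_add: "x \<in> Rn n \<Longrightarrow> y \<in> Rn n \<Longrightarrow> (\<lambda>i. x i + y i) \<in> Rn n"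
  by (simp add: topspace_Euclidean_space)

lemma Rn_scale: "x \<in> Rn n \<Longrightarrow> (\<lambda>i. c * x i) \<in> Rn n"
  by (simp add: topspace_Euclidean_space)

lemma Rn_divide: "x \<in> Rn n \<Longrightarrow> (\<lambda>i. x i / c) \<in> Rn n"
  by (simp add: topspace_Euclidean_space)

lemma Rn_minus: "x \<in> Rn n \<Longrightarrow> (\<lambda>i. - x i) \<in> Rn n"
  by (simp add: topspace_Euclidean_space)

section \<open>Calculus for radial integrals and geometric means\<close>

lemma nn_integral_inverse_power_tail:
  assumes "a > 0" "p > 0"
  shows "(\<integral>\<^sup>+s. indicator {a..} s * ennreal (1 / s ^ (p + 1)) \<partial>lborel) = ennreal (1 / (real p * a ^ p))"
proof -
  have "(\<integral>\<^sup>+s. ennreal (1 / s ^ (p + 1)) * indicator {a..} s \<partial>lborel) = ennreal (0 - (- 1 / (real p * a ^ p)))"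
  proof (rule nn_integral_FTC_atLeast)
    show "((\<lambda>s. - 1 / (real p * s ^ p)) \<longlongrightarrow> 0) at_top"
      using assms by (intro real_tendsto_divide_at_top[OF tendsto_const]
          filterlim_tendsto_pos_mult_at_top[OF tendsto_const] filterlim_pow_at_top filterlim_ident) auto
    fix s assume "a \<le> s"
    then have s: "s > 0" using assms by simp
    have "((\<lambda>s. - 1 / (real p * s ^ p)) has_real_derivative (real p * (real p * s ^ (p - 1))) / (real p * s ^ p)\<^sup>2) (at s)"
      using s assms by (auto intro!: derivative_eq_intros simp: power2_eq_square)
    also have "(real p * (real p * s ^ (p - 1))) / (real p * s ^ p)\<^sup>2 = 1 / s ^ (p + 1)"
    proof -
      have "s ^ p = s * s ^ (p - 1)" using assms(2) by (cases p) auto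
      then show ?thesis using s assms by (simp add: power2_eq_square field_simps)
    qed
    finally show "((\<lambda>s. - 1 / (real p * s ^ p)) has_real_derivative 1 / s ^ (p + 1)) (at s)" .
    show "0 \<le> 1 / s ^ (p + 1)" using s by simp
  qed measurable
  then show ?thesis by (simp add: mult.commute)
qed

lemma norm_ball_borel [measurable]: "{z. norm_n n z \<le> t} \<in> sets borel"
  by measurable

lemma emeasure_norm_ball_finite: "emeasure (lborel_n n) {z. norm_n n z \<le> t} < \<infinity>"
  by (rule emeasure_bounded_coordinates_finite[of _ n t]) (auto intro: order_trans[OF norm_n_coordinate])

text \<open>Power means tend to the geometric mean as the exponent tends to 0: the logarithm
  \<open>g\<close> of the mean vanishes at 0 with derivative \<open>- (ln a + ln b) / 2\<close>, and
  \<open>Suc k\<close> is the reciprocal of the increment.\<close>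

lemma power_mean_limit:
  fixes a b :: real
  assumes "a > 0" "b > 0"
  shows "(\<lambda>k. ((a powr (- 1 / real (Suc k)) + b powr (- 1 / real (Suc k))) / 2) ^ Suc k) \<longlonglongrightarrow> exp (- (ln a + ln b) / 2)"
proof -
  define g where "g h = ln ((exp (- ln a * h) + exp (- ln b * h)) / 2)" for h :: real
  have pw: "c powr (- 1 / h) = exp (- ln c * inverse h)" if "c > 0" for c h :: real
    using that by (simp add: powr_def divide_inverse)
  have g0: "g 0 = 0" by (simp add: g_def)
  have pos: "exp (- ln a * h) + exp (- ln b * h) > 0" for h by (intro add_pos_pos) auto
  have "(g has_real_derivative (- (ln a + ln b) / 2)) (at 0)"
    unfolding g_def by (auto intro!: derivative_eq_intros simp: field_simps)
  then have lim: "((\<lambda>h. (g (0 + h) - g 0) / h) \<longlongrightarrow> (- (ln a + ln b) / 2)) (at 0)"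
    by (simp add: DERIV_def)
  have "filterlim (\<lambda>k. inverse (real (Suc k))) (at 0) sequentially"
    using LIMSEQ_inverse_real_of_nat by (simp add: filterlim_at)
  from filterlim_compose[OF lim this]
  have "(\<lambda>k. (g (0 + inverse (real (Suc k))) - g 0) / inverse (real (Suc k))) \<longlonglongrightarrow> (- (ln a + ln b) / 2)" .
  moreover have "(g (0 + inverse (real (Suc k))) - g 0) / inverse (real (Suc k)) = real (Suc k) * g (inverse (real (Suc k)))" for k
    by (simp only: add_0_left g0 diff_zero divide_inverse inverse_inverse_eq mult.commute)
  ultimately have "(\<lambda>k. real (Suc k) * g (inverse (real (Suc k)))) \<longlonglongrightarrow> (- (ln a + ln b) / 2)"
    by (simp only:)
  then have "(\<lambda>k. exp (real (Suc k) * g (inverse (real (Suc k))))) \<longlonglongrightarrow> exp (- (ln a + ln b) / 2)"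
    by (rule tendsto_exp)
  moreover have "exp (real (Suc k) * g (inverse (real (Suc k))))
      = ((a powr (- 1 / real (Suc k)) + b powr (- 1 / real (Suc k))) / 2) ^ Suc k" for k
  proof -
    have "exp (real (Suc k) * g (inverse (real (Suc k)))) = exp (g (inverse (real (Suc k)))) ^ Suc k"
      by (rule exp_of_nat_mult)
    also have "exp (g (inverse (real (Suc k)))) = (a powr (- 1 / real (Suc k)) + b powr (- 1 / real (Suc k))) / 2"
      unfolding g_def pw[OF assms(1)] pw[OF assms(2)] using pos by (subst exp_ln) auto
    finally show ?thesis .
  qed
  ultimately show ?thesis by (simp only:)
qed

text \<open>\<open>R\<close> is the radius of the smoothing ball, \<open>r\<close> a radius within
  which \<open>f\<close> stays above 3/4, and \<open>T\<close> one beyond which it vanishes. By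
  \<open>K_core\<close>, a ball of radius \<open>R\<close> centred within distance \<open>r\<close>
  of the origin contains the core of \<open>K\<close>. Isotropy enters later, with
  \<open>isotropic_smoothing\<close>.\<close>

locale smoothed_body =
  fixes n :: nat and K :: "(nat \<Rightarrow> real) set" and R r T :: real
  assumes n_pos: "n > 0"
    and K_borel [measurable]: "K \<in> sets borel"
    and K_Rn: "K \<subseteq> Rn n"
    and K_convex: "convex_n K"
    and K_symmetric: "symmetric_body K"
    and K_volume: "emeasure (lborel_n n) K = 1"
    and R_pos: "R > 0" and r_pos: "r > 0"
    and K_core: "3 / 4 \<le> measure (lborel_n n) {y \<in> K. norm_n n y \<le> R - r}"
    and K_norm: "\<And>y. y \<in> K \<Longrightarrow> norm_n n y \<le> T - R"
begin

definition f :: "(nat \<Rightarrow> real) \<Rightarrow> real" where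
  "f x = measure (lborel_n n) {y \<in> K. norm_n n (\<lambda>i. x i - y i) \<le> R}"

lemma emeasure_subset_K: "A \<subseteq> K \<Longrightarrow> emeasure (lborel_n n) A \<le> 1"
  using emeasure_mono[of A K "lborel_n n"] K_volume by simp

lemma f_emeasure: "ennreal (f x) = emeasure (lborel_n n) {y \<in> K. norm_n n (\<lambda>i. x i - y i) \<le> R}"
  unfolding f_def
  by (rule emeasure_eq_ennreal_measure[symmetric])
     (use emeasure_subset_K[of "{y \<in> K. norm_n n (\<lambda>i. x i - y i) \<le> R}"] in \<open>auto simp: top_unique\<close>)

lemma f_nonneg [simp]: "0 \<le> f x"
  by (simp add: f_def)

lemma f_le_1: "f x \<le> 1"
proof -
  have "ennreal (f x) \<le> ennreal 1" unfolding f_emeasure using emeasure_subset_K by simp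
  then show ?thesis by simp
qed

lemma f_eq_nn_integral: "ennreal (f x) = (\<integral>\<^sup>+y. indicator K y * indicator {z. norm_n n z \<le> R} (\<lambda>i. x i - y i) \<partial>lborel_n n)"
proof -
  have "ennreal (f x) = (\<integral>\<^sup>+y. indicator {y \<in> K. norm_n n (\<lambda>i. x i - y i) \<le> R} y \<partial>lborel_n n)"
    by (simp add: f_emeasure)
  also have "\<dots> = (\<integral>\<^sup>+y. indicator K y * indicator {z. norm_n n z \<le> R} (\<lambda>i. x i - y i) \<partial>lborel_n n)"
    by (intro nn_integral_cong) (auto simp: indicator_def)
  finally show ?thesis .
qed

lemma f_measurable [measurable]: "f \<in> borel_measurable borel"
proof -
  have "(\<lambda>x. \<integral>\<^sup>+y. indicator K y * indicator {z. norm_n n z \<le> R} (\<lambda>i. x i - y i) \<partial>lborel_n n) \<in> borel_measurable borel"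
    by measurable
  then have "(\<lambda>x. ennreal (f x)) \<in> borel_measurable borel"
    unfolding f_eq_nn_integral .
  then have "(\<lambda>x. enn2real (ennreal (f x))) \<in> borel_measurable borel" by measurable
  then show ?thesis by simp
qed

lemma K_minus: "y \<in> K \<longleftrightarrow> (\<lambda>i. - y i) \<in> K"
proof -
  have 1: "(\<lambda>i. - y i) \<in> K" if "y \<in> K" for y
    using K_symmetric that unfolding symmetric_body_def by (metis imageI)
  show ?thesis using 1[of y] 1[of "\<lambda>i. - y i"] by auto
qed

lemma K_convexD: "x \<in> K \<Longrightarrow> y \<in> K \<Longrightarrow> 0 \<le> u \<Longrightarrow> 0 \<le> v \<Longrightarrow> u + v = 1 \<Longrightarrow> (\<lambda>i. u * x i + v * y i) \<in> K"
  using K_convex unfolding convex_n_def by blast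

lemma f_minus: "f (\<lambda>i. - x i) = f x"
proof -
  have "ennreal (f (\<lambda>i. - x i)) = (\<integral>\<^sup>+y. indicator K y * indicator {z. norm_n n z \<le> R} (\<lambda>i. - x i - y i) \<partial>lborel_n n)"
    by (simp add: f_eq_nn_integral)
  also have "\<dots> = (\<integral>\<^sup>+y. indicator K (\<lambda>i. - y i) * indicator {z. norm_n n z \<le> R} (\<lambda>i. - x i - - y i) \<partial>lborel_n n)"
    by (rule nn_integral_lborel_n_reflect[symmetric]) measurable
  also have "\<dots> = ennreal (f x)"
    unfolding f_eq_nn_integral using norm_n_diff_commute[of n x]
    by (intro nn_integral_cong) (auto simp: indicator_def K_minus[symmetric])
  finally show ?thesis by simp
qed

lemma f_core: "norm_n n x \<le> r \<Longrightarrow> 3 / 4 \<le> f x"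
proof -
  assume x: "norm_n n x \<le> r"
  have "ennreal (3 / 4) \<le> emeasure (lborel_n n) {y \<in> K. norm_n n y \<le> R - r}"
    using emeasure_subset_K[of "{y \<in> K. norm_n n y \<le> R - r}"] K_core
    by (subst emeasure_eq_ennreal_measure) (auto simp: top_unique intro: ennreal_leI)
  also have "\<dots> \<le> ennreal (f x)"
    unfolding f_emeasure
  proof (rule emeasure_mono)
    have "norm_n n (\<lambda>i. x i - y i) \<le> R" if "norm_n n y \<le> R - r" for y
      using norm_n_triangle[of n x "\<lambda>i. - y i"] x that by (simp add: norm_n_minus)
    then show "{y \<in> K. norm_n n y \<le> R - r} \<subseteq> {y \<in> K. norm_n n (\<lambda>i. x i - y i) \<le> R}"
      by blast
  qed simp
  finally show ?thesis by simp
qed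

lemma f_support: "T < norm_n n x \<Longrightarrow> f x = 0"
proof -
  assume x: "T < norm_n n x"
  have "\<not> norm_n n (\<lambda>i. x i - y i) \<le> R" if "y \<in> K" for y
    using K_norm[OF that] norm_n_triangle_sub[of n x y] x by linarith
  then have "{y \<in> K. norm_n n (\<lambda>i. x i - y i) \<le> R} = {}" by blast
  then show ?thesis unfolding f_def by (simp only: measure_empty)
qed

text \<open>The perspective \<open>f (x / s) / s ^ k\<close> is the integral over \<open>z\<close>
  of \<open>s ^ -(k + n)\<close> on the set \<open>S x s\<close>. These sets add up as their
  parameters do, by convexity of \<open>K\<close> and the triangle inequality, so the n-dimensional
  Borell--Brascamp--Lieb inequality applies. All concavity of \<open>f\<close> used below comes from
  choosing \<open>k\<close>, the points and the scales here.\<close>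

lemma f_concavity:
  assumes k: "k > 0" and s: "s0 > 0" "s1 > 0" and b: "b0 > 0" "b1 > 0"
    and 0: "1 / b0 ^ k \<le> f (\<lambda>i. x0 i / s0) / s0 ^ k" and 1: "1 / b1 ^ k \<le> f (\<lambda>i. x1 i / s1) / s1 ^ k"
  shows "1 / (b0 + b1) ^ k \<le> f (\<lambda>i. (x0 i + x1 i) / (s0 + s1)) / (s0 + s1) ^ k"
proof -
  define S where "S x s = {z. (\<lambda>j. z j / s) \<in> K \<and> norm_n n (\<lambda>j. x j - z j) \<le> s * R}" for x :: "nat \<Rightarrow> real" and s :: real
  have S [measurable]: "S x s \<in> sets borel" for x s
    unfolding S_def by measurable
  define F where "F x s = (\<lambda>z. ennreal (1 / s ^ (k + n)) * indicator (S x s) z)" for x s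
  have Fm [measurable]: "F x s \<in> borel_measurable borel" for x s
    unfolding F_def by measurable
  have int: "(\<integral>\<^sup>+z. F x s z \<partial>lborel_n n) = ennreal (f (\<lambda>i. x i / s) / s ^ k)" if s: "s > 0" for x s
  proof -
    have mem: "(\<lambda>i. s * z i) \<in> S x s \<longleftrightarrow> z \<in> {y \<in> K. norm_n n (\<lambda>i. x i / s - y i) \<le> R}" for z
    proof -
      have "norm_n n (\<lambda>j. x j - s * z j) = s * norm_n n (\<lambda>j. x j / s - z j)"
        using s norm_n_scale[of n s "\<lambda>j. x j / s - z j"] by (simp add: right_diff_distrib)
      then show ?thesis using s by (simp add: S_def)
    qed
    \<comment> \<open>The dilation by \<open>s\<close> contributes \<open>s ^ n\<close> and so
      lowers the exponent from \<open>k + n\<close> to \<open>k\<close>.\<close>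
    have "(\<integral>\<^sup>+z. F x s z \<partial>lborel_n n) = ennreal (s ^ n) * (\<integral>\<^sup>+z. F x s (\<lambda>i. s * z i) \<partial>lborel_n n)"
      by (rule nn_integral_lborel_n_scale) (use s in auto)
    also have "(\<integral>\<^sup>+z. F x s (\<lambda>i. s * z i) \<partial>lborel_n n)
       = (\<integral>\<^sup>+z. ennreal (1 / s ^ (k + n)) * indicator {y \<in> K. norm_n n (\<lambda>i. x i / s - y i) \<le> R} z \<partial>lborel_n n)"
      unfolding F_def by (intro nn_integral_cong) (simp add: indicator_def mem)
    also have "\<dots> = ennreal (1 / s ^ (k + n)) * ennreal (f (\<lambda>i. x i / s))"
      unfolding f_emeasure by (rule nn_integral_cmult_indicator) simp
    finally show ?thesis
      using s by (simp add: ennreal_mult[symmetric] power_add field_simps)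
  qed
  have "ennreal (1 / (b0 + b1) ^ k) \<le> (\<integral>\<^sup>+z. F (\<lambda>i. x0 i + x1 i) (s0 + s1) z \<partial>lborel_n n)"
  proof (rule borell_brascamp_lieb[where ?F0.0 = "F x0 s0" and ?F1.0 = "F x1 s1"])
    fix z0 z1 :: "nat \<Rightarrow> real" and c0 c1 :: real
    assume c: "c0 > 0" "c1 > 0" "ennreal (1 / c0 ^ (k + n)) \<le> F x0 s0 z0" "ennreal (1 / c1 ^ (k + n)) \<le> F x1 s1 z1"
    \<comment> \<open>\<open>F x s\<close> has a single nonzero value, so a lower bound
      \<open>1 / c ^ (k + n)\<close> on it says just that \<open>z\<close> lies in
      \<open>S x s\<close> and that \<open>s \<le> c\<close>.\<close>
    have le: "s \<le> c \<and> z \<in> S x s" if "ennreal (1 / c ^ (k + n)) \<le> F x s z" "c > 0" "s > 0" for x s c z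
    proof -
      have z: "z \<in> S x s"
      proof (rule ccontr)
        assume "z \<notin> S x s"
        then have "ennreal (1 / c ^ (k + n)) \<le> 0" using that(1) by (simp add: F_def)
        then show False using that(2) by simp
      qed
      then have "1 / c ^ (k + n) \<le> 1 / s ^ (k + n)" using that by (simp add: F_def)
      then have "s ^ (k + n) \<le> c ^ (k + n)" using that by (simp add: field_simps)
      then have "s \<le> c" using that k by (simp add: power_mono_iff)
      with z show ?thesis by simp
    qed
    have z0: "s0 \<le> c0" "z0 \<in> S x0 s0" and z1: "s1 \<le> c1" "z1 \<in> S x1 s1"
      using le c s by blast+
    have "(\<lambda>i. z0 i + z1 i) \<in> S (\<lambda>i. x0 i + x1 i) (s0 + s1)"
    proof -
      have ss: "s0 + s1 > 0" using s by simp
      have "(\<lambda>i. s0 / (s0 + s1) * (z0 i / s0) + s1 / (s0 + s1) * (z1 i / s1)) \<in> K"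
      proof -
        have "s0 / (s0 + s1) + s1 / (s0 + s1) = 1" using ss by (simp add: add_divide_distrib[symmetric])
        then show ?thesis
          by (intro K_convexD) (use z0(2) z1(2) s ss in \<open>auto simp: S_def\<close>)
      qed
      also have "(\<lambda>i. s0 / (s0 + s1) * (z0 i / s0) + s1 / (s0 + s1) * (z1 i / s1)) = (\<lambda>i. (z0 i + z1 i) / (s0 + s1))"
        using s ss by (simp add: add_divide_distrib)
      finally have 1: "(\<lambda>i. (z0 i + z1 i) / (s0 + s1)) \<in> K" .
      have "norm_n n (\<lambda>i. (x0 i - z0 i) + (x1 i - z1 i)) \<le> s0 * R + s1 * R"
        using z0(2) z1(2) norm_n_triangle[of n "\<lambda>i. x0 i - z0 i" "\<lambda>i. x1 i - z1 i"] by (simp add: S_def)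
      moreover have "(\<lambda>i. (x0 i - z0 i) + (x1 i - z1 i)) = (\<lambda>i. x0 i + x1 i - (z0 i + z1 i))" by auto
      ultimately show ?thesis using 1 by (simp add: S_def distrib_right)
    qed
    moreover have "1 / (c0 + c1) ^ (k + n) \<le> 1 / (s0 + s1) ^ (k + n)"
      using z0(1) z1(1) s by (intro divide_left_mono power_mono mult_pos_pos) auto
    ultimately show "ennreal (1 / (c0 + c1) ^ (k + n)) \<le> F (\<lambda>i. x0 i + x1 i) (s0 + s1) (\<lambda>i. z0 i + z1 i)"
      by (simp add: F_def ennreal_leI)
  qed (use k b 0 1 s in \<open>auto simp: int intro: ennreal_leI\<close>)
  then show ?thesis
    using s b by (subst (asm) int) (auto simp: ennreal_le_iff)
qed

text \<open>\<open>t x\<close> is the combination of \<open>x\<close> and \<open>-x\<close> with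
  weights \<open>(1 + t) / 2\<close> and \<open>(1 - t) / 2\<close>, and the even function
  \<open>f\<close> takes the same value at both. Concavity is used with \<open>k = 1\<close> and
  parameters \<open>s0 / f x\<close>, \<open>s1 / f x\<close>.\<close>

lemma f_ray:
  assumes t: "0 \<le> t" "t \<le> 1"
  shows "f x \<le> f (\<lambda>i. t * x i)"
proof (cases "t = 1 \<or> f x = 0")
  case True
  then show ?thesis by auto
next
  case False
  define s0 s1 where "s0 = (1 + t) / 2" and "s1 = (1 - t) / 2"
  have s: "s0 > 0" "s1 > 0" "s0 + s1 = 1" "s0 - s1 = t" using False t by (auto simp: s0_def s1_def field_simps)
  have fx: "f x > 0" using False f_nonneg[of x] by linarith
  have e0: "(\<lambda>i. s0 * x i / s0) = x" using s by auto
  have e1: "(\<lambda>i. - (s1 * x i) / s1) = (\<lambda>i. - x i)" using s by auto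
  have e: "(\<lambda>i. (s0 * x i + - (s1 * x i)) / (s0 + s1)) = (\<lambda>i. t * x i)"
    using s(3) s(4)[symmetric] by (auto simp: left_diff_distrib)
  have "1 / (s0 / f x + s1 / f x) ^ 1 \<le> f (\<lambda>i. (s0 * x i + - (s1 * x i)) / (s0 + s1)) / (s0 + s1) ^ 1"
    by (rule f_concavity) (use s fx in \<open>simp_all add: e0 e1 f_minus\<close>)
  then show ?thesis unfolding e using s(3) fx by (simp add: add_divide_distrib[symmetric])
qed

text \<open>Logarithmic concavity between 0 and \<open>x\<close>, as a limit:
  \<open>f_concavity\<close> with both scales 1 bounds \<open>f (x / 2)\<close> from below by the
  power mean of exponent \<open>-1 / k\<close> for every \<open>k\<close>, and as \<open>k\<close>
  grows this becomes the geometric mean.\<close>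

lemma f_midpoint: "f x * f (\<lambda>_. 0) \<le> (f (\<lambda>i. x i / 2))\<^sup>2"
proof (cases "f x = 0")
  case False
  define a b where "a = f x" and "b = f (\<lambda>_. 0)"
  have a: "a > 0" using False f_nonneg[of x] unfolding a_def by linarith
  have b: "b > 0" using f_core[of "\<lambda>_. 0"] r_pos norm_n_eq_0_iff[of "\<lambda>_. 0" n] unfolding b_def by simp
  define G where "G k = ((a powr (- 1 / real (Suc k)) + b powr (- 1 / real (Suc k))) / 2) ^ Suc k" for k
  have root: "1 / (c powr (- 1 / real (Suc k))) ^ Suc k = c" if "c > 0" for c :: real and k
  proof -
    have "(c powr (- 1 / real (Suc k))) ^ Suc k = c powr (- 1 / real (Suc k) * real (Suc k))"
      using that by (subst powr_realpow[symmetric]) (auto simp: powr_powr simp del: of_nat_Suc)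
    also have "- 1 / real (Suc k) * real (Suc k) = -1" by simp
    finally show ?thesis using that by (simp add: powr_minus_divide del: power_Suc)
  qed
  have aux: "1 \<le> F * (q / 2) ^ m" if "1 / q ^ m \<le> F / (1 + 1) ^ m" "q > 0" for q F :: real and m
    using that by (simp add: power_divide field_simps)
  have le: "1 \<le> f (\<lambda>i. x i / 2) * G k" for k
  proof -
    let ?a = "a powr (- 1 / real (Suc k))" and ?b = "b powr (- 1 / real (Suc k))"
    have p: "?a > 0" "?b > 0" using a b by auto
    have "1 / (?a + ?b) ^ Suc k \<le> f (\<lambda>i. (x i + 0) / (1 + 1)) / (1 + 1) ^ Suc k"
      by (rule f_concavity) (use p root[OF a] root[OF b] in \<open>simp_all add: a_def b_def del: power_Suc of_nat_Suc\<close>)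
    then have "1 / (?a + ?b) ^ Suc k \<le> f (\<lambda>i. x i / 2) / (1 + 1) ^ Suc k" by simp
    then show ?thesis unfolding G_def by (rule aux) (rule add_pos_pos[OF p])
  qed
  have "(\<lambda>k. f (\<lambda>i. x i / 2) * G k) \<longlonglongrightarrow> f (\<lambda>i. x i / 2) * exp (- (ln a + ln b) / 2)"
    unfolding G_def by (intro tendsto_mult_left power_mean_limit a b)
  then have "1 \<le> f (\<lambda>i. x i / 2) * exp (- (ln a + ln b) / 2)"
    by (rule LIMSEQ_le_const) (use le in auto)
  then have "1\<^sup>2 \<le> (f (\<lambda>i. x i / 2) * exp (- (ln a + ln b) / 2))\<^sup>2"
    by (intro power_mono) auto
  also have "\<dots> = (f (\<lambda>i. x i / 2))\<^sup>2 * exp (- (ln a + ln b))"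
    by (simp add: power_mult_distrib exp_double[symmetric])
  also have "exp (- (ln a + ln b)) = 1 / (a * b)"
    using a b by (simp add: exp_minus exp_diff field_simps)
  finally show ?thesis using a b by (simp add: a_def[symmetric] b_def[symmetric] field_simps)
qed auto

end

section \<open>Ball's body of the smoothed indicator\<close>

lemma inverse_scaled_power_le_iff:
  fixes P a b :: real
  assumes "P > 0" "a > 0" "b > 0" "p > 0"
  shows "1 / (P * a ^ p) \<le> 1 / (P * b ^ p) \<longleftrightarrow> b \<le> a"
proof -
  have "1 / (P * a ^ p) \<le> 1 / (P * b ^ p) \<longleftrightarrow> b ^ p \<le> a ^ p"
    using assms by (simp add: field_simps)
  then show ?thesis using assms by (simp add: power_mono_iff)
qed

lemma nn_integral_inverse_Icc:
  assumes "a > 0" "a \<le> b"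
  shows "(\<integral>\<^sup>+s. ennreal (1 / s) * indicator {a..b} s \<partial>lborel) = ennreal (ln b - ln a)"
  by (rule nn_integral_FTC_Icc) (use assms in \<open>auto intro!: derivative_eq_intros\<close>)

section \<open>The radial integral \<open>J\<close> and the norm \<open>N\<close>\<close>

context smoothed_body begin

lemma T_R_nonneg: "0 \<le> T - R"
proof -
  have "K \<noteq> {}" using K_volume by auto
  then obtain y where "y \<in> K" by blast
  then show ?thesis using K_norm[of y] norm_n_nonneg[of n y] by linarith
qed

lemma T_pos: "T > 0"
  using T_R_nonneg R_pos by linarith

(* The substitution s = 1/r turns the integral of r ^ (n + 1) f (r x) into J, to whose integrand
   the Borell--Brascamp--Lieb inequality in (x, s) applies. *)
definition J :: "(nat \<Rightarrow> real) \<Rightarrow> ennreal" where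
  "J x = (\<integral>\<^sup>+s. indicator {0<..} s * ennreal (f (\<lambda>i. x i / s) / s ^ (n + 3)) \<partial>lborel)"

(* At the origin J is 0 or infinite, and both junk values give N = 0. *)
definition N :: "(nat \<Rightarrow> real) \<Rightarrow> real" where
  "N x = 1 / root (n + 2) (real (n + 2) * enn2real (J x))"

lemma f_divide_measurable [measurable]:
  assumes [measurable]: "c \<in> borel_measurable M" "g \<in> M \<rightarrow>\<^sub>M (borel :: (nat \<Rightarrow> real) measure)"
  shows "(\<lambda>w. f (\<lambda>i. g w i / c w)) \<in> borel_measurable M"
  by (rule measurable_compose[OF _ f_measurable]) measurable

lemma f_ray_measurable [measurable]: "(\<lambda>s. f (\<lambda>i. x i / s)) \<in> borel_measurable borel"
proof (rule measurable_compose[OF _ f_measurable])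
  show "(\<lambda>s i. x i / s) \<in> borel \<rightarrow>\<^sub>M borel"
    by (rule measurable_coordinatewise_then_product) measurable
qed

lemma J_integrand_measurable:
  "(\<lambda>s. indicator {0<..} s * ennreal (f (\<lambda>i. x i / s) / s ^ m)) \<in> borel_measurable borel"
  by (intro borel_measurable_times_ennreal borel_measurable_indicator measurable_compose[OF _ measurable_ennreal]
      borel_measurable_divide f_ray_measurable) auto

lemma J_measurable [measurable]: "J \<in> borel_measurable borel"
  unfolding J_def by measurable

lemma N_measurable [measurable]: "N \<in> borel_measurable borel"
  unfolding N_def by measurable

text \<open>By \<open>f_concavity\<close> with \<open>k = n + 3\<close> the integrand satisfies the
  Borell--Brascamp--Lieb hypothesis jointly in \<open>x\<close> and \<open>s\<close>; integrating
  out \<open>s\<close> leaves the exponent \<open>n + 2\<close>. In terms of \<open>N\<close> this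
  is the triangle inequality.\<close>

lemma J_add:
  assumes c: "c0 > 0" "c1 > 0" and "ennreal (1 / c0 ^ (n + 2)) \<le> J x0" "ennreal (1 / c1 ^ (n + 2)) \<le> J x1"
  shows "ennreal (1 / (c0 + c1) ^ (n + 2)) \<le> J (\<lambda>i. x0 i + x1 i)"
  unfolding J_def
proof (rule borell_brascamp_lieb_real[OF _ _ _ _ _ c assms(3,4)[unfolded J_def]])
  fix t0 t1 b0 b1 :: real
  assume b: "b0 > 0" "b1 > 0"
    and *: "ennreal (1 / b0 ^ (n + 2 + 1)) \<le> indicator {0<..} t0 * ennreal (f (\<lambda>i. x0 i / t0) / t0 ^ (n + 3))"
      "ennreal (1 / b1 ^ (n + 2 + 1)) \<le> indicator {0<..} t1 * ennreal (f (\<lambda>i. x1 i / t1) / t1 ^ (n + 3))"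
  have pos: "t > 0 \<and> 1 / b ^ (n + 3) \<le> f (\<lambda>i. x i / t) / t ^ (n + 3)"
    if "b > 0" "ennreal (1 / b ^ (n + 2 + 1)) \<le> indicator {0<..} t * ennreal (f (\<lambda>i. x i / t) / t ^ (n + 3))" for b t x
  proof (cases "t > 0")
    case True
    then have "ennreal (1 / b ^ (n + 3)) \<le> ennreal (f (\<lambda>i. x i / t) / t ^ (n + 3))"
      using that(2) by (simp add: numeral_3_eq_3)
    then show ?thesis using True by (subst (asm) ennreal_le_iff) auto
  next
    case False
    then have "ennreal (1 / b ^ (n + 2 + 1)) \<le> 0" using that(2) by simp
    then show ?thesis using that(1) by simp
  qed
  have 0: "t0 > 0" "1 / b0 ^ (n + 3) \<le> f (\<lambda>i. x0 i / t0) / t0 ^ (n + 3)"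
    and 1: "t1 > 0" "1 / b1 ^ (n + 3) \<le> f (\<lambda>i. x1 i / t1) / t1 ^ (n + 3)"
    using pos[OF b(1) *(1)] pos[OF b(2) *(2)] by auto
  have "1 / (b0 + b1) ^ (n + 3) \<le> f (\<lambda>i. (x0 i + x1 i) / (t0 + t1)) / (t0 + t1) ^ (n + 3)"
    by (rule f_concavity) (use 0 1 b in auto)
  then show "ennreal (1 / (b0 + b1) ^ (n + 2 + 1))
      \<le> indicator {0<..} (t0 + t1) * ennreal (f (\<lambda>i. (x0 i + x1 i) / (t0 + t1)) / (t0 + t1) ^ (n + 3))"
    using 0(1) 1(1) by (simp add: ennreal_leI numeral_3_eq_3)
qed (simp_all add: J_integrand_measurable)

lemma J_scale:
  assumes c: "c > 0"
  shows "J (\<lambda>i. c * x i) = ennreal (1 / c ^ (n + 2)) * J x"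
proof -
  have "J (\<lambda>i. c * x i) = ennreal \<bar>c\<bar> *
      (\<integral>\<^sup>+s. indicator {0<..} (0 + c * s) * ennreal (f (\<lambda>i. c * x i / (0 + c * s)) / (0 + c * s) ^ (n + 3)) \<partial>lborel)"
    unfolding J_def by (rule nn_integral_real_affine[OF J_integrand_measurable]) (use c in simp)
  also have "(\<integral>\<^sup>+s. indicator {0<..} (0 + c * s) * ennreal (f (\<lambda>i. c * x i / (0 + c * s)) / (0 + c * s) ^ (n + 3)) \<partial>lborel)
      = (\<integral>\<^sup>+s. ennreal (1 / c ^ (n + 3)) * (indicator {0<..} s * ennreal (f (\<lambda>i. x i / s) / s ^ (n + 3))) \<partial>lborel)"
  proof (rule nn_integral_cong)
    fix s :: real
    show "indicator {0<..} (0 + c * s) * ennreal (f (\<lambda>i. c * x i / (0 + c * s)) / (0 + c * s) ^ (n + 3))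
       = ennreal (1 / c ^ (n + 3)) * (indicator {0<..} s * ennreal (f (\<lambda>i. x i / s) / s ^ (n + 3)))"
      using c by (cases "s > 0") (auto simp: zero_less_mult_iff ennreal_mult[symmetric] power_mult_distrib)
  qed
  also have "\<dots> = ennreal (1 / c ^ (n + 3)) * J x"
    unfolding J_def by (rule nn_integral_cmult) measurable
  also have "ennreal \<bar>c\<bar> * (ennreal (1 / c ^ (n + 3)) * J x) = ennreal (1 / c ^ (n + 2)) * J x"
    using c by (simp add: mult.assoc[symmetric] ennreal_mult[symmetric] power_add numeral_3_eq_3)
  finally show ?thesis .
qed

text \<open>Serves two bounds: \<open>c = 3 / 4\<close>, from the values of \<open>f\<close> near
  the origin, and \<open>c = f x\<close>, from monotonicity along rays.\<close>

lemma J_ge: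
  assumes a: "a > 0" and c: "0 \<le> c" "\<And>s. a \<le> s \<Longrightarrow> c \<le> f (\<lambda>i. x i / s)"
  shows "ennreal (c * (1 / (real (n + 2) * a ^ (n + 2)))) \<le> J x"
proof -
  have "ennreal (c * (1 / (real (n + 2) * a ^ (n + 2))))
      = ennreal c * (\<integral>\<^sup>+s. indicator {a..} s * ennreal (1 / s ^ (n + 2 + 1)) \<partial>lborel)"
    using a c by (subst nn_integral_inverse_power_tail) (simp_all add: ennreal_mult[symmetric])
  also have "\<dots> = (\<integral>\<^sup>+s. ennreal c * (indicator {a..} s * ennreal (1 / s ^ (n + 2 + 1))) \<partial>lborel)"
    by (rule nn_integral_cmult[symmetric]) measurable
  also have "\<dots> \<le> J x"
    unfolding J_def
  proof (rule nn_integral_mono)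
    fix s :: real
    show "ennreal c * (indicator {a..} s * ennreal (1 / s ^ (n + 2 + 1)))
        \<le> indicator {0<..} s * ennreal (f (\<lambda>i. x i / s) / s ^ (n + 3))"
    proof (cases "a \<le> s")
      case True
      then have s: "s > 0" using a by linarith
      have "c * (1 / s ^ (n + 2 + 1)) \<le> f (\<lambda>i. x i / s) * (1 / s ^ (n + 3))"
        using s c(2)[OF True] by (intro mult_mono) (auto simp: numeral_3_eq_3)
      then show ?thesis using True s c by (simp add: ennreal_mult[symmetric] ennreal_leI numeral_3_eq_3)
    qed auto
  qed
  finally show ?thesis .
qed

lemma J_lower:
  assumes x: "norm_n n x > 0"
  shows "ennreal (3 / 4 * (1 / (real (n + 2) * (norm_n n x / r) ^ (n + 2)))) \<le> J x"
proof (rule J_ge)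
  show a: "norm_n n x / r > 0" using x r_pos by simp
  show "3 / 4 \<le> f (\<lambda>i. x i / s)" if s: "norm_n n x / r \<le> s" for s
  proof (rule f_core)
    have "s > 0" using s a by linarith
    then show "norm_n n (\<lambda>i. x i / s) \<le> r"
      using s r_pos by (simp add: norm_n_divide field_simps)
  qed
qed simp

lemma J_upper:
  assumes x: "norm_n n x > 0"
  shows "J x \<le> ennreal (1 / (real (n + 2) * (norm_n n x / T) ^ (n + 2)))"
proof -
  let ?a = "norm_n n x / T"
  have a: "?a > 0" using x T_pos by simp
  have "J x \<le> (\<integral>\<^sup>+s. indicator {?a..} s * ennreal (1 / s ^ (n + 2 + 1)) \<partial>lborel)"
    unfolding J_def
  proof (rule nn_integral_mono)
    fix s :: real
    show "indicator {0<..} s * ennreal (f (\<lambda>i. x i / s) / s ^ (n + 3))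
       \<le> indicator {?a..} s * ennreal (1 / s ^ (n + 2 + 1))"
    proof (cases "s > 0")
      case s: True
      show ?thesis
      proof (cases "?a \<le> s")
        case True
        have "f (\<lambda>i. x i / s) / s ^ (n + 3) \<le> 1 / s ^ (n + 3)"
          using s f_le_1 by (intro divide_right_mono) auto
        then show ?thesis using True s by (simp add: ennreal_leI numeral_3_eq_3)
      next
        case False
        then have "T < norm_n n (\<lambda>i. x i / s)"
          using s T_pos by (simp add: norm_n_divide field_simps)
        then show ?thesis using f_support by simp
      qed
    qed simp
  qed
  also have "\<dots> = ennreal (1 / (real (n + 2) * ?a ^ (n + 2)))"
    by (rule nn_integral_inverse_power_tail) (use a in auto)
  finally show ?thesis .
qed

lemma N_nonneg [simp]: "0 \<le> N x"
  by (simp add: N_def)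

text \<open>Away from the origin \<open>J x\<close> is finite, as \<open>f\<close> vanishes far out,
  and positive, as \<open>f\<close> is at least 3/4 near 0. Hence neither \<open>enn2real\<close>
  nor the root in the definition of \<open>N\<close> loses information.\<close>

lemma J_eq_N:
  assumes "norm_n n x > 0"
  shows "N x > 0" "J x = ennreal (1 / (real (n + 2) * N x ^ (n + 2)))"
proof -
  have fin: "J x \<noteq> top" using J_upper[OF assms] by (auto simp: top_unique)
  have "0 < ennreal (3 / 4 * (1 / (real (n + 2) * (norm_n n x / r) ^ (n + 2))))"
    using assms r_pos by (auto simp: ennreal_zero_less_mult_iff intro!: mult_pos_pos add_pos_pos)
  then have "J x > 0" using J_lower[OF assms] by (rule less_le_trans)
  then have j: "enn2real (J x) > 0" using fin by (simp add: enn2real_positive_iff top.not_eq_extremum)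
  then have root: "root (n + 2) (real (n + 2) * enn2real (J x)) ^ (n + 2) = real (n + 2) * enn2real (J x)"
    by (intro real_root_pow_pos2) auto
  have rpos: "root (n + 2) (real (n + 2) * enn2real (J x)) > 0"
    using j by (intro real_root_gt_zero) auto
  then show "N x > 0" by (simp add: N_def)
  have "N x ^ (n + 2) = 1 / (real (n + 2) * enn2real (J x))"
    unfolding N_def power_divide root by simp
  then have "1 / (real (n + 2) * N x ^ (n + 2)) = enn2real (J x)"
    by simp
  then show "J x = ennreal (1 / (real (n + 2) * N x ^ (n + 2)))"
    using fin by (simp only: ennreal_enn2real top.not_eq_extremum)
qed

lemma N_le_iff:
  assumes "norm_n n x > 0" "c > 0"
  shows "N x \<le> c \<longleftrightarrow> ennreal (1 / (real (n + 2) * c ^ (n + 2))) \<le> J x"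
proof -
  have "ennreal (1 / (real (n + 2) * c ^ (n + 2))) \<le> J x
      \<longleftrightarrow> 1 / (real (n + 2) * c ^ (n + 2)) \<le> 1 / (real (n + 2) * N x ^ (n + 2))"
    unfolding J_eq_N(2)[OF assms(1)] using J_eq_N(1)[OF assms(1)] by (subst ennreal_le_iff) auto
  also have "\<dots> \<longleftrightarrow> N x \<le> c"
    using assms J_eq_N(1)[OF assms(1)] by (intro inverse_scaled_power_le_iff) auto
  finally show ?thesis ..
qed

lemma N_scale:
  assumes c: "c > 0"
  shows "N (\<lambda>i. c * x i) = c * N x"
proof -
  have "enn2real (J (\<lambda>i. c * x i)) = 1 / c ^ (n + 2) * enn2real (J x)"
    unfolding J_scale[OF c] enn2real_mult using c by simp
  then have "root (n + 2) (real (n + 2) * enn2real (J (\<lambda>i. c * x i)))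
     = root (n + 2) (1 / c ^ (n + 2)) * root (n + 2) (real (n + 2) * enn2real (J x))"
    by (simp add: real_root_mult[symmetric] mult.left_commute)
  also have "root (n + 2) (1 / c ^ (n + 2)) = 1 / c"
    using c by (simp add: real_root_divide real_root_power_cancel del: power_Suc power_add add_2_eq_Suc')
  finally show ?thesis by (simp add: N_def)
qed

lemma N_0 [simp]: "N (\<lambda>_. 0) = 0"
  using N_scale[of 2 "\<lambda>_. 0"] by simp

lemma N_minus: "N (\<lambda>i. - x i) = N x"
proof -
  have "f (\<lambda>i. - x i / s) = f (\<lambda>i. x i / s)" for s
    using f_minus[of "\<lambda>i. x i / s"] by simp
  then show ?thesis by (simp add: N_def J_def)
qed

lemma Rn_norm_pos: "x \<in> Rn n \<Longrightarrow> x \<noteq> (\<lambda>_. 0) \<Longrightarrow> norm_n n x > 0"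
  using norm_n_eq_0_iff[of x n] norm_n_nonneg[of n x] by linarith

lemma N_triangle:
  assumes x: "x \<in> Rn n" and y: "y \<in> Rn n"
  shows "N (\<lambda>i. x i + y i) \<le> N x + N y"
\<comment> \<open>\<open>J_eq_N\<close> is silent at the origin, but \<open>N\<close> is 0 there,
  which settles the cases in which one of the three vectors vanishes.\<close>
proof (cases "x = (\<lambda>_. 0) \<or> y = (\<lambda>_. 0) \<or> (\<lambda>i. x i + y i) = (\<lambda>_. 0)")
  case True
  then show ?thesis by auto
next
  case False
  \<comment> \<open>The factor \<open>n + 2\<close> in the definition of \<open>N\<close> is moved
    into the base of the power, as \<open>J_add\<close> has no such factor.\<close>
  define q where "q = root (n + 2) (real (n + 2))"
  have q: "q > 0" "q ^ (n + 2) = real (n + 2)"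
    unfolding q_def by (rule real_root_gt_zero, simp, simp) (rule real_root_pow_pos2, simp, simp)
  have nx: "norm_n n x > 0" "norm_n n y > 0" "norm_n n (\<lambda>i. x i + y i) > 0"
    using False x y Rn_add[OF x y] by (auto intro: Rn_norm_pos)
  note N = J_eq_N[OF nx(1)] J_eq_N[OF nx(2)]
  have "ennreal (1 / (q * N x + q * N y) ^ (n + 2)) \<le> J (\<lambda>i. x i + y i)"
    by (rule J_add) (use N q in \<open>auto simp: power_mult_distrib simp del: power_add power_Suc add_2_eq_Suc'\<close>)
  then have "ennreal (1 / (real (n + 2) * (N x + N y) ^ (n + 2))) \<le> J (\<lambda>i. x i + y i)"
    by (simp only: distrib_left[symmetric] power_mult_distrib q(2))
  then show ?thesis using N_le_iff[OF nx(3), of "N x + N y"] N by simp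
qed

lemma norm_le_T_N:
  assumes "x \<in> Rn n"
  shows "norm_n n x \<le> T * N x"
proof (cases "x = (\<lambda>_. 0)")
  case False
  note nx = Rn_norm_pos[OF assms False]
  note N = J_eq_N[OF nx]
  have "ennreal (1 / (real (n + 2) * N x ^ (n + 2))) \<le> ennreal (1 / (real (n + 2) * (norm_n n x / T) ^ (n + 2)))"
    using J_upper[OF nx] N(2) by simp
  then have "1 / (real (n + 2) * N x ^ (n + 2)) \<le> 1 / (real (n + 2) * (norm_n n x / T) ^ (n + 2))"
    using nx T_pos by (subst (asm) ennreal_le_iff) auto
  then have "norm_n n x / T \<le> N x"
    using nx N T_pos by (subst (asm) inverse_scaled_power_le_iff) auto
  then show ?thesis using T_pos by (simp add: field_simps)
qed simp

lemma N_le_norm: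
  assumes "x \<in> Rn n"
  shows "N x \<le> 4 / (3 * r) * norm_n n x"
proof (cases "x = (\<lambda>_. 0)")
  case False
  note nx = Rn_norm_pos[OF assms False]
  have "1 / (real (n + 2) * (4 / (3 * r) * norm_n n x) ^ (n + 2))
      \<le> 3 / 4 * (1 / (real (n + 2) * (norm_n n x / r) ^ (n + 2)))"
  proof -
    \<comment> \<open>The lower bound 3/4 of \<open>f\<close> is weakened to its power of exponent
      \<open>n + 2\<close>. It then passes through the root and gives a constant that does not
      depend on \<open>n\<close>.\<close>
    have "(3 / 4 :: real) ^ (n + 2) \<le> (3 / 4) ^ 1" by (rule power_decreasing) auto
    then have "(3 / 4) ^ (n + 2) * (1 / (real (n + 2) * (norm_n n x / r) ^ (n + 2)))
        \<le> 3 / 4 * (1 / (real (n + 2) * (norm_n n x / r) ^ (n + 2)))"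
      using nx r_pos by (intro mult_right_mono) auto
    moreover have "1 / (real (n + 2) * (4 / (3 * r) * norm_n n x) ^ (n + 2))
        = (3 / 4) ^ (n + 2) * (1 / (real (n + 2) * (norm_n n x / r) ^ (n + 2)))"
    proof -
      have "4 / (3 * r) * norm_n n x = (norm_n n x / r) / (3 / 4)" by simp
      moreover have "1 / (P * (m / (3 / 4)) ^ p) = (3 / 4) ^ p * (1 / (P * m ^ p))" for P m :: real and p
        by (simp add: power_divide)
      ultimately show ?thesis by (simp only:)
    qed
    ultimately show ?thesis by simp
  qed
  then have "ennreal (1 / (real (n + 2) * (4 / (3 * r) * norm_n n x) ^ (n + 2))) \<le> J x"
    by (intro order_trans[OF ennreal_leI J_lower[OF nx]])
  then show ?thesis using N_le_iff[OF nx, of "4 / (3 * r) * norm_n n x"] nx r_pos by simp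
qed simp

text \<open>\<open>f\<close> decreases outwards along rays, so for \<open>s \<ge> 1\<close> the
  integrand of \<open>J x\<close> is at least \<open>f x / s ^ (n + 3)\<close>. This is the decay
  that controls high moments.\<close>

lemma f_le_N:
  assumes "norm_n n x > 0"
  shows "f x \<le> 1 / N x ^ (n + 2)"
proof -
  have "f x \<le> f (\<lambda>i. x i / s)" if "1 \<le> s" for s
    using f_ray[of "1 / s" x] that by simp
  then have "ennreal (f x * (1 / real (n + 2))) \<le> J x"
    using J_ge[of 1 "f x" x] by simp
  also have "\<dots> = ennreal (1 / (real (n + 2) * N x ^ (n + 2)))" by (rule J_eq_N[OF assms])
  finally have "f x * (1 / real (n + 2)) \<le> 1 / (real (n + 2) * N x ^ (n + 2))"
    using J_eq_N(1)[OF assms] by (subst (asm) ennreal_le_iff) auto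
  then have "f x * (1 / real (n + 2)) * real (n + 2) \<le> 1 / (real (n + 2) * N x ^ (n + 2)) * real (n + 2)"
    by (intro mult_right_mono) auto
  then show ?thesis by simp
qed

definition A :: "(nat \<Rightarrow> real) set" where
  "A = {x \<in> Rn n. N x \<le> 1}"

lemma A_borel [measurable]: "A \<in> sets borel"
proof -
  have "A = Rn n \<inter> {x \<in> space borel. N x \<le> 1}" by (auto simp: A_def)
  also have "\<dots> \<in> sets borel" by (intro sets.Int Rn_in_borel) measurable
  finally show ?thesis .
qed

lemma A_norm: "x \<in> A \<Longrightarrow> norm_n n x \<le> T"
  using norm_le_T_N[of x] mult_left_le[of "N x" T] T_pos by (auto simp: A_def intro: order_trans)

lemma A_finite: "emeasure (lborel_n n) A < \<infinity>"
proof -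
  have "emeasure (lborel_n n) A \<le> emeasure (lborel_n n) {z. norm_n n z \<le> T}"
    by (rule emeasure_mono) (auto simp: A_norm)
  then show ?thesis using emeasure_norm_ball_finite[of n T] by (rule le_less_trans)
qed

section \<open>Polar integration: integrals against \<open>f\<close> as integrals over
  \<open>A\<close>\<close>

abbreviation annulus :: "(nat \<Rightarrow> real) set" where
  "annulus \<equiv> {y. 1 \<le> norm_n n y \<and> norm_n n y \<le> exp 1}"

(* Polar integration with the sphere replaced by the annulus 1 <= |y| <= e, whose
   radial measure ds/s has total mass 1. *)
lemma nn_integral_annulus:
  assumes [measurable]: "F \<in> borel_measurable borel" and F0: "F (\<lambda>_. 0) = 0"
  shows "(\<integral>\<^sup>+x. F x \<partial>lborel_n n) = (\<integral>\<^sup>+y. indicator annulus y *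
     (\<integral>\<^sup>+s. indicator {0<..} s * ennreal (1 / s ^ (n + 1)) * F (\<lambda>i. y i / s) \<partial>lborel) \<partial>lborel_n n)"
proof -
  interpret pair_sigma_finite "lborel_n n" lborel
    by (intro pair_sigma_finite.intro sigma_finite_lborel_n lborel.sigma_finite_measure_axioms)
  have W [measurable]: "annulus \<in> sets borel" by measurable
  have Fdiv [measurable]: "(\<lambda>w. F (\<lambda>i. g w i / c w)) \<in> borel_measurable M"
    if [measurable]: "c \<in> borel_measurable M" "g \<in> M \<rightarrow>\<^sub>M (borel :: (nat \<Rightarrow> real) measure)" for c g and M :: "'z measure"
    by (rule measurable_compose[OF _ assms(1)]) measurable
  have scale: "(\<integral>\<^sup>+y. indicator annulus y * F (\<lambda>i. y i / s) \<partial>lborel_n n)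
      = ennreal (s ^ n) * (\<integral>\<^sup>+x. indicator annulus (\<lambda>i. s * x i) * F x \<partial>lborel_n n)" if s: "s > 0" for s
  proof -
    have "(\<integral>\<^sup>+y. indicator annulus y * F (\<lambda>i. y i / s) \<partial>lborel_n n)
      = ennreal (s ^ n) * (\<integral>\<^sup>+x. indicator annulus (\<lambda>i. s * x i) * F (\<lambda>i. s * x i / s) \<partial>lborel_n n)"
      by (rule nn_integral_lborel_n_scale) (use s in measurable)
    then show ?thesis using s by simp
  qed
  have "(\<integral>\<^sup>+y. indicator annulus y * (\<integral>\<^sup>+s. indicator {0<..} s * ennreal (1 / s ^ (n + 1)) * F (\<lambda>i. y i / s) \<partial>lborel) \<partial>lborel_n n)
      = (\<integral>\<^sup>+y. \<integral>\<^sup>+s. indicator annulus y * (indicator {0<..} s * ennreal (1 / s ^ (n + 1)) * F (\<lambda>i. y i / s)) \<partial>lborel \<partial>lborel_n n)"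
    by (intro nn_integral_cong nn_integral_cmult[symmetric]) measurable
  also have "\<dots> = (\<integral>\<^sup>+s. \<integral>\<^sup>+y. indicator annulus y * (indicator {0<..} s * ennreal (1 / s ^ (n + 1)) * F (\<lambda>i. y i / s)) \<partial>lborel_n n \<partial>lborel)"
    by (rule Fubini'[symmetric]) measurable
  also have "\<dots> = (\<integral>\<^sup>+s. \<integral>\<^sup>+x. indicator {0<..} s * ennreal (1 / s) * (indicator annulus (\<lambda>i. s * x i) * F x) \<partial>lborel_n n \<partial>lborel)"
  proof (rule nn_integral_cong)
    fix s :: real
    have "(\<integral>\<^sup>+y. indicator annulus y * (indicator {0<..} s * ennreal (1 / s ^ (n + 1)) * F (\<lambda>i. y i / s)) \<partial>lborel_n n)
        = (indicator {0<..} s * ennreal (1 / s ^ (n + 1))) * (\<integral>\<^sup>+y. indicator annulus y * F (\<lambda>i. y i / s) \<partial>lborel_n n)"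
      by (subst nn_integral_cmult[symmetric]) (measurable, auto intro!: nn_integral_cong simp: mult_ac)
    also have "\<dots> = indicator {0<..} s * ennreal (1 / s) * (\<integral>\<^sup>+x. indicator annulus (\<lambda>i. s * x i) * F x \<partial>lborel_n n)"
    proof (cases "s > 0")
      case True
      then have "ennreal (1 / s ^ (n + 1)) * ennreal (s ^ n) = ennreal (1 / s)"
        by (simp add: ennreal_mult[symmetric])
      then show ?thesis using True scale[OF True] by (simp add: mult.assoc[symmetric])
    qed simp
    also have "\<dots> = (\<integral>\<^sup>+x. indicator {0<..} s * ennreal (1 / s) * (indicator annulus (\<lambda>i. s * x i) * F x) \<partial>lborel_n n)"
      by (rule nn_integral_cmult[symmetric]) measurable
    finally show "(\<integral>\<^sup>+y. indicator annulus y * (indicator {0<..} s * ennreal (1 / s ^ (n + 1)) * F (\<lambda>i. y i / s)) \<partial>lborel_n n)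
      = (\<integral>\<^sup>+x. indicator {0<..} s * ennreal (1 / s) * (indicator annulus (\<lambda>i. s * x i) * F x) \<partial>lborel_n n)" .
  qed
  also have "\<dots> = (\<integral>\<^sup>+x. \<integral>\<^sup>+s. indicator {0<..} s * ennreal (1 / s) * (indicator annulus (\<lambda>i. s * x i) * F x) \<partial>lborel \<partial>lborel_n n)"
    by (rule Fubini') measurable
  \<comment> \<open>For \<open>x\<close> other than 0, \<open>s x\<close> is in the annulus for
    \<open>s\<close> in an interval whose endpoints have ratio e, of mass 1 under
    \<open>ds / s\<close>. The origin is where \<open>F0\<close> is used.\<close>
  also have "\<dots> = (\<integral>\<^sup>+x. F x \<partial>lborel_n n)"
  proof (rule nn_integral_cong_AE)
    show "AE x in lborel_n n. (\<integral>\<^sup>+s. indicator {0<..} s * ennreal (1 / s) * (indicator annulus (\<lambda>i. s * x i) * F x) \<partial>lborel) = F x"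
      using AE_lborel_n_Rn[of n]
    proof eventually_elim
      fix x assume x: "x \<in> Rn n"
      show "(\<integral>\<^sup>+s. indicator {0<..} s * ennreal (1 / s) * (indicator annulus (\<lambda>i. s * x i) * F x) \<partial>lborel) = F x"
      proof (cases "x = (\<lambda>_. 0)")
        case True
        then show ?thesis using F0 by simp
      next
        case False
        note nx = Rn_norm_pos[OF x False]
        let ?m = "norm_n n x"
        have "(\<integral>\<^sup>+s. indicator {0<..} s * ennreal (1 / s) * (indicator annulus (\<lambda>i. s * x i) * F x) \<partial>lborel)
            = (\<integral>\<^sup>+s. ennreal (1 / s) * indicator {1 / ?m..exp 1 / ?m} s * F x \<partial>lborel)"
        proof (rule nn_integral_cong)
          fix s :: real
          have "s > 0 \<Longrightarrow> (\<lambda>i. s * x i) \<in> annulus \<longleftrightarrow> s \<in> {1 / ?m..exp 1 / ?m}"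
            using nx by (simp add: norm_n_scale field_simps)
          moreover have "\<not> s > 0 \<Longrightarrow> s \<notin> {1 / ?m..exp 1 / ?m}"
            using nx by (auto simp: not_less intro: less_le_trans dest: order_trans)
          ultimately show "indicator {0<..} s * ennreal (1 / s) * (indicator annulus (\<lambda>i. s * x i) * F x)
             = ennreal (1 / s) * indicator {1 / ?m..exp 1 / ?m} s * F x"
            by (cases "s > 0") (auto simp: indicator_def)
        qed
        also have "\<dots> = ennreal (ln (exp 1 / ?m) - ln (1 / ?m)) * F x"
          using nx by (subst nn_integral_multc, measurable, subst nn_integral_inverse_Icc) (auto simp: divide_right_mono)
        also have "ln (exp 1 / ?m) - ln (1 / ?m) = 1"
          using nx by (simp add: ln_div)
        finally show ?thesis by simp
      qed
    qed
  qed
  finally show ?thesis ..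
qed

text \<open>On the ray through \<open>y\<close> both sides give \<open>G y\<close> times an integral
  of \<open>s ^ -(n + 3)\<close>: weighted by \<open>f\<close> it is \<open>J y\<close>, and cut off
  at \<open>N y\<close> it has the same value by the choice of \<open>N\<close>. The weight is
  \<open>s ^ -(n + 1)\<close> from polar integration times \<open>s ^ -2\<close> from the
  homogeneity of \<open>G\<close>.\<close>

lemma nn_integral_f_eq_A:
  assumes [measurable]: "G \<in> borel_measurable borel"
    and G: "\<And>c x. c > 0 \<Longrightarrow> G (\<lambda>i. c * x i) = ennreal (c\<^sup>2) * G x" and G0: "G (\<lambda>_. 0) = 0"
  shows "(\<integral>\<^sup>+x. G x * ennreal (f x) \<partial>lborel_n n) = (\<integral>\<^sup>+x\<in>A. G x \<partial>lborel_n n)"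
proof -
  have Gdiv: "G (\<lambda>i. y i / s) = ennreal (1 / s\<^sup>2) * G y" if "s > 0" for s y
    using G[of "1 / s" y] that by (simp add: power_divide)
  have Gs: "ennreal (1 / s ^ (n + 1)) * G (\<lambda>i. y i / s) = G y * ennreal (1 / s ^ (n + 3))" if "s > 0" for s y
  proof -
    have "1 / s ^ (n + 1) * (1 / s\<^sup>2) = 1 / s ^ (n + 3)"
      by (simp only: times_divide_times_eq mult_1 power_add[symmetric]) (simp add: numeral_3_eq_3)
    then have "ennreal (1 / s ^ (n + 1)) * ennreal (1 / s\<^sup>2) = ennreal (1 / s ^ (n + 3))"
      using that by (subst ennreal_mult[symmetric]) auto
    then show ?thesis
      unfolding Gdiv[OF that] by (simp only: mult.assoc[symmetric]) (simp only: mult.commute)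
  qed
  have inner: "(\<integral>\<^sup>+s. indicator {0<..} s * ennreal (1 / s ^ (n + 1)) * (G (\<lambda>i. y i / s) * ennreal (f (\<lambda>i. y i / s))) \<partial>lborel)
     = (\<integral>\<^sup>+s. indicator {0<..} s * ennreal (1 / s ^ (n + 1)) * (G (\<lambda>i. y i / s) * indicator A (\<lambda>i. y i / s)) \<partial>lborel)"
    if y: "y \<in> Rn n" and ny: "norm_n n y > 0" for y
  proof -
    have "(\<integral>\<^sup>+s. indicator {0<..} s * ennreal (1 / s ^ (n + 1)) * (G (\<lambda>i. y i / s) * ennreal (f (\<lambda>i. y i / s))) \<partial>lborel)
       = (\<integral>\<^sup>+s. G y * (indicator {0<..} s * ennreal (f (\<lambda>i. y i / s) / s ^ (n + 3))) \<partial>lborel)"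
    proof (rule nn_integral_cong)
      fix s :: real
      show "indicator {0<..} s * ennreal (1 / s ^ (n + 1)) * (G (\<lambda>i. y i / s) * ennreal (f (\<lambda>i. y i / s)))
         = G y * (indicator {0<..} s * ennreal (f (\<lambda>i. y i / s) / s ^ (n + 3)))"
      proof (cases "s > 0")
        case True
        have "ennreal (1 / s ^ (n + 1)) * (G (\<lambda>i. y i / s) * ennreal (f (\<lambda>i. y i / s)))
            = G y * (ennreal (1 / s ^ (n + 3)) * ennreal (f (\<lambda>i. y i / s)))"
          using Gs[OF True, of y] by (simp only: mult.assoc[symmetric])
        also have "ennreal (1 / s ^ (n + 3)) * ennreal (f (\<lambda>i. y i / s)) = ennreal (f (\<lambda>i. y i / s) / s ^ (n + 3))"
          using True by (simp add: ennreal_mult[symmetric])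
        finally show ?thesis using True by simp
      qed simp
    qed
    also have "\<dots> = G y * J y"
      unfolding J_def by (rule nn_integral_cmult) measurable
    also have "J y = (\<integral>\<^sup>+s. indicator {N y..} s * ennreal (1 / s ^ (n + 2 + 1)) \<partial>lborel)"
      using J_eq_N[OF ny] by (subst nn_integral_inverse_power_tail) auto
    also have "G y * \<dots> = (\<integral>\<^sup>+s. G y * (indicator {N y..} s * ennreal (1 / s ^ (n + 2 + 1))) \<partial>lborel)"
      by (rule nn_integral_cmult[symmetric]) measurable
    also have "\<dots> = (\<integral>\<^sup>+s. indicator {0<..} s * ennreal (1 / s ^ (n + 1)) * (G (\<lambda>i. y i / s) * indicator A (\<lambda>i. y i / s)) \<partial>lborel)"
    proof (rule nn_integral_cong)
      fix s :: real
      show "G y * (indicator {N y..} s * ennreal (1 / s ^ (n + 2 + 1)))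
         = indicator {0<..} s * ennreal (1 / s ^ (n + 1)) * (G (\<lambda>i. y i / s) * indicator A (\<lambda>i. y i / s))"
      proof (cases "s > 0")
        case True
        have "N (\<lambda>i. y i / s) = N y / s" using N_scale[of "1 / s" y] True by simp
        then have "N (\<lambda>i. y i / s) \<le> 1 \<longleftrightarrow> N y \<le> s" using True by (simp only: divide_le_eq_1_pos)
        then have "(\<lambda>i. y i / s) \<in> A \<longleftrightarrow> s \<in> {N y..}" using y by (simp add: A_def Rn_divide)
        then have i: "indicator A (\<lambda>i. y i / s) = (indicator {N y..} s :: ennreal)" by (simp add: indicator_def)
        have "ennreal (1 / s ^ (n + 1)) * (G (\<lambda>i. y i / s) * indicator A (\<lambda>i. y i / s))
            = G y * ennreal (1 / s ^ (n + 3)) * indicator {N y..} s"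
          using Gs[OF True, of y] unfolding i by (simp only: mult.assoc[symmetric])
        then show ?thesis using True by (simp add: numeral_3_eq_3 mult_ac)
      next
        case False
        then have "s \<notin> {N y..}" using J_eq_N(1)[OF ny] by auto
        then show ?thesis using False by simp
      qed
    qed
    finally show ?thesis .
  qed
  have "(\<integral>\<^sup>+x. G x * ennreal (f x) \<partial>lborel_n n) = (\<integral>\<^sup>+y. indicator annulus y *
     (\<integral>\<^sup>+s. indicator {0<..} s * ennreal (1 / s ^ (n + 1)) * (G (\<lambda>i. y i / s) * ennreal (f (\<lambda>i. y i / s))) \<partial>lborel) \<partial>lborel_n n)"
    by (rule nn_integral_annulus) (simp_all add: G0)
  also have "\<dots> = (\<integral>\<^sup>+y. indicator annulus y *
     (\<integral>\<^sup>+s. indicator {0<..} s * ennreal (1 / s ^ (n + 1)) * (G (\<lambda>i. y i / s) * indicator A (\<lambda>i. y i / s)) \<partial>lborel) \<partial>lborel_n n)"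
  proof (rule nn_integral_cong_AE)
    show "AE y in lborel_n n. indicator annulus y *
     (\<integral>\<^sup>+s. indicator {0<..} s * ennreal (1 / s ^ (n + 1)) * (G (\<lambda>i. y i / s) * ennreal (f (\<lambda>i. y i / s))) \<partial>lborel)
     = indicator annulus y *
     (\<integral>\<^sup>+s. indicator {0<..} s * ennreal (1 / s ^ (n + 1)) * (G (\<lambda>i. y i / s) * indicator A (\<lambda>i. y i / s)) \<partial>lborel)"
      using AE_lborel_n_Rn[of n] by eventually_elim (use inner in \<open>auto simp: indicator_def\<close>)
  qed
  also have "\<dots> = (\<integral>\<^sup>+x\<in>A. G x \<partial>lborel_n n)"
    by (rule nn_integral_annulus[symmetric]) (simp_all add: G0)
  finally show ?thesis .
qed

end

section \<open>Comparison of moments\<close>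

text \<open>The total exponent \<open>q - n - 4\<close> of \<open>N\<close> is negative, so the
  worst case is \<open>N = 4\<close>. The remaining \<open>2 ^ -(n + 2)\<close> cancels what a
  dilation by 2 produces later.\<close>

lemma power_quotient_bound:
  fixes N q :: real
  assumes "4 \<le> N" "q \<le> real n"
  shows "N powr (q - 2) * (2 ^ (n + 2) / N ^ (n + 2)) \<le> 4 powr (q - 2) / 2 ^ (n + 2)"
proof -
  have N: "N > 0" using assms by simp
  have e: "M powr (q - 2 - real (n + 2)) = M powr (q - 2) / M ^ (n + 2)" if "M > 0" for M :: real
    using that by (simp only: powr_diff powr_realpow)
  have "N powr (q - 2) * (2 ^ (n + 2) / N ^ (n + 2)) = 2 ^ (n + 2) * N powr (q - 2 - real (n + 2))"
    unfolding e[OF N] by simp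
  also have "\<dots> \<le> 2 ^ (n + 2) * 4 powr (q - 2 - real (n + 2))"
    using assms by (intro mult_left_mono powr_mono2') auto
  also have "\<dots> = 4 powr (q - 2) * (2 ^ (n + 2) / 4 ^ (n + 2))"
    by (subst e) simp_all
  also have "(2::real) ^ (n + 2) / 4 ^ (n + 2) = 1 / 2 ^ (n + 2)"
  proof -
    have "(4::real) ^ (n + 2) = 2 ^ (n + 2) * 2 ^ (n + 2)" by (simp only: power_mult_distrib[symmetric]) simp
    then show ?thesis by simp
  qed
  finally show ?thesis by simp
qed

lemma inner_n_add_left: "inner_n n (\<lambda>i. x i + y i) z = inner_n n x z + inner_n n y z"
  by (simp add: inner_n_def distrib_right sum.distrib)

lemma inner_n_minus_left: "inner_n n (\<lambda>i. - x i) z = - inner_n n x z"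
  by (simp add: inner_n_def sum_negf)

context smoothed_body begin

lemma homogeneous_times_N_powr:
  assumes c: "c > 0" and g: "g (\<lambda>i. c * x i) = ennreal (c powr q) * g x"
  shows "g (\<lambda>i. c * x i) * ennreal (N (\<lambda>i. c * x i) powr (2 - q)) = ennreal (c\<^sup>2) * (g x * ennreal (N x powr (2 - q)))"
proof -
  have "c powr q * N (\<lambda>i. c * x i) powr (2 - q) = c\<^sup>2 * N x powr (2 - q)"
    using c by (simp add: N_scale powr_mult mult.assoc[symmetric] powr_add[symmetric])
  then have "ennreal (c powr q) * ennreal (N (\<lambda>i. c * x i) powr (2 - q)) = ennreal (c\<^sup>2) * ennreal (N x powr (2 - q))"
    using c by (simp add: ennreal_mult[symmetric])
  moreover have "ennreal (c powr q) * g x * w = g x * (ennreal (c powr q) * w)" for w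
    by (simp only: mult_ac)
  ultimately show ?thesis unfolding g by (simp only: mult.left_commute)
qed

text \<open>A bathtub argument. \<open>f - 1\<close> is at most 0 on \<open>A\<close> and
  \<open>f\<close> is at least 0 off \<open>A\<close>, while the increasing weight
  \<open>t = N ^ (2 - q)\<close> is at most 1 on \<open>A\<close> and at least 1 off
  \<open>A\<close>. So \<open>f\<close> minus the indicator of \<open>A\<close>, times
  \<open>t - 1\<close>, is nonnegative; integrated against \<open>g\<close>, the terms with
  \<open>t\<close> cancel by the 2-homogeneous identity.\<close>

lemma moment_comparison_low:
  assumes [measurable]: "g \<in> borel_measurable borel" and q: "0 \<le> q" "q \<le> 2"
    and g: "\<And>c x. c > 0 \<Longrightarrow> g (\<lambda>i. c * x i) = ennreal (c powr q) * g x"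
    and fin: "(\<integral>\<^sup>+x\<in>A. g x \<partial>lborel_n n) < \<infinity>"
  shows "(\<integral>\<^sup>+x. g x * ennreal (f x) \<partial>lborel_n n) \<le> (\<integral>\<^sup>+x\<in>A. g x \<partial>lborel_n n)"
proof -
  define t where "t x = N x powr (2 - q)" for x
  have [measurable]: "t \<in> borel_measurable borel" unfolding t_def by measurable
  define G where "G x = g x * ennreal (t x)" for x
  have [measurable]: "G \<in> borel_measurable borel" unfolding G_def by measurable
  have hom: "G (\<lambda>i. c * x i) = ennreal (c\<^sup>2) * G x" if "c > 0" for c x
    unfolding G_def t_def by (rule homogeneous_times_N_powr[where g = g, OF that g[OF that]])
  have eq: "(\<integral>\<^sup>+x. G x * ennreal (f x) \<partial>lborel_n n) = (\<integral>\<^sup>+x\<in>A. G x \<partial>lborel_n n)"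
    by (rule nn_integral_f_eq_A) (auto simp: hom, simp add: G_def t_def)
  have t_A: "t x \<le> 1" if "x \<in> A" for x
    using that q unfolding t_def A_def by (auto intro: powr_le1)
  have "(\<integral>\<^sup>+x\<in>A. G x \<partial>lborel_n n) \<le> (\<integral>\<^sup>+x\<in>A. g x \<partial>lborel_n n)"
  proof (rule nn_integral_mono)
    fix x
    show "G x * indicator A x \<le> g x * indicator A x"
    proof (cases "x \<in> A")
      case True
      then have "g x * ennreal (t x) \<le> g x * ennreal 1" by (intro mult_left_mono ennreal_leI t_A) auto
      then show ?thesis using True by (simp add: G_def)
    qed simp
  qed
  \<comment> \<open>Finiteness permits cancelling this integral from both sides at the end.\<close>
  then have Gfin: "(\<integral>\<^sup>+x\<in>A. G x \<partial>lborel_n n) \<noteq> top"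
    using fin by (auto simp: top_unique)
  have "(\<integral>\<^sup>+x. g x * ennreal (f x) \<partial>lborel_n n) + (\<integral>\<^sup>+x\<in>A. G x \<partial>lborel_n n)
      = (\<integral>\<^sup>+x. g x * ennreal (f x) + G x * indicator A x \<partial>lborel_n n)"
    by (rule nn_integral_add[symmetric]) measurable
  also have "\<dots> \<le> (\<integral>\<^sup>+x. g x * indicator A x + G x * ennreal (f x) \<partial>lborel_n n)"
  proof (rule nn_integral_mono_AE)
    show "AE x in lborel_n n. g x * ennreal (f x) + G x * indicator A x \<le> g x * indicator A x + G x * ennreal (f x)"
      using AE_lborel_n_Rn[of n]
    proof eventually_elim
      fix x assume x: "x \<in> Rn n"
      have t0: "0 \<le> t x" by (simp add: t_def)
      show "g x * ennreal (f x) + G x * indicator A x \<le> g x * indicator A x + G x * ennreal (f x)"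
      proof (cases "x \<in> A")
        case True
        have "0 \<le> (1 - f x) * (1 - t x)" using f_le_1 t_A[OF True] by simp
        then have "f x + t x \<le> 1 + t x * f x" by (simp add: algebra_simps)
        then have "g x * ennreal (f x + t x) \<le> g x * ennreal (1 + t x * f x)"
          by (intro mult_left_mono ennreal_leI) auto
        then show ?thesis
          using True t0 by (simp add: G_def distrib_left ennreal_mult mult.assoc)
      next
        case False
        then have "N x \<ge> 1" using x by (auto simp: A_def)
        then have "1 \<le> t x" using q by (auto simp: t_def ge_one_powr_ge_zero)
        then have "1 * f x \<le> t x * f x" by (intro mult_right_mono) auto
        then have "g x * ennreal (f x) \<le> g x * ennreal (t x * f x)"
          by (intro mult_left_mono ennreal_leI) auto
        then show ?thesis
          using False t0 by (simp add: G_def ennreal_mult mult.assoc)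
      qed
    qed
  qed
  also have "\<dots> = (\<integral>\<^sup>+x\<in>A. g x \<partial>lborel_n n) + (\<integral>\<^sup>+x\<in>A. G x \<partial>lborel_n n)"
    unfolding eq[symmetric] by (rule nn_integral_add) measurable
  finally show ?thesis
    using Gfin by (simp add: add.commute)
qed

(* Where N <= 4 the factor N ^ (q - 2) is harmless. Elsewhere f x <= 4/3 (f (x/2))^2 and
   f (x/2) <= (N x / 2) ^ -(n + 2) absorb it, at the price of a dilation by 2. *)
lemma moment_comparison_high:
  assumes [measurable]: "g \<in> borel_measurable borel" and q: "2 \<le> q" "q \<le> real n" and C: "0 \<le> C"
    and g: "\<And>c x. c > 0 \<Longrightarrow> g (\<lambda>i. c * x i) = ennreal (c powr q) * g x"
    and bound: "\<And>x. g x \<le> ennreal (C * norm_n n x powr q)"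
  shows "(\<integral>\<^sup>+x. g x * ennreal (f x) \<partial>lborel_n n) \<le> ennreal (8 powr q) * (\<integral>\<^sup>+x\<in>A. g x \<partial>lborel_n n)"
proof -
  define t where "t x = N x powr (2 - q)" for x
  have [measurable]: "t \<in> borel_measurable borel" unfolding t_def by measurable
  have t0: "0 \<le> t x" for x by (simp add: t_def)
  define G where "G x = g x * ennreal (t x)" for x
  have [measurable]: "G \<in> borel_measurable borel" unfolding G_def by measurable
  have hom: "G (\<lambda>i. c * x i) = ennreal (c\<^sup>2) * G x" if "c > 0" for c x
    unfolding G_def t_def by (rule homogeneous_times_N_powr[where g = g, OF that g[OF that]])
  have G0: "G (\<lambda>_. 0) = 0" by (simp add: G_def t_def)
  have g0: "g (\<lambda>_. 0) = 0" using bound[of "\<lambda>_. 0"] by simp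
  define X where "X = (\<integral>\<^sup>+x\<in>A. G x \<partial>lborel_n n)"
  have eq: "(\<integral>\<^sup>+x. G x * ennreal (f x) \<partial>lborel_n n) = X"
    unfolding X_def by (rule nn_integral_f_eq_A) (auto simp: hom G0)
  have gG: "g x = G x * ennreal (N x powr (q - 2))" if "x \<in> Rn n" for x
  proof (cases "x = (\<lambda>_. 0)")
    case False
    have "N x > 0" by (rule J_eq_N(1)[OF Rn_norm_pos[OF that False]])
    then have "t x * N x powr (q - 2) = 1" by (simp add: t_def powr_add[symmetric])
    then have "ennreal (t x) * ennreal (N x powr (q - 2)) = 1" by (simp add: ennreal_mult[symmetric] t0)
    then show ?thesis by (simp add: G_def mult.assoc)
  qed (simp add: g0 G0)
  \<comment> \<open>\<open>X\<close> must be finite because a quarter of it is absorbed into the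
    left-hand side further down.\<close>
  have Xfin: "X \<noteq> top"
  proof -
    have "X \<le> (\<integral>\<^sup>+x\<in>A. ennreal (C * T powr q) \<partial>lborel_n n)"
      unfolding X_def
    proof (rule nn_integral_mono)
      fix x
      show "G x * indicator A x \<le> ennreal (C * T powr q) * indicator A x"
      proof (cases "x \<in> A")
        case True
        then have x: "x \<in> Rn n" "N x \<le> 1" by (auto simp: A_def)
        have "C * norm_n n x powr q * t x \<le> C * (T * N x) powr q * t x"
          using q norm_le_T_N[OF x(1)] t0 C by (intro mult_right_mono mult_left_mono powr_mono2) auto
        also have "\<dots> = C * T powr q * (N x powr q * N x powr (2 - q))"
          using T_pos by (simp add: powr_mult t_def)
        also have "\<dots> \<le> C * T powr q * 1"
          using C x(2) by (intro mult_left_mono) (auto simp: powr_add[symmetric] power_le_one)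
        finally have le: "C * norm_n n x powr q * t x \<le> C * T powr q" by simp
        have "G x \<le> ennreal (C * norm_n n x powr q) * ennreal (t x)"
          unfolding G_def by (intro mult_right_mono bound) auto
        also have "\<dots> \<le> ennreal (C * T powr q)"
          using le C t0 by (simp add: ennreal_mult[symmetric] ennreal_leI)
        finally show ?thesis using True by simp
      qed simp
    qed
    also have "\<dots> = ennreal (C * T powr q) * emeasure (lborel_n n) A"
      by (rule nn_integral_cmult_indicator) simp
    also have "\<dots> < top" using A_finite by (simp add: ennreal_mult_less_top)
    finally show ?thesis by simp
  qed
  \<comment> \<open>The dilation by 2 gives \<open>2 ^ n\<close> from the volume and 4 from
    homogeneity, which is what \<open>power_quotient_bound\<close> pays back.\<close>
  have half: "(\<integral>\<^sup>+x. G x * ennreal (f (\<lambda>i. x i / 2)) \<partial>lborel_n n) = ennreal (2 ^ (n + 2)) * X"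
  proof -
    have fh: "(\<lambda>x. f (\<lambda>i. x i / 2)) \<in> borel_measurable borel"
      by (rule f_divide_measurable[where g = "\<lambda>x. x" and c = "\<lambda>_. 2"]) simp_all
    have "(\<integral>\<^sup>+x. G x * ennreal (f (\<lambda>i. x i / 2)) \<partial>lborel_n n)
        = ennreal (2 ^ n) * (\<integral>\<^sup>+x. G (\<lambda>i. 2 * x i) * ennreal (f (\<lambda>i. 2 * x i / 2)) \<partial>lborel_n n)"
      by (rule nn_integral_lborel_n_scale, intro borel_measurable_times_ennreal \<open>G \<in> borel_measurable borel\<close>
          measurable_compose[OF fh measurable_ennreal]) simp
    also have "(\<integral>\<^sup>+x. G (\<lambda>i. 2 * x i) * ennreal (f (\<lambda>i. 2 * x i / 2)) \<partial>lborel_n n)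
        = (\<integral>\<^sup>+x. ennreal 4 * (G x * ennreal (f x)) \<partial>lborel_n n)"
      by (intro nn_integral_cong) (simp add: hom mult.assoc)
    also have "\<dots> = ennreal 4 * X"
      unfolding eq[symmetric] by (rule nn_integral_cmult) measurable
    finally show ?thesis by (simp add: mult.assoc[symmetric] ennreal_mult[symmetric] power_add mult.commute[of 4] del: ennreal_numeral)
  qed
  let ?c = "4 powr (q - 2) :: real"
  have "(\<integral>\<^sup>+x. g x * ennreal (f x) \<partial>lborel_n n)
      \<le> (\<integral>\<^sup>+x. ennreal ?c * (G x * ennreal (f x)) + ennreal (4 / 3 * (?c / 2 ^ (n + 2))) * (G x * ennreal (f (\<lambda>i. x i / 2))) \<partial>lborel_n n)"
  proof (rule nn_integral_mono_AE)
    show "AE x in lborel_n n. g x * ennreal (f x) \<le> ennreal ?c * (G x * ennreal (f x))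
        + ennreal (4 / 3 * (?c / 2 ^ (n + 2))) * (G x * ennreal (f (\<lambda>i. x i / 2)))"
      using AE_lborel_n_Rn[of n]
    proof eventually_elim
      fix x assume x: "x \<in> Rn n"
      show "g x * ennreal (f x) \<le> ennreal ?c * (G x * ennreal (f x))
        + ennreal (4 / 3 * (?c / 2 ^ (n + 2))) * (G x * ennreal (f (\<lambda>i. x i / 2)))"
      proof (cases "N x \<le> 4")
        case True
        have "N x powr (q - 2) \<le> ?c" using True q by (intro powr_mono2) auto
        then have "G x * ennreal (N x powr (q - 2)) * ennreal (f x) \<le> G x * ennreal ?c * ennreal (f x)"
          by (intro mult_right_mono mult_left_mono ennreal_leI) auto
        then have "g x * ennreal (f x) \<le> ennreal ?c * (G x * ennreal (f x))"
          unfolding gG[OF x] by (simp only: mult_ac)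
        then show ?thesis by (rule order_trans) simp
      next
        case False
        then have N4: "N x \<ge> 4" by simp
        then have "x \<noteq> (\<lambda>_. 0)" by auto
        then have nx: "norm_n n x > 0" by (rule Rn_norm_pos[OF x])
        let ?h = "\<lambda>i. x i / 2"
        have Nh: "N ?h = N x / 2" using N_scale[of "1 / 2" x] by simp
        have "norm_n n ?h > 0" using nx by (simp add: norm_n_divide)
        then have fh: "f ?h \<le> 1 / (N x / 2) ^ (n + 2)" using f_le_N[of ?h] unfolding Nh by simp
        have "f x * (3 / 4) \<le> f x * f (\<lambda>_. 0)"
          using f_core[of "\<lambda>_. 0"] r_pos by (intro mult_left_mono) auto
        also have "\<dots> \<le> (f ?h)\<^sup>2" by (rule f_midpoint)
        also have "\<dots> \<le> 1 / (N x / 2) ^ (n + 2) * f ?h"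
          unfolding power2_eq_square using fh by (intro mult_right_mono) auto
        also have "1 / (N x / 2) ^ (n + 2) = 2 ^ (n + 2) / N x ^ (n + 2)"
          by (simp only: power_divide divide_divide_eq_right mult_1)
        finally have "f x \<le> 4 / 3 * (2 ^ (n + 2) / N x ^ (n + 2)) * f ?h" by simp
        then have "N x powr (q - 2) * f x \<le> N x powr (q - 2) * (4 / 3 * (2 ^ (n + 2) / N x ^ (n + 2)) * f ?h)"
          by (intro mult_left_mono) auto
        also have "\<dots> = 4 / 3 * (N x powr (q - 2) * (2 ^ (n + 2) / N x ^ (n + 2))) * f ?h" by simp
        also have "\<dots> \<le> 4 / 3 * (?c / 2 ^ (n + 2)) * f ?h"
          by (intro mult_left_mono mult_right_mono power_quotient_bound N4 q) auto
        finally have "G x * ennreal (N x powr (q - 2) * f x) \<le> G x * ennreal (4 / 3 * (?c / 2 ^ (n + 2)) * f ?h)"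
          by (intro mult_left_mono ennreal_leI) auto
        then have "G x * ennreal (N x powr (q - 2)) * ennreal (f x) \<le> ennreal (4 / 3 * (?c / 2 ^ (n + 2))) * (G x * ennreal (f ?h))"
          by (subst (asm) (1 2) ennreal_mult) (auto simp: mult_ac)
        then show ?thesis unfolding gG[OF x, symmetric] by (rule order_trans) simp
      qed
    qed
  qed
  also have "\<dots> = ennreal ?c * X + ennreal (4 / 3 * (?c / 2 ^ (n + 2))) * (ennreal (2 ^ (n + 2)) * X)"
    unfolding eq[symmetric] half[unfolded eq[symmetric], symmetric]
    by (subst nn_integral_add, measurable, subst (1 2) nn_integral_cmult) auto
  also have "\<dots> = ennreal (7 / 3 * ?c) * X"
  proof -
    have "ennreal (4 / 3 * (?c / 2 ^ (n + 2))) * (ennreal (2 ^ (n + 2)) * X) = ennreal (4 / 3 * ?c) * X"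
      by (simp add: mult.assoc[symmetric] ennreal_mult[symmetric] del: power_add power_Suc add_2_eq_Suc')
    then show ?thesis by (simp add: distrib_right[symmetric] ennreal_plus[symmetric] del: ennreal_plus)
  qed
  finally have 1: "(\<integral>\<^sup>+x. g x * ennreal (f x) \<partial>lborel_n n) \<le> ennreal (7 / 3 * ?c) * X" .
  \<comment> \<open>It remains to bound \<open>X\<close>, whose weight \<open>N ^ (2 - q)\<close>
    may blow up at the origin. The half-size copy \<open>S\<close> of \<open>A\<close> carries at
    most a quarter of \<open>X\<close> by homogeneity, and on the rest of \<open>A\<close> the
    weight is at most \<open>2 powr (q - 2)\<close>. Hence the factor 4/3 below.\<close>
  define S where "S = {x. (\<lambda>i. 2 * x i) \<in> A}"
  have S [measurable]: "S \<in> sets borel" unfolding S_def by measurable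
  have memS: "x \<in> S \<longleftrightarrow> x \<in> A \<and> N x \<le> 1 / 2" if "x \<in> Rn n" for x
    using N_scale[of 2 x] that Rn_scale[OF that, of 2] by (auto simp: S_def A_def)
  have XS: "ennreal 4 * (\<integral>\<^sup>+x\<in>S. G x \<partial>lborel_n n) \<le> X"
  proof -
    have "X = ennreal (2 ^ n) * (\<integral>\<^sup>+x. G (\<lambda>i. 2 * x i) * indicator A (\<lambda>i. 2 * x i) \<partial>lborel_n n)"
      unfolding X_def by (rule nn_integral_lborel_n_scale)
        (intro borel_measurable_times_ennreal borel_measurable_indicator A_borel \<open>G \<in> borel_measurable borel\<close>, simp)
    also have "(\<integral>\<^sup>+x. G (\<lambda>i. 2 * x i) * indicator A (\<lambda>i. 2 * x i) \<partial>lborel_n n)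
        = (\<integral>\<^sup>+x. ennreal 4 * (G x * indicator S x) \<partial>lborel_n n)"
      by (intro nn_integral_cong) (auto simp: hom S_def indicator_def)
    also have "\<dots> = ennreal 4 * (\<integral>\<^sup>+x\<in>S. G x \<partial>lborel_n n)"
      by (rule nn_integral_cmult) measurable
    finally have "X = ennreal (2 ^ n) * (ennreal 4 * (\<integral>\<^sup>+x\<in>S. G x \<partial>lborel_n n))" .
    moreover have "1 * Y \<le> ennreal (2 ^ n) * Y" for Y :: ennreal
      by (intro mult_right_mono) (auto simp: ennreal_1[symmetric] simp del: ennreal_1)
    ultimately show ?thesis by simp
  qed
  have "X \<le> (\<integral>\<^sup>+x. G x * indicator S x + ennreal (2 powr (q - 2)) * (g x * indicator A x) \<partial>lborel_n n)"
    unfolding X_def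
  proof (rule nn_integral_mono_AE)
    show "AE x in lborel_n n. G x * indicator A x \<le> G x * indicator S x + ennreal (2 powr (q - 2)) * (g x * indicator A x)"
      using AE_lborel_n_Rn[of n]
    proof eventually_elim
      fix x assume x: "x \<in> Rn n"
      show "G x * indicator A x \<le> G x * indicator S x + ennreal (2 powr (q - 2)) * (g x * indicator A x)"
      proof (cases "x \<in> S \<or> x \<notin> A")
        case False
        then have "N x \<ge> 1 / 2" using memS[OF x] by auto
        then have "t x \<le> (1 / 2) powr (2 - q)" unfolding t_def using q by (intro powr_mono2') auto
        also have "(1 / 2 :: real) powr (2 - q) = 2 powr (q - 2)"
          by (simp add: powr_divide powr_diff)
        finally have "g x * ennreal (t x) \<le> g x * ennreal (2 powr (q - 2))"
          by (intro mult_left_mono ennreal_leI) auto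
        then show ?thesis using False by (simp add: G_def mult.commute)
      qed (auto simp: indicator_def)
    qed
  qed
  also have "\<dots> = (\<integral>\<^sup>+x\<in>S. G x \<partial>lborel_n n) + ennreal (2 powr (q - 2)) * (\<integral>\<^sup>+x\<in>A. g x \<partial>lborel_n n)"
    by (subst nn_integral_add, measurable, subst nn_integral_cmult) auto
  finally have 2: "X \<le> (\<integral>\<^sup>+x\<in>S. G x \<partial>lborel_n n) + ennreal (2 powr (q - 2)) * (\<integral>\<^sup>+x\<in>A. g x \<partial>lborel_n n)" .
  define Y where "Y = (\<integral>\<^sup>+x\<in>S. G x \<partial>lborel_n n)"
  define Z where "Z = (\<integral>\<^sup>+x\<in>A. g x \<partial>lborel_n n)"
  have 3: "ennreal (7 / 3 * ?c) * X \<le> ennreal (8 powr q) * Z"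
  proof (cases "Z = top")
    case True
    then show ?thesis by (simp add: ennreal_mult_top)
  next
    case False
    obtain x where x: "X = ennreal x" "x \<ge> 0" using Xfin by (cases X) auto
    have "Y \<noteq> top" using XS Xfin unfolding Y_def[symmetric] by (auto simp: ennreal_mult_top top_unique)
    then obtain y where y: "Y = ennreal y" "y \<ge> 0" by (cases Y) auto
    obtain z where z: "Z = ennreal z" "z \<ge> 0" using False by (cases Z) auto
    have xy: "4 * y \<le> x" using XS unfolding Y_def[symmetric] x y
      using x(2) y(2) by (simp add: ennreal_mult[symmetric] del: ennreal_numeral)
    have xz: "x \<le> y + 2 powr (q - 2) * z" using 2 unfolding Y_def[symmetric] Z_def[symmetric] x y z
      using x(2) y(2) z(2) by (simp add: ennreal_mult[symmetric] ennreal_plus[symmetric] del: ennreal_plus)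
    have "x \<le> 4 / 3 * (2 powr (q - 2) * z)" using xy xz by simp
    then have "7 / 3 * ?c * x \<le> 7 / 3 * ?c * (4 / 3 * (2 powr (q - 2) * z))" by (intro mult_left_mono) auto
    also have "\<dots> = 28 / 9 * ((4 * 2) powr (q - 2)) * z" by (subst powr_mult) auto
    also have "\<dots> = 28 / 9 / 64 * (8 powr q * z)" by (simp add: powr_diff)
    also have "\<dots> \<le> 1 * (8 powr q * z)" using z(2) by (intro mult_right_mono) auto
    finally show ?thesis
      unfolding x z using x(2) z(2) by (simp add: ennreal_mult[symmetric] ennreal_leI)
  qed
  show ?thesis using order_trans[OF 1 3] unfolding Z_def .
qed

section \<open>Averaging over the smoothing ball\<close>

abbreviation B :: "(nat \<Rightarrow> real) set" where
  "B \<equiv> {z. norm_n n z \<le> R}"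

lemma nn_integral_f:
  assumes [measurable]: "g \<in> borel_measurable borel"
  shows "(\<integral>\<^sup>+x. g x * ennreal (f x) \<partial>lborel_n n)
    = (\<integral>\<^sup>+y. indicator K y * (\<integral>\<^sup>+b. g (\<lambda>i. b i + y i) * indicator B b \<partial>lborel_n n) \<partial>lborel_n n)"
proof -
  interpret pair_sigma_finite "lborel_n n" "lborel_n n"
    by (intro pair_sigma_finite.intro sigma_finite_lborel_n)
  have "(\<integral>\<^sup>+x. g x * ennreal (f x) \<partial>lborel_n n)
      = (\<integral>\<^sup>+x. \<integral>\<^sup>+y. g x * (indicator K y * indicator B (\<lambda>i. x i - y i)) \<partial>lborel_n n \<partial>lborel_n n)"
    unfolding f_eq_nn_integral by (intro nn_integral_cong nn_integral_cmult[symmetric]) measurable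
  also have "\<dots> = (\<integral>\<^sup>+y. \<integral>\<^sup>+x. g x * (indicator K y * indicator B (\<lambda>i. x i - y i)) \<partial>lborel_n n \<partial>lborel_n n)"
    by (rule Fubini'[symmetric]) measurable
  also have "\<dots> = (\<integral>\<^sup>+y. indicator K y * (\<integral>\<^sup>+b. g (\<lambda>i. b i + y i) * indicator B b \<partial>lborel_n n) \<partial>lborel_n n)"
  proof (rule nn_integral_cong)
    fix y :: "nat \<Rightarrow> real"
    show "(\<integral>\<^sup>+x. g x * (indicator K y * indicator B (\<lambda>i. x i - y i)) \<partial>lborel_n n)
      = indicator K y * (\<integral>\<^sup>+b. g (\<lambda>i. b i + y i) * indicator B b \<partial>lborel_n n)"
    proof (cases "y \<in> K")
      case True
      then have y: "y \<in> Rn n" using K_Rn by blast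
      have "(\<integral>\<^sup>+x. g x * indicator B (\<lambda>i. x i - y i) \<partial>lborel_n n)
          = (\<integral>\<^sup>+b. g (\<lambda>i. b i + y i) * indicator B (\<lambda>i. b i + y i - y i) \<partial>lborel_n n)"
        by (rule nn_integral_lborel_n_translate[OF _ y, symmetric]) measurable
      then show ?thesis using True by simp
    qed simp
  qed
  finally show ?thesis .
qed

text \<open>Jensen's inequality for symmetric noise: pairing \<open>b\<close> with \<open>-b\<close>
  in the ball, midpoint convexity bounds the average of \<open>g\<close> around \<open>y\<close>
  from below by \<open>g y\<close>.\<close>

lemma nn_integral_f_ge:
  assumes [measurable]: "g \<in> borel_measurable borel"
    and g: "\<And>y b. y \<in> Rn n \<Longrightarrow> b \<in> Rn n \<Longrightarrow> 2 * g y \<le> g (\<lambda>i. b i + y i) + g (\<lambda>i. - b i + y i)"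
  shows "emeasure (lborel_n n) B * (\<integral>\<^sup>+y\<in>K. g y \<partial>lborel_n n) \<le> (\<integral>\<^sup>+x. g x * ennreal (f x) \<partial>lborel_n n)"
proof -
  have inner: "g y * emeasure (lborel_n n) B \<le> (\<integral>\<^sup>+b. g (\<lambda>i. b i + y i) * indicator B b \<partial>lborel_n n)" if y: "y \<in> Rn n" for y
  proof -
    let ?I = "(\<integral>\<^sup>+b. g (\<lambda>i. b i + y i) * indicator B b \<partial>lborel_n n)"
    have refl: "(\<integral>\<^sup>+b. g (\<lambda>i. - b i + y i) * indicator B b \<partial>lborel_n n) = ?I"
      using nn_integral_lborel_n_reflect[of "\<lambda>b. g (\<lambda>i. b i + y i) * indicator B b" n]
      by (simp add: norm_n_minus indicator_def)
    have "2 * (g y * emeasure (lborel_n n) B) = (\<integral>\<^sup>+b\<in>B. 2 * g y \<partial>lborel_n n)"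
      by (subst nn_integral_cmult_indicator) (auto simp: mult.assoc)
    also have "\<dots> \<le> (\<integral>\<^sup>+b. g (\<lambda>i. b i + y i) * indicator B b + g (\<lambda>i. - b i + y i) * indicator B b \<partial>lborel_n n)"
    proof (rule nn_integral_mono_AE)
      show "AE b in lborel_n n. 2 * g y * indicator B b \<le> g (\<lambda>i. b i + y i) * indicator B b + g (\<lambda>i. - b i + y i) * indicator B b"
        using AE_lborel_n_Rn[of n] by eventually_elim (use g[OF y] in \<open>auto simp: indicator_def\<close>)
    qed
    also have "\<dots> = ?I + (\<integral>\<^sup>+b. g (\<lambda>i. - b i + y i) * indicator B b \<partial>lborel_n n)"
      by (rule nn_integral_add) measurable
    also have "\<dots> = 2 * ?I" unfolding refl by (rule mult_2[symmetric])
    finally show ?thesis by (simp add: ennreal_mult_le_mult_iff)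
  qed
  have "emeasure (lborel_n n) B * (\<integral>\<^sup>+y\<in>K. g y \<partial>lborel_n n)
      = (\<integral>\<^sup>+y. emeasure (lborel_n n) B * (g y * indicator K y) \<partial>lborel_n n)"
    by (rule nn_integral_cmult[symmetric]) measurable
  also have "\<dots> \<le> (\<integral>\<^sup>+y. indicator K y * (\<integral>\<^sup>+b. g (\<lambda>i. b i + y i) * indicator B b \<partial>lborel_n n) \<partial>lborel_n n)"
  proof (rule nn_integral_mono)
    fix y :: "nat \<Rightarrow> real"
    show "emeasure (lborel_n n) B * (g y * indicator K y)
       \<le> indicator K y * (\<integral>\<^sup>+b. g (\<lambda>i. b i + y i) * indicator B b \<partial>lborel_n n)"
      using inner[of y] K_Rn by (cases "y \<in> K") (auto simp: mult.commute)
  qed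
  also have "\<dots> = (\<integral>\<^sup>+x. g x * ennreal (f x) \<partial>lborel_n n)" by (rule nn_integral_f[symmetric]) measurable
  finally show ?thesis .
qed

text \<open>Pairing \<open>b\<close> with \<open>-b\<close> removes the mixed term, so the second
  moments of \<open>K\<close> and \<open>B\<close> add, each weighted by the volume of the other
  set; that of \<open>K\<close> is 1.\<close>

lemma second_moment_f:
  "(\<integral>\<^sup>+x. ennreal ((inner_n n x \<theta>)\<^sup>2) * ennreal (f x) \<partial>lborel_n n)
    = emeasure (lborel_n n) B * (\<integral>\<^sup>+y\<in>K. ennreal ((inner_n n y \<theta>)\<^sup>2) \<partial>lborel_n n)
      + (\<integral>\<^sup>+b\<in>B. ennreal ((inner_n n b \<theta>)\<^sup>2) \<partial>lborel_n n)"
proof -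
  let ?g = "\<lambda>x. ennreal ((inner_n n x \<theta>)\<^sup>2)"
  let ?Q = "\<integral>\<^sup>+b\<in>B. ?g b \<partial>lborel_n n"
  have inner: "(\<integral>\<^sup>+b. ?g (\<lambda>i. b i + y i) * indicator B b \<partial>lborel_n n) = ?g y * emeasure (lborel_n n) B + ?Q" for y
  proof -
    let ?I = "(\<integral>\<^sup>+b. ?g (\<lambda>i. b i + y i) * indicator B b \<partial>lborel_n n)"
    have refl: "(\<integral>\<^sup>+b. ?g (\<lambda>i. - b i + y i) * indicator B b \<partial>lborel_n n) = ?I"
      using nn_integral_lborel_n_reflect[of "\<lambda>b. ?g (\<lambda>i. b i + y i) * indicator B b" n]
      by (simp add: norm_n_minus indicator_def)
    have "2 * ?I = ?I + (\<integral>\<^sup>+b. ?g (\<lambda>i. - b i + y i) * indicator B b \<partial>lborel_n n)"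
      unfolding refl by (rule mult_2)
    also have "\<dots> = (\<integral>\<^sup>+b. ?g (\<lambda>i. b i + y i) * indicator B b + ?g (\<lambda>i. - b i + y i) * indicator B b \<partial>lborel_n n)"
      by (rule nn_integral_add[symmetric]) measurable
    also have "\<dots> = (\<integral>\<^sup>+b. 2 * ?g y * indicator B b + 2 * (?g b * indicator B b) \<partial>lborel_n n)"
    proof (rule nn_integral_cong)
      fix b :: "nat \<Rightarrow> real"
      have "(u + v)\<^sup>2 + (- u + v)\<^sup>2 = 2 * v\<^sup>2 + 2 * u\<^sup>2" for u v :: real
        by (simp add: power2_eq_square algebra_simps)
      then have "ennreal ((u + v)\<^sup>2) + ennreal ((- u + v)\<^sup>2) = ennreal (2 * v\<^sup>2 + 2 * u\<^sup>2)" for u v :: real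
        by (simp only: ennreal_plus[OF zero_le_power2 zero_le_power2, symmetric])
      moreover have "ennreal (2 * v\<^sup>2 + 2 * u\<^sup>2) = 2 * ennreal (v\<^sup>2) + 2 * ennreal (u\<^sup>2)" for u v :: real
        by (simp add: ennreal_mult)
      ultimately have "ennreal ((u + v)\<^sup>2) + ennreal ((- u + v)\<^sup>2) = 2 * ennreal (v\<^sup>2) + 2 * ennreal (u\<^sup>2)" for u v :: real
        by (simp only:)
      then show "?g (\<lambda>i. b i + y i) * indicator B b + ?g (\<lambda>i. - b i + y i) * indicator B b = 2 * ?g y * indicator B b + 2 * (?g b * indicator B b)"
        by (cases "b \<in> B") (simp_all only: inner_n_add_left inner_n_minus_left indicator_simps mult_1_right mult_zero_right add_0_right not_False_eq_True)
    qed
    also have "\<dots> = 2 * ?g y * emeasure (lborel_n n) B + 2 * ?Q"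
      by (subst nn_integral_add, measurable, subst nn_integral_cmult_indicator, simp, subst nn_integral_cmult) auto
    also have "\<dots> = 2 * (?g y * emeasure (lborel_n n) B + ?Q)" by (simp add: distrib_left mult.assoc)
    finally show ?thesis by (simp only: ennreal_mult_cancel_left) auto
  qed
  have "(\<integral>\<^sup>+x. ?g x * ennreal (f x) \<partial>lborel_n n)
      = (\<integral>\<^sup>+y. indicator K y * (\<integral>\<^sup>+b. ?g (\<lambda>i. b i + y i) * indicator B b \<partial>lborel_n n) \<partial>lborel_n n)"
    by (rule nn_integral_f) measurable
  also have "\<dots> = (\<integral>\<^sup>+y. emeasure (lborel_n n) B * (?g y * indicator K y) + ?Q * indicator K y \<partial>lborel_n n)"
    unfolding inner by (intro nn_integral_cong) (simp add: distrib_left mult_ac)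
  also have "\<dots> = emeasure (lborel_n n) B * (\<integral>\<^sup>+y\<in>K. ?g y \<partial>lborel_n n) + ?Q * emeasure (lborel_n n) K"
    by (subst nn_integral_add, measurable, subst nn_integral_cmult_indicator, simp, subst nn_integral_cmult) auto
  finally show ?thesis using K_volume by simp
qed

end

section \<open>Second moments\<close>

lemma emeasure_norm_ball_scale:
  assumes t: "t > 0"
  shows "emeasure (lborel_n n) {z. norm_n n z \<le> t} = ennreal (t ^ n) * emeasure (lborel_n n) {z. norm_n n z \<le> 1}"
proof -
  have "emeasure (lborel_n n) {z. norm_n n z \<le> t} = (\<integral>\<^sup>+x. indicator {z. norm_n n z \<le> t} x \<partial>lborel_n n)"
    by (rule nn_integral_indicator[symmetric]) simp
  also have "\<dots> = ennreal (t ^ n) * (\<integral>\<^sup>+x. indicator {z. norm_n n z \<le> t} (\<lambda>i. t * x i) \<partial>lborel_n n)"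
    by (rule nn_integral_lborel_n_scale) (use t in simp_all)
  also have "(\<integral>\<^sup>+x. indicator {z. norm_n n z \<le> t} (\<lambda>i. t * x i) \<partial>lborel_n n) = (\<integral>\<^sup>+x. indicator {z. norm_n n z \<le> 1} x \<partial>lborel_n n)"
    using t by (intro nn_integral_cong) (auto simp: indicator_def norm_n_scale field_simps)
  also have "\<dots> = emeasure (lborel_n n) {z. norm_n n z \<le> 1}"
    by (rule nn_integral_indicator) simp
  finally show ?thesis .
qed

section \<open>Second moments of a ball from sign changes and transpositions\<close>

definition basis_n :: "nat \<Rightarrow> nat \<Rightarrow> real" where
  "basis_n i = (\<lambda>j. if j = i then 1 else 0)"

lemma inner_basis_n: "i < n \<Longrightarrow> inner_n n x (basis_n i) = x i"
  by (simp add: inner_n_def basis_n_def if_distrib cong: if_cong)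

lemma norm_basis_n: "i < n \<Longrightarrow> norm_n n (basis_n i) = 1"
  by (simp add: norm_n_def inner_basis_n) (simp add: basis_n_def)

lemma norm_n_flip: "norm_n n (x(i := - x i)) = norm_n n x"
  unfolding norm_n_def inner_n_def by (rule arg_cong[where f = sqrt], rule sum.cong) auto

lemma inner_n_flip: "inner_n n (x(i := - x i)) y = inner_n n x (y(i := - y i))"
  unfolding inner_n_def by (rule sum.cong) auto

lemma ennreal_norm_n_power2: "ennreal ((norm_n n x)\<^sup>2) = (\<Sum>i<n. ennreal ((inner_n n x (basis_n i))\<^sup>2))"
  by (simp add: norm_n_power2 inner_basis_n)

definition ball_moment :: "nat \<Rightarrow> real \<Rightarrow> (nat \<Rightarrow> real) \<Rightarrow> ennreal" where
  "ball_moment n R \<theta> = (\<integral>\<^sup>+b\<in>{z. norm_n n z \<le> R}. ennreal ((inner_n n b \<theta>)\<^sup>2) \<partial>lborel_n n)"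

lemma ball_moment_flip: "ball_moment n R (\<theta>(i := - \<theta> i)) = ball_moment n R \<theta>"
  unfolding ball_moment_def
  using nn_integral_lborel_n_reflect_coordinate[of "\<lambda>b. ennreal ((inner_n n b \<theta>)\<^sup>2) * indicator {z. norm_n n z \<le> R} b" n i]
  by (simp add: inner_n_flip norm_n_flip indicator_def cong: if_cong)

text \<open>Reflecting the i-th coordinate preserves the ball, so \<open>c\<close> and
  \<open>-c\<close> give the same moment; in their sum the mixed term disappears. The quadratic form
  is therefore diagonal.\<close>

lemma ball_moment_add_basis:
  assumes i: "i < n" and a: "a i = 0"
  shows "ball_moment n R (a(i := c)) = ball_moment n R a + ennreal (c\<^sup>2) * ball_moment n R (basis_n i)"
proof -
  have inner: "inner_n n b (a(i := d)) = inner_n n b a + d * inner_n n b (basis_n i)" for b d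
  proof -
    have "b j * (a(i := d)) j = b j * a j + d * (b j * basis_n i j)" for j
      using a by (simp add: basis_n_def)
    then show ?thesis by (simp add: inner_n_def sum.distrib sum_distrib_left)
  qed
  have alg: "ennreal ((u + c * v)\<^sup>2) + ennreal ((u + - c * v)\<^sup>2) = 2 * ennreal (u\<^sup>2) + 2 * (ennreal (c\<^sup>2) * ennreal (v\<^sup>2))" for u v
  proof -
    have "ennreal ((u + c * v)\<^sup>2) + ennreal ((u + - c * v)\<^sup>2) = ennreal ((u + c * v)\<^sup>2 + (u + - c * v)\<^sup>2)"
      by (simp only: ennreal_plus[OF zero_le_power2 zero_le_power2, symmetric])
    also have "(u + c * v)\<^sup>2 + (u + - c * v)\<^sup>2 = 2 * u\<^sup>2 + 2 * (c\<^sup>2 * v\<^sup>2)"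
      by (simp add: power2_eq_square algebra_simps)
    finally show ?thesis by (simp add: ennreal_mult)
  qed
  let ?I = "indicator {z. norm_n n z \<le> R} :: (nat \<Rightarrow> real) \<Rightarrow> ennreal"
  have "2 * ball_moment n R (a(i := c)) = ball_moment n R (a(i := c)) + ball_moment n R (a(i := - c))"
    using ball_moment_flip[of n R "a(i := c)" i] by (simp add: mult_2)
  also have "\<dots> = (\<integral>\<^sup>+b. ennreal ((inner_n n b (a(i := c)))\<^sup>2) * ?I b + ennreal ((inner_n n b (a(i := - c)))\<^sup>2) * ?I b \<partial>lborel_n n)"
    unfolding ball_moment_def by (rule nn_integral_add[symmetric]) measurable
  also have "\<dots> = (\<integral>\<^sup>+b. 2 * (ennreal ((inner_n n b a)\<^sup>2) * ?I b)
      + 2 * (ennreal (c\<^sup>2) * (ennreal ((inner_n n b (basis_n i))\<^sup>2) * ?I b)) \<partial>lborel_n n)"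
    unfolding inner by (intro nn_integral_cong) (simp only: distrib_right[symmetric] alg, simp only: distrib_right mult.assoc)
  also have "\<dots> = 2 * ball_moment n R a + 2 * (ennreal (c\<^sup>2) * ball_moment n R (basis_n i))"
    unfolding ball_moment_def by (simp add: nn_integral_add nn_integral_cmult)
  also have "\<dots> = 2 * (ball_moment n R a + ennreal (c\<^sup>2) * ball_moment n R (basis_n i))"
    by (simp add: distrib_left)
  finally show ?thesis by (simp only: ennreal_mult_cancel_left) auto
qed

lemma ball_moment_basis:
  assumes i: "i < n"
  shows "ball_moment n R (basis_n i) = ball_moment n R (basis_n 0)"
proof -
  let ?s = "Transposition.transpose i 0"
  have s: "?s k < n \<longleftrightarrow> k < n" for k using i by (auto simp: Transposition.transpose_def)
  have norm: "norm_n n (x \<circ> ?s) = norm_n n x" for x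
    unfolding norm_n_def inner_n_def
    by (rule arg_cong[where f = sqrt], rule sum.reindex_bij_witness[of _ ?s ?s]) (use s in auto)
  have inner: "inner_n n (x \<circ> ?s) (basis_n i) = inner_n n x (basis_n 0)" for x
  proof -
    have n: "0 < n" using i by simp
    show ?thesis by (simp add: inner_basis_n[OF i] inner_basis_n[OF n])
  qed
  have "ball_moment n R (basis_n i)
    = (\<integral>\<^sup>+x. ennreal ((inner_n n (x \<circ> ?s) (basis_n i))\<^sup>2) * indicator {z. norm_n n z \<le> R} (x \<circ> ?s) \<partial>lborel_n n)"
    unfolding ball_moment_def by (rule nn_integral_lborel_n_transpose[OF _ i order_le_less_trans[OF le0 i], symmetric]) measurable
  then show ?thesis by (simp add: inner norm ball_moment_def indicator_def)
qed

lemma ball_moment_eq: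
  assumes n: "n > 0"
  shows "ball_moment n R \<theta> = ennreal ((norm_n n \<theta>)\<^sup>2) * ball_moment n R (basis_n 0)"
proof -
  \<comment> \<open>\<open>\<theta>\<close> is built up one coordinate at a time from its
    truncations, each new entry contributing its square.\<close>
  have "ball_moment n R (\<lambda>j. if j < m then \<theta> j else 0) = ennreal (\<Sum>i<m. (\<theta> i)\<^sup>2) * ball_moment n R (basis_n 0)"
    if "m \<le> n" for m
    using that
  proof (induction m)
    case 0
    then show ?case by (simp add: ball_moment_def inner_n_def)
  next
    case (Suc m)
    have "(\<lambda>j. if j < Suc m then \<theta> j else 0) = (\<lambda>j. if j < m then \<theta> j else 0)(m := \<theta> m)"
      by (auto simp: less_Suc_eq)
    then have "ball_moment n R (\<lambda>j. if j < Suc m then \<theta> j else 0)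
       = ball_moment n R (\<lambda>j. if j < m then \<theta> j else 0) + ennreal ((\<theta> m)\<^sup>2) * ball_moment n R (basis_n m)"
      using ball_moment_add_basis[of m n "\<lambda>j. if j < m then \<theta> j else 0" R "\<theta> m"] Suc.prems by simp
    also have "\<dots> = (ennreal (\<Sum>i<m. (\<theta> i)\<^sup>2) + ennreal ((\<theta> m)\<^sup>2)) * ball_moment n R (basis_n 0)"
      using Suc ball_moment_basis[of m n R] by (simp add: distrib_right)
    finally show ?case by (simp add: sum_nonneg ennreal_plus[symmetric] del: ennreal_plus)
  qed
  from this[of n] have "ball_moment n R (\<lambda>j. if j < n then \<theta> j else 0) = ennreal ((norm_n n \<theta>)\<^sup>2) * ball_moment n R (basis_n 0)"
    by (simp add: norm_n_power2)
  moreover have "inner_n n b (\<lambda>j. if j < n then \<theta> j else 0) = inner_n n b \<theta>" for b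
    by (simp add: inner_n_def)
  ultimately show ?thesis by (simp add: ball_moment_def)
qed

text \<open>The \<open>n\<close> diagonal entries agree and add up to the integral of the squared
  norm, which is at most \<open>R\<^sup>2\<close> on the ball.\<close>

lemma ball_moment_le:
  assumes n: "n > 0"
  shows "ennreal (real n) * ball_moment n R (basis_n 0) \<le> ennreal (R\<^sup>2) * emeasure (lborel_n n) {z. norm_n n z \<le> R}"
proof -
  have "ennreal (real n) * ball_moment n R (basis_n 0) = (\<Sum>i<n. ball_moment n R (basis_n 0))"
    by (simp add: ennreal_of_nat_eq_real_of_nat)
  also have "\<dots> = (\<Sum>i<n. ball_moment n R (basis_n i))"
    by (intro sum.cong refl ball_moment_basis[symmetric]) simp
  also have "\<dots> = (\<integral>\<^sup>+b. (\<Sum>i<n. ennreal ((inner_n n b (basis_n i))\<^sup>2) * indicator {z. norm_n n z \<le> R} b) \<partial>lborel_n n)"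
    unfolding ball_moment_def by (rule nn_integral_sum[symmetric]) measurable
  also have "\<dots> = (\<integral>\<^sup>+b\<in>{z. norm_n n z \<le> R}. ennreal ((norm_n n b)\<^sup>2) \<partial>lborel_n n)"
    by (simp only: ennreal_norm_n_power2 sum_distrib_right)
  also have "\<dots> \<le> (\<integral>\<^sup>+b\<in>{z. norm_n n z \<le> R}. ennreal (R\<^sup>2) \<partial>lborel_n n)"
    by (intro nn_integral_mono) (auto simp: indicator_def intro!: ennreal_leI power_mono)
  also have "\<dots> = ennreal (R\<^sup>2) * emeasure (lborel_n n) {z. norm_n n z \<le> R}"
    by (rule nn_integral_cmult_indicator) simp
  finally show ?thesis .
qed

text \<open>A cube of half-side \<open>t / (n + 1)\<close> fits into the ball, as the Euclidean norm
  is at most the sum of the absolute values; the \<open>+ 1\<close> covers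
  \<open>n = 0\<close>.\<close>

lemma emeasure_norm_ball_pos:
  assumes t: "t > 0"
  shows "emeasure (lborel_n n) {z. norm_n n z \<le> t} > 0"
proof -
  let ?d = "t / (real n + 1)"
  have d: "?d > 0" using t by simp
  have "0 < ennreal (\<Prod>i<n. ?d - - ?d)" using d by (auto simp: ennreal_zero_less_mult_iff intro!: prod_pos)
  also have "\<dots> = emeasure (lborel_n n) {x \<in> Rn n. \<forall>i<n. - ?d \<le> x i \<and> x i \<le> ?d}"
    using d by (subst emeasure_lborel_n_box) auto
  also have "\<dots> \<le> emeasure (lborel_n n) {z. norm_n n z \<le> t}"
  proof (rule emeasure_mono)
    show "{x \<in> Rn n. \<forall>i<n. - ?d \<le> x i \<and> x i \<le> ?d} \<subseteq> {z. norm_n n z \<le> t}"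
    proof clarify
      fix x assume x: "\<forall>i<n. - ?d \<le> x i \<and> x i \<le> ?d"
      have "norm_n n x \<le> (\<Sum>i<n. \<bar>x i\<bar>)" unfolding norm_n_eq_L2_set by (rule L2_set_le_sum_abs)
      also have "\<dots> \<le> (\<Sum>i<n. ?d)" using x by (intro sum_mono) (auto simp: abs_le_iff minus_le_iff)
      also have "\<dots> = real n * ?d" by simp
      also have "\<dots> \<le> t" using t by (simp add: field_simps)
      finally show "norm_n n x \<le> t" .
    qed
  qed simp
  finally show ?thesis .
qed

text \<open>\<open>r\<^sup>2 = n L\<^sup>2\<close> is the integral of the squared norm over
  \<open>K\<close>, and \<open>R - r = 2 r\<close>, so \<open>K_core\<close> becomes Chebyshev's
  inequality with loss 1/4.\<close>

locale isotropic_smoothing = smoothed_body +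
  fixes L :: real
  assumes L_pos: "L > 0" and r_eq: "r = sqrt (real n) * L" and R_eq: "R = 3 * r"
    and K_isotropic: "\<And>\<theta>. norm_n n \<theta> = 1 \<Longrightarrow>
      (\<integral>\<^sup>+y\<in>K. ennreal ((inner_n n y \<theta>)\<^sup>2) \<partial>lborel_n n) = ennreal (L\<^sup>2)"
begin

definition \<beta> :: real where "\<beta> = measure (lborel_n n) B"

definition V :: real where "V = measure (lborel_n n) A"

text \<open>The second moment of \<open>A\<close> in every unit direction, as
  \<open>second_moment_A\<close> shows. \<open>K\<close> contributes
  \<open>\<beta> * L\<^sup>2\<close> and the ball the rest.\<close>

definition M :: real where "M = \<beta> * L\<^sup>2 + enn2real (ball_moment n R (basis_n 0))"

lemma emeasure_B: "emeasure (lborel_n n) B = ennreal \<beta>"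
  unfolding \<beta>_def using emeasure_norm_ball_finite[of n R] by (intro emeasure_eq_ennreal_measure) auto

lemma \<beta>_pos: "\<beta> > 0"
  using emeasure_norm_ball_pos[OF R_pos, of n] unfolding emeasure_B by simp

lemma emeasure_A: "emeasure (lborel_n n) A = ennreal V"
  unfolding V_def using A_finite by (intro emeasure_eq_ennreal_measure) auto

text \<open>Per unit volume the ball contributes at most \<open>R\<^sup>2 / n = 9 L\<^sup>2\<close>.
  With the \<open>L\<^sup>2\<close> of \<open>K\<close> this makes the 10 in
  \<open>M_bounds\<close>.\<close>

lemma ball_moment_real: "ball_moment n R (basis_n 0) = ennreal (M - \<beta> * L\<^sup>2)" "0 \<le> M - \<beta> * L\<^sup>2" "M - \<beta> * L\<^sup>2 \<le> 9 * L\<^sup>2 * \<beta>"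
proof -
  have le: "ennreal (real n) * ball_moment n R (basis_n 0) \<le> ennreal (R\<^sup>2 * \<beta>)"
    using ball_moment_le[OF n_pos, of R] \<beta>_pos unfolding emeasure_B by (simp add: ennreal_mult)
  then have fin: "ball_moment n R (basis_n 0) \<noteq> top"
    using n_pos by (auto simp: ennreal_mult_top top_unique)
  then show eq: "ball_moment n R (basis_n 0) = ennreal (M - \<beta> * L\<^sup>2)" by (simp add: M_def top.not_eq_extremum)
  show nn: "0 \<le> M - \<beta> * L\<^sup>2" by (simp add: M_def)
  have "ennreal (real n * (M - \<beta> * L\<^sup>2)) \<le> ennreal (R\<^sup>2 * \<beta>)"
    using le nn unfolding eq by (simp only: ennreal_mult[OF of_nat_0_le_iff nn])
  then have "real n * (M - \<beta> * L\<^sup>2) \<le> R\<^sup>2 * \<beta>" using \<beta>_pos by (simp add: ennreal_le_iff)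
  also have "R\<^sup>2 * \<beta> = real n * (9 * L\<^sup>2 * \<beta>)" by (simp add: R_eq r_eq power_mult_distrib)
  finally show "M - \<beta> * L\<^sup>2 \<le> 9 * L\<^sup>2 * \<beta>" using n_pos by simp
qed

lemma M_bounds: "M > 0" "M \<le> 10 * L\<^sup>2 * \<beta>"
proof -
  have "\<beta> * L\<^sup>2 > 0" using \<beta>_pos L_pos by simp
  then show "M > 0" using ball_moment_real(2) by linarith
  show "M \<le> 10 * L\<^sup>2 * \<beta>" using ball_moment_real(3) by (simp add: algebra_simps)
qed

lemma second_moment_A:
  assumes \<theta>: "norm_n n \<theta> = 1"
  shows "(\<integral>\<^sup>+x\<in>A. ennreal ((inner_n n x \<theta>)\<^sup>2) \<partial>lborel_n n) = ennreal M"
proof -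
  have "(\<integral>\<^sup>+x\<in>A. ennreal ((inner_n n x \<theta>)\<^sup>2) \<partial>lborel_n n)
      = (\<integral>\<^sup>+x. ennreal ((inner_n n x \<theta>)\<^sup>2) * ennreal (f x) \<partial>lborel_n n)"
  proof (rule nn_integral_f_eq_A[symmetric])
    have "inner_n n (\<lambda>i. c * x i) \<theta> = c * inner_n n x \<theta>" for c x
      by (simp add: inner_n_def sum_distrib_left mult.assoc)
    then show "ennreal ((inner_n n (\<lambda>i. c * x i) \<theta>)\<^sup>2) = ennreal (c\<^sup>2) * ennreal ((inner_n n x \<theta>)\<^sup>2)" for c x
      by (simp add: power_mult_distrib ennreal_mult)
  qed (measurable, simp add: inner_n_def)
  also have "\<dots> = ennreal (\<beta> * L\<^sup>2) + ennreal (M - \<beta> * L\<^sup>2)"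
    unfolding second_moment_f K_isotropic[OF \<theta>] emeasure_B ball_moment_def[symmetric] ball_moment_eq[OF n_pos, of R \<theta>] \<theta> ball_moment_real(1)
    using \<beta>_pos by (simp add: ennreal_mult)
  also have "\<dots> = ennreal M" using \<beta>_pos ball_moment_real(2) by (simp add: ennreal_plus[symmetric] del: ennreal_plus)
  finally show ?thesis .
qed

text \<open>The case \<open>q = 0\<close> of the low moment comparison, as the integral of
  \<open>f\<close> is \<open>|K| |B| = \<beta>\<close>.\<close>

lemma \<beta>_le_V: "\<beta> \<le> V"
proof -
  have "ennreal \<beta> = (\<integral>\<^sup>+y. indicator K y * ennreal \<beta> \<partial>lborel_n n)"
    using K_volume by (subst nn_integral_multc) auto
  also have "\<dots> = (\<integral>\<^sup>+x. 1 * ennreal (f x) \<partial>lborel_n n)"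
    by (subst nn_integral_f[of "\<lambda>_. 1"]) (simp_all add: emeasure_B)
  also have "\<dots> \<le> (\<integral>\<^sup>+x\<in>A. 1 \<partial>lborel_n n)"
    by (rule moment_comparison_low[where q = 0]) (use A_finite in auto)
  also have "\<dots> = ennreal V" by (simp add: emeasure_A)
  finally show ?thesis by (simp add: V_def ennreal_le_iff)
qed

lemma V_pos: "V > 0"
  using \<beta>_le_V \<beta>_pos by linarith

text \<open>Markov's inequality: outside \<open>B\<close> the norm exceeds \<open>R\<close>, hence
  \<open>r\<close>, and the squared norm integrates over \<open>A\<close> to \<open>n M\<close>, at
  most \<open>10 r\<^sup>2 \<beta>\<close>. The ball itself accounts for the eleventh
  \<open>\<beta>\<close>.\<close>

lemma V_le: "V \<le> 11 * \<beta>"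
proof -
  have "(\<integral>\<^sup>+x\<in>A. ennreal ((norm_n n x)\<^sup>2) \<partial>lborel_n n)
      = (\<Sum>i<n. \<integral>\<^sup>+x\<in>A. ennreal ((inner_n n x (basis_n i))\<^sup>2) \<partial>lborel_n n)"
    unfolding ennreal_norm_n_power2 sum_distrib_right by (rule nn_integral_sum) measurable
  also have "\<dots> = ennreal (real n * M)"
    using M_bounds by (simp add: second_moment_A norm_basis_n ennreal_of_nat_eq_real_of_nat ennreal_mult)
  finally have mom: "(\<integral>\<^sup>+x\<in>A. ennreal ((norm_n n x)\<^sup>2) \<partial>lborel_n n) = ennreal (real n * M)" .
  have "ennreal V = (\<integral>\<^sup>+x. indicator A x \<partial>lborel_n n)" by (simp add: emeasure_A)
  also have "\<dots> \<le> (\<integral>\<^sup>+x. indicator B x + ennreal (1 / r\<^sup>2) * (ennreal ((norm_n n x)\<^sup>2) * indicator A x) \<partial>lborel_n n)"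
  proof (rule nn_integral_mono)
    fix x
    show "indicator A x \<le> indicator B x + ennreal (1 / r\<^sup>2) * (ennreal ((norm_n n x)\<^sup>2) * indicator A x)"
    proof (cases "x \<in> A \<and> x \<notin> B")
      case True
      then have "r \<le> norm_n n x" using R_eq r_pos by auto
      then have "1 \<le> 1 / r\<^sup>2 * (norm_n n x)\<^sup>2" using r_pos by (simp add: power_mono)
      then have "ennreal 1 \<le> ennreal (1 / r\<^sup>2 * (norm_n n x)\<^sup>2)" by (rule ennreal_leI)
      then have "1 \<le> ennreal (1 / r\<^sup>2) * ennreal ((norm_n n x)\<^sup>2)"
        by (subst (asm) ennreal_mult) auto
      then show ?thesis using True by simp
    qed (auto simp: indicator_def)
  qed
  also have "\<dots> = ennreal \<beta> + ennreal (1 / r\<^sup>2) * ennreal (real n * M)"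
    unfolding mom[symmetric] emeasure_B[symmetric]
    by (subst nn_integral_add, simp, measurable, subst nn_integral_cmult) auto
  also have "\<dots> = ennreal (\<beta> + 1 / r\<^sup>2 * (real n * M))"
    using \<beta>_pos M_bounds r_pos by (simp add: ennreal_mult[symmetric] ennreal_plus[symmetric] del: ennreal_plus)
  finally have "V \<le> \<beta> + 1 / r\<^sup>2 * (real n * M)"
    using \<beta>_pos M_bounds r_pos by (subst (asm) ennreal_le_iff) auto
  also have "1 / r\<^sup>2 * (real n * M) = M / L\<^sup>2"
    using n_pos by (simp add: r_eq power_mult_distrib)
  also have "\<dots> \<le> 10 * \<beta>" using M_bounds L_pos by (simp add: field_simps)
  finally show ?thesis by simp
qed

end

section \<open>Volume-one balls and centroid bodies\<close>

lemma ball_n_eq: "ball_n n t = Rn n \<inter> {z. norm_n n z \<le> t}"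
  by (auto simp: ball_n_def)

lemma emeasure_ball_n: "emeasure (lborel_n n) (ball_n n t) = emeasure (lborel_n n) {z. norm_n n z \<le> t}"
proof (rule emeasure_eq_AE)
  show "AE x in lborel_n n. (x \<in> ball_n n t) = (x \<in> {z. norm_n n z \<le> t})"
    using AE_lborel_n_Rn[of n] by eventually_elim (simp add: ball_n_def)
  show "ball_n n t \<in> sets (lborel_n n)" unfolding ball_n_eq sets_lborel_n by (intro sets.Int Rn_in_borel norm_ball_borel)
  show "{z. norm_n n z \<le> t} \<in> sets (lborel_n n)" unfolding sets_lborel_n by (rule norm_ball_borel)
qed

lemma nn_integral_exp_abs_le: "(\<integral>\<^sup>+t. ennreal (exp (- 4 * \<bar>t\<bar>)) \<partial>lborel) \<le> ennreal (1 / 2)"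
proof -
  let ?h = "\<lambda>t::real. ennreal (exp (- 4 * t)) * indicator {0..} t"
  have half: "(\<integral>\<^sup>+t. ?h t \<partial>lborel) = ennreal (0 - (- (1 / 4) * exp (- 4 * 0)))"
  proof (rule nn_integral_FTC_atLeast)
    show "((\<lambda>t. - (1 / 4) * exp (- 4 * t)) has_real_derivative exp (- 4 * t)) (at t)" for t :: real
      by (auto intro!: derivative_eq_intros)
    have "((\<lambda>t::real. - (1 / 4) * exp (- 4 * t)) \<longlongrightarrow> - (1 / 4) * 0) at_top"
      by (intro tendsto_mult_left filterlim_compose[OF exp_at_bot] filterlim_tendsto_neg_mult_at_bot[OF tendsto_const] filterlim_ident) auto
    then show "((\<lambda>t::real. - (1 / 4) * exp (- 4 * t)) \<longlongrightarrow> 0) at_top" by simp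
  qed auto
  have refl: "(\<integral>\<^sup>+t. ?h (- t) \<partial>lborel) = (\<integral>\<^sup>+t. ?h t \<partial>lborel)"
    using nn_integral_real_affine[of ?h "-1" 0] by simp
  have "(\<integral>\<^sup>+t. ennreal (exp (- 4 * \<bar>t\<bar>)) \<partial>lborel) \<le> (\<integral>\<^sup>+t. ?h t + ?h (- t) \<partial>lborel)"
    by (intro nn_integral_mono) (auto simp: indicator_def abs_if)
  also have "\<dots> = (\<integral>\<^sup>+t. ?h t \<partial>lborel) + (\<integral>\<^sup>+t. ?h (- t) \<partial>lborel)"
    by (rule nn_integral_add) measurable
  also have "\<dots> = ennreal (1 / 2)"
    unfolding refl half by (simp add: ennreal_plus[symmetric] del: ennreal_plus)
  finally show ?thesis .
qed

lemma nn_integral_lborel_n_prod: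
  assumes [measurable]: "h \<in> borel_measurable borel"
  shows "(\<integral>\<^sup>+x. (\<Prod>i<n. h (x i)) \<partial>lborel_n n) = (\<integral>\<^sup>+t. h t \<partial>lborel) ^ n"
proof -
  interpret product_sigma_finite "\<lambda>_::nat. lborel :: real measure" ..
  have hm: "(\<lambda>x::nat \<Rightarrow> real. h (x i)) \<in> borel_measurable borel" for i
    by (rule measurable_compose[OF borel_measurable_coordinate assms])
  have "(\<integral>\<^sup>+x. (\<Prod>i<n. h (x i)) \<partial>lborel_n n) = (\<integral>\<^sup>+x. (\<Prod>i<n. h (zero_ext n x i)) \<partial>(\<Pi>\<^sub>M i\<in>{..<n}. lborel))"
    by (rule nn_integral_lborel_n) (intro borel_measurable_prod_ennreal hm)
  also have "\<dots> = (\<integral>\<^sup>+x. (\<Prod>i<n. h (x i)) \<partial>(\<Pi>\<^sub>M i\<in>{..<n}. lborel))"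
    by (intro nn_integral_cong prod.cong) (auto simp: zero_ext_def)
  also have "\<dots> = (\<Prod>i<n. \<integral>\<^sup>+t. h t \<partial>lborel)"
    by (rule product_nn_integral_prod) auto
  finally show ?thesis by simp
qed

text \<open>The ball is dominated by a product density. On it the absolute values of the coordinates
  sum to at most \<open>n / 8\<close> by Cauchy--Schwarz, so the product of the factors
  \<open>exp (1/2 - 4 |x_i|)\<close> is at least 1, while each factor integrates to
  \<open>exp (1/2) / 2\<close>, at most 1.\<close>

lemma emeasure_small_ball_le:
  assumes n: "n > 0"
  shows "emeasure (lborel_n n) {z. norm_n n z \<le> sqrt (real n) / 8} \<le> 1"
proof -
  let ?h = "\<lambda>t::real. ennreal (exp (1 / 2) * exp (- 4 * \<bar>t\<bar>))"
  have "emeasure (lborel_n n) {z. norm_n n z \<le> sqrt (real n) / 8}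
      = (\<integral>\<^sup>+x. indicator {z. norm_n n z \<le> sqrt (real n) / 8} x \<partial>lborel_n n)"
    by (rule nn_integral_indicator[symmetric]) (simp only: sets_lborel_n norm_ball_borel)
  also have "\<dots> \<le> (\<integral>\<^sup>+x. (\<Prod>i<n. ?h (x i)) \<partial>lborel_n n)"
  proof (rule nn_integral_mono)
    fix x :: "nat \<Rightarrow> real"
    show "indicator {z. norm_n n z \<le> sqrt (real n) / 8} x \<le> (\<Prod>i<n. ?h (x i))"
    proof (cases "norm_n n x \<le> sqrt (real n) / 8")
      case True
      have "(\<Sum>i<n. \<bar>x i\<bar>) \<le> L2_set x {..<n} * L2_set (\<lambda>_. 1) {..<n}"
        using L2_set_mult_ineq[of x "\<lambda>_. 1" "{..<n}"] by simp
      also have "\<dots> = norm_n n x * sqrt (real n)" by (simp add: norm_n_eq_L2_set L2_set_constant)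
      also have "\<dots> \<le> sqrt (real n) / 8 * sqrt (real n)" using True by (intro mult_right_mono) auto
      finally have "(\<Sum>i<n. \<bar>x i\<bar>) \<le> real n / 8" by simp
      moreover have "(\<Sum>i<n. 1 / 2 + - 4 * \<bar>x i\<bar>) = real n / 2 - 4 * (\<Sum>i<n. \<bar>x i\<bar>)"
        unfolding sum.distrib sum_distrib_left[symmetric] by simp
      ultimately have "0 \<le> (\<Sum>i<n. 1 / 2 + - 4 * \<bar>x i\<bar>)" by simp
      then have "1 \<le> exp (\<Sum>i<n. 1 / 2 + - 4 * \<bar>x i\<bar>)" by simp
      also have "\<dots> = (\<Prod>i<n. exp (1 / 2) * exp (- 4 * \<bar>x i\<bar>))"
        by (simp only: exp_sum[OF finite_lessThan] exp_add)
      finally have "ennreal 1 \<le> ennreal (\<Prod>i<n. exp (1 / 2) * exp (- 4 * \<bar>x i\<bar>))" by (rule ennreal_leI)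
      also have "\<dots> = (\<Prod>i<n. ?h (x i))" by (rule prod_ennreal[symmetric]) simp
      finally show ?thesis using True by simp
    qed simp
  qed
  also have "\<dots> = (\<integral>\<^sup>+t. ?h t \<partial>lborel) ^ n"
    by (rule nn_integral_lborel_n_prod) measurable
  also have "\<dots> \<le> 1 ^ n"
  proof (rule power_mono)
    have "(\<integral>\<^sup>+t. ?h t \<partial>lborel) = ennreal (exp (1 / 2)) * (\<integral>\<^sup>+t. ennreal (exp (- 4 * \<bar>t\<bar>)) \<partial>lborel)"
      by (simp only: ennreal_mult[OF exp_ge_zero exp_ge_zero], rule nn_integral_cmult) measurable
    also have "\<dots> \<le> ennreal 2 * ennreal (1 / 2)"
      by (intro mult_mono nn_integral_exp_abs_le ennreal_leI exp_half_le2) auto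
    also have "\<dots> = 1" by (simp only: ennreal_mult[symmetric]) simp
    finally show "(\<integral>\<^sup>+t. ?h t \<partial>lborel) \<le> 1" .
  qed simp
  finally show ?thesis by simp
qed

text \<open>The unit cube centred at the origin has volume 1 and lies in this ball.\<close>

lemma emeasure_big_ball_ge: "1 \<le> emeasure (lborel_n n) {z. norm_n n z \<le> sqrt (real n) / 2}"
proof -
  have "1 = ennreal (\<Prod>i<n. 1 / 2 - (- (1 / 2)))" by simp
  also have "\<dots> = emeasure (lborel_n n) {x \<in> Rn n. \<forall>i<n. - (1 / 2) \<le> x i \<and> x i \<le> 1 / 2}"
    by (rule emeasure_lborel_n_box[symmetric]) simp
  also have "\<dots> \<le> emeasure (lborel_n n) {z. norm_n n z \<le> sqrt (real n) / 2}"
  proof (rule emeasure_mono)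
    show "{x \<in> Rn n. \<forall>i<n. - (1 / 2) \<le> x i \<and> x i \<le> 1 / 2} \<subseteq> {z. norm_n n z \<le> sqrt (real n) / 2}"
    proof clarify
      fix x :: "nat \<Rightarrow> real" assume x: "\<forall>i<n. - (1 / 2) \<le> x i \<and> x i \<le> 1 / 2"
      have sq: "t\<^sup>2 \<le> 1 / 4" if "- (1 / 2) \<le> t" "t \<le> 1 / 2" for t :: real
      proof -
        have "\<bar>t\<bar> \<le> \<bar>1 / 2\<bar>" using that by (simp add: abs_le_iff)
        then have "t\<^sup>2 \<le> (1 / 2)\<^sup>2" by (simp only: abs_le_square_iff)
        then show ?thesis by (simp add: power2_eq_square)
      qed
      have "(norm_n n x)\<^sup>2 \<le> (\<Sum>i<n. 1 / 4)"
        unfolding norm_n_power2 using x sq by (intro sum_mono) auto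
      also have "\<dots> = (sqrt (real n) / 2)\<^sup>2" by (simp add: power_divide)
      finally show "norm_n n x \<le> sqrt (real n) / 2" by (rule power2_le_imp_le) simp
    qed
  qed (simp only: sets_lborel_n norm_ball_borel)
  finally show ?thesis .
qed

text \<open>The two bounds on the radius \<open>\<rho>\<close> of the volume-one ball differ by the
  factor 4 in every dimension, which is precise enough for absolute constants and takes the place of
  an exact volume formula.\<close>

lemma volume_one_ball:
  assumes n: "n > 0"
  obtains \<rho> where "volume_one_ball n = ball_n n \<rho>" "sqrt (real n) / 8 \<le> \<rho>" "\<rho> \<le> sqrt (real n) / 2"
    "\<And>t. t > 0 \<Longrightarrow> measure (lborel_n n) {z. norm_n n z \<le> t} = (t / \<rho>) ^ n"
proof -
  define b where "b = measure (lborel_n n) {z. norm_n n z \<le> 1}"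
  have b: "emeasure (lborel_n n) {z. norm_n n z \<le> 1} = ennreal b"
    unfolding b_def using emeasure_norm_ball_finite[of n 1] by (intro emeasure_eq_ennreal_measure) auto
  have bpos: "b > 0" using emeasure_norm_ball_pos[of 1 n] unfolding b by simp
  have vol: "emeasure (lborel_n n) {z. norm_n n z \<le> t} = ennreal (t ^ n * b)" if "t > 0" for t
    using emeasure_norm_ball_scale[OF that, of n] that bpos unfolding b by (simp add: ennreal_mult)
  define \<rho> where "\<rho> = root n (1 / b)"
  have \<rho>: "\<rho> > 0" "\<rho> ^ n = 1 / b"
    unfolding \<rho>_def using bpos n by (auto simp: real_root_pow_pos2)
  have one: "emeasure (lborel_n n) (ball_n n t) = 1 \<longleftrightarrow> t = \<rho>" if "t > 0" for t
  proof -
    have "emeasure (lborel_n n) (ball_n n t) = 1 \<longleftrightarrow> t ^ n * b = 1"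
      using that bpos by (simp add: emeasure_ball_n vol ennreal_eq_1)
    also have "\<dots> \<longleftrightarrow> t ^ n = \<rho> ^ n" unfolding \<rho>(2) using bpos by (simp add: field_simps)
    also have "\<dots> \<longleftrightarrow> t = \<rho>" using that \<rho> n power_eq_iff_eq_base[of n t \<rho>] by simp
    finally show ?thesis .
  qed
  have "(THE r. r > 0 \<and> emeasure (lborel_n n) (ball_n n r) = 1) = \<rho>"
    by (rule the_equality) (use one \<rho> in auto)
  then have "volume_one_ball n = ball_n n \<rho>" by (simp add: volume_one_ball_def)
  moreover have le: "t \<le> \<rho> \<longleftrightarrow> t ^ n * b \<le> 1" if "t > 0" for t
  proof -
    have "t ^ n * b \<le> 1 \<longleftrightarrow> t ^ n \<le> \<rho> ^ n" unfolding \<rho>(2) using bpos by (simp add: field_simps)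
    also have "\<dots> \<longleftrightarrow> t \<le> \<rho>" using that \<rho>(1) n by (intro power_mono_iff) auto
    finally show ?thesis ..
  qed
  have sn: "sqrt (real n) > 0" using n by simp
  have "sqrt (real n) / 8 \<le> \<rho>"
    using emeasure_small_ball_le[OF n] sn le[of "sqrt (real n) / 8"] vol[of "sqrt (real n) / 8"] by (simp add: ennreal_le_1)
  moreover have "\<rho> \<le> sqrt (real n) / 2"
  proof -
    have "1 \<le> (sqrt (real n) / 2) ^ n * b"
      using emeasure_big_ball_ge[of n] sn vol[of "sqrt (real n) / 2"] by (simp add: ennreal_ge_1)
    then have "\<rho> ^ n \<le> (sqrt (real n) / 2) ^ n" unfolding \<rho>(2) using bpos by (simp add: field_simps)
    then show ?thesis using \<rho> n sn by (subst (asm) power_mono_iff) auto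
  qed
  moreover have "measure (lborel_n n) {z. norm_n n z \<le> t} = (t / \<rho>) ^ n" if "t > 0" for t
    using vol[OF that] that bpos by (simp add: measure_def power_divide \<rho>(2))
  ultimately show thesis by (intro that) auto
qed

section \<open>Centroid bodies and their support functions\<close>

lemma set_lebesgue_integral_nonneg:
  assumes [measurable]: "g \<in> borel_measurable borel" "S \<in> sets borel" and "\<And>x. 0 \<le> g x"
  shows "(LINT x:S|lborel_n n. g x) = enn2real (\<integral>\<^sup>+x\<in>S. ennreal (g x) \<partial>lborel_n n)"
proof -
  have "(LINT x:S|lborel_n n. g x) = enn2real (\<integral>\<^sup>+x. ennreal (indicator S x *\<^sub>R g x) \<partial>lborel_n n)"
    unfolding set_lebesgue_integral_def by (rule integral_eq_nn_integral) (use assms(3) in \<open>auto simp: indicator_def\<close>)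
  also have "(\<integral>\<^sup>+x. ennreal (indicator S x *\<^sub>R g x) \<partial>lborel_n n) = (\<integral>\<^sup>+x\<in>S. ennreal (g x) \<partial>lborel_n n)"
    by (intro nn_integral_cong) (auto simp: indicator_def)
  finally show ?thesis .
qed

lemma nn_set_integral_bounded_finite:
  assumes "\<And>x. x \<in> S \<Longrightarrow> g x \<le> c" and S: "S \<in> sets borel" and fin: "emeasure (lborel_n n) S < \<infinity>"
  shows "(\<integral>\<^sup>+x\<in>S. ennreal (g x) \<partial>lborel_n n) < \<infinity>"
proof -
  have "(\<integral>\<^sup>+x\<in>S. ennreal (g x) \<partial>lborel_n n) \<le> (\<integral>\<^sup>+x\<in>S. ennreal c \<partial>lborel_n n)"
    using assms(1) by (intro nn_integral_mono) (auto simp: indicator_def intro: ennreal_leI)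
  also have "\<dots> = ennreal c * emeasure (lborel_n n) S" by (rule nn_integral_cmult_indicator) (simp only: sets_lborel_n S)
  also have "\<dots> < \<infinity>" using fin by (simp add: ennreal_mult_less_top)
  finally show ?thesis .
qed

lemma inner_n_scale_left: "inner_n n (\<lambda>i. c * x i) z = c * inner_n n x z"
  by (simp add: inner_n_def sum_distrib_left mult.assoc)

lemma inner_n_scale_right: "inner_n n z (\<lambda>i. c * x i) = c * inner_n n z x"
  by (simp add: inner_n_def sum_distrib_left mult.left_commute)

lemma Young_powr:
  fixes a b q :: real
  assumes "0 \<le> a" "0 \<le> b" and q: "1 \<le> q"
  shows "a powr (q - 1) * b \<le> (1 - 1 / q) * a powr q + 1 / q * b powr q"
proof (cases "a = 0 \<or> b = 0")
  case False
  then have "(a powr q) powr (1 - 1 / q) * (b powr q) powr (1 / q) \<le> (1 - 1 / q) * a powr q + 1 / q * b powr q"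
    using assms q by (intro Youngs_inequality_0) auto
  moreover have "q * (1 - 1 / q) = q - 1" using q by (simp add: right_diff_distrib)
  ultimately show ?thesis using False assms q by (simp add: powr_powr)
qed (use assms q in \<open>auto intro!: mult_nonneg_nonneg add_nonneg_nonneg\<close>)

text \<open>Instantiated with both \<open>K\<close> and \<open>C\<close>. The radius
  \<open>\<rho>\<close> and the finite measure keep all moments finite, so that \<open>h\<close> can
  be handled in the reals.\<close>

locale bounded_set =
  fixes n :: nat and K :: "(nat \<Rightarrow> real) set" and \<rho> :: real and q :: real
  assumes K_borel: "K \<in> sets borel" and K_fin: "emeasure (lborel_n n) K < \<infinity>"
    and K_norm: "\<And>x. x \<in> K \<Longrightarrow> norm_n n x \<le> \<rho>" and \<rho>_nonneg: "0 \<le> \<rho>" and q: "1 \<le> q"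
begin

definition moment :: "(nat \<Rightarrow> real) \<Rightarrow> ennreal" where
  "moment y = (\<integral>\<^sup>+x\<in>K. ennreal (\<bar>inner_n n x y\<bar> powr q) \<partial>lborel_n n)"

abbreviation h :: "(nat \<Rightarrow> real) \<Rightarrow> real" where
  "h \<equiv> Lq_moment n q K"

lemma abs_inner_le: "x \<in> K \<Longrightarrow> \<bar>inner_n n x y\<bar> \<le> \<rho> * norm_n n y"
  using inner_n_Cauchy_Schwarz[of n x y] K_norm[of x] by (meson mult_right_mono norm_n_nonneg order_trans)

lemma moment_finite: "moment y < \<infinity>"
  unfolding moment_def
proof (rule nn_set_integral_bounded_finite[OF _ K_borel K_fin])
  show "\<bar>inner_n n x y\<bar> powr q \<le> (\<rho> * norm_n n y) powr q" if "x \<in> K" for x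
    using abs_inner_le[OF that] q by (intro powr_mono2) auto
qed

lemma h_eq: "h y = enn2real (moment y) powr (1 / q)"
  unfolding Lq_moment_def moment_def by (subst set_lebesgue_integral_nonneg) (use K_borel in auto)

lemma h_nonneg: "0 \<le> h y"
  by (simp add: h_eq)

lemma h_powr: "h y powr q = enn2real (moment y)"
  using q by (simp add: h_eq powr_powr)

lemma moment_eq: "moment y = ennreal (h y powr q)"
  unfolding h_powr using moment_finite[of y] by (simp add: top.not_eq_extremum)

lemma h_measurable: "h \<in> borel_measurable borel"
proof -
  note K_borel[measurable]
  have "moment \<in> borel_measurable borel" unfolding moment_def by measurable
  then show ?thesis unfolding h_eq[abs_def] by measurable
qed

lemma h_scale:
  assumes c: "0 \<le> c"
  shows "h (\<lambda>i. c * y i) = c * h y"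
proof -
  note K_borel[measurable]
  have "moment (\<lambda>i. c * y i) = (\<integral>\<^sup>+x. ennreal (c powr q) * (ennreal (\<bar>inner_n n x y\<bar> powr q) * indicator K x) \<partial>lborel_n n)"
    unfolding moment_def using c
    by (intro nn_integral_cong) (simp add: inner_n_scale_right abs_mult powr_mult ennreal_mult mult.assoc)
  also have "\<dots> = ennreal (c powr q) * moment y"
    unfolding moment_def by (rule nn_integral_cmult) measurable
  finally show ?thesis using c q by (simp add: h_eq enn2real_mult powr_mult powr_powr)
qed

text \<open>Young's inequality for the two factors, normalised by \<open>h y\<close> and
  \<open>G\<close>, and integrated. A free \<open>G\<close> above \<open>h z\<close> is allowed
  because \<open>h z\<close> itself may vanish and could not be divided by.\<close>

lemma nn_integral_Hoelder:
  assumes H: "h y > 0" and G: "G > 0" "h z \<le> G"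
  shows "(\<integral>\<^sup>+x. ennreal (\<bar>inner_n n x y\<bar> powr (q - 1) * \<bar>inner_n n x z\<bar>) * indicator K x \<partial>lborel_n n)
    \<le> ennreal (h y powr (q - 1) * G)"
proof -
  note K_borel[measurable]
  define H where "H = h y"
  have Hpos: "H > 0" using assms by (simp add: H_def)
  define c where "c = H powr (q - 1) * G"
  have c: "c \<ge> 0" using G by (simp add: c_def)
  define a b where "a = c * (1 - 1 / q) / H powr q" and "b = c * (1 / q) / G powr q"
  have ab: "a \<ge> 0" "b \<ge> 0" using c q by (auto simp: a_def b_def)
  have pt: "\<bar>u\<bar> powr (q - 1) * \<bar>v\<bar> \<le> a * \<bar>u\<bar> powr q + b * \<bar>v\<bar> powr q" for u v :: real
  proof -
    have "(\<bar>u\<bar> / H) powr (q - 1) * (\<bar>v\<bar> / G) \<le> (1 - 1 / q) * (\<bar>u\<bar> / H) powr q + 1 / q * (\<bar>v\<bar> / G) powr q"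
      by (rule Young_powr) (use Hpos G q in auto)
    then have "c * ((\<bar>u\<bar> / H) powr (q - 1) * (\<bar>v\<bar> / G)) \<le> c * ((1 - 1 / q) * (\<bar>u\<bar> / H) powr q + 1 / q * (\<bar>v\<bar> / G) powr q)"
      using c by (rule mult_left_mono)
    moreover have "c * ((\<bar>u\<bar> / H) powr (q - 1) * (\<bar>v\<bar> / G)) = \<bar>u\<bar> powr (q - 1) * \<bar>v\<bar>"
      using Hpos G by (simp add: c_def powr_divide)
    moreover have "c * ((1 - 1 / q) * (\<bar>u\<bar> / H) powr q + 1 / q * (\<bar>v\<bar> / G) powr q) = a * \<bar>u\<bar> powr q + b * \<bar>v\<bar> powr q"
      using Hpos G by (simp add: a_def b_def powr_divide distrib_left mult_ac)
    ultimately show ?thesis by simp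
  qed
  have "(\<integral>\<^sup>+x. ennreal (\<bar>inner_n n x y\<bar> powr (q - 1) * \<bar>inner_n n x z\<bar>) * indicator K x \<partial>lborel_n n)
     \<le> (\<integral>\<^sup>+x. ennreal a * (ennreal (\<bar>inner_n n x y\<bar> powr q) * indicator K x)
          + ennreal b * (ennreal (\<bar>inner_n n x z\<bar> powr q) * indicator K x) \<partial>lborel_n n)"
  proof (rule nn_integral_mono)
    fix x
    have "ennreal (\<bar>inner_n n x y\<bar> powr (q - 1) * \<bar>inner_n n x z\<bar>)
       \<le> ennreal (a * \<bar>inner_n n x y\<bar> powr q + b * \<bar>inner_n n x z\<bar> powr q)"
      by (rule ennreal_leI[OF pt])
    also have "\<dots> = ennreal a * ennreal (\<bar>inner_n n x y\<bar> powr q) + ennreal b * ennreal (\<bar>inner_n n x z\<bar> powr q)"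
      using ab by (simp add: ennreal_mult)
    finally show "ennreal (\<bar>inner_n n x y\<bar> powr (q - 1) * \<bar>inner_n n x z\<bar>) * indicator K x
       \<le> ennreal a * (ennreal (\<bar>inner_n n x y\<bar> powr q) * indicator K x)
          + ennreal b * (ennreal (\<bar>inner_n n x z\<bar> powr q) * indicator K x)"
      by (cases "x \<in> K") simp_all
  qed
  also have "\<dots> = ennreal a * moment y + ennreal b * moment z"
    unfolding moment_def by (simp add: nn_integral_add nn_integral_cmult)
  also have "\<dots> = ennreal (a * H powr q + b * h z powr q)"
    unfolding moment_eq H_def[symmetric] using ab by (simp add: ennreal_mult)
  also have "\<dots> \<le> ennreal c"
  proof (rule ennreal_leI)
    have "b * h z powr q \<le> b * G powr q"
      using ab(2) G h_nonneg q by (intro mult_left_mono powr_mono2) auto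
    also have "b * G powr q = c * (1 / q)" using G by (simp add: b_def)
    finally have "b * h z powr q \<le> c * (1 / q)" .
    moreover have "a * H powr q = c * (1 - 1 / q)" using Hpos by (simp add: a_def)
    ultimately show "a * H powr q + b * h z powr q \<le> c" by (simp add: right_diff_distrib)
  qed
  finally show ?thesis by (simp add: c_def H_def)
qed

(* The subgradient of the L^q norm at y is the vector with entries
   h(y)^(1-q) int_K sgn<x,y> |<x,y>|^(q-1) x_i dx. *)
lemma exists_supporting_point:
  "\<exists>d\<in>Lq_centroid_body n q K. inner_n n d y = h y"
proof (cases "h y = 0")
  case True
  then show ?thesis
    by (intro bexI[of _ "\<lambda>_. 0"]) (auto simp: Lq_centroid_body_def inner_n_def h_nonneg)
next
  case False
  then have H: "h y > 0" using h_nonneg[of y] by linarith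
  note K_borel[measurable]
  define w where "w x = sgn (inner_n n x y) * \<bar>inner_n n x y\<bar> powr (q - 1)" for x
  have w [measurable]: "w \<in> borel_measurable borel" unfolding w_def by measurable
  have wb: "\<bar>w x\<bar> \<le> (\<rho> * norm_n n y) powr (q - 1)" if "x \<in> K" for x
  proof -
    have "\<bar>inner_n n x y\<bar> powr (q - 1) \<le> (\<rho> * norm_n n y) powr (q - 1)"
      using abs_inner_le[OF that] q by (intro powr_mono2) auto
    then show ?thesis by (auto simp: w_def abs_mult sgn_if)
  qed
  have wabs: "\<bar>w x * t\<bar> \<le> \<bar>inner_n n x y\<bar> powr (q - 1) * \<bar>t\<bar>" for x t
    by (auto simp: w_def abs_mult sgn_if)
  define d where "d i = (if i < n then (LINT x:K|lborel_n n. w x * x i) / h y powr (q - 1) else 0)" for i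
  have int: "set_integrable (lborel_n n) K (\<lambda>x. w x * x i)" if "i < n" for i
    unfolding set_integrable_def
  proof (rule integrableI_bounded_set_indicator)
    show "AE x in lborel_n n. x \<in> K \<longrightarrow> norm (w x * x i) \<le> (\<rho> * norm_n n y) powr (q - 1) * \<rho>"
    proof (intro AE_I2 impI)
      fix x assume x: "x \<in> K"
      have "\<bar>x i\<bar> \<le> \<rho>" using norm_n_coordinate[OF that, of x] K_norm[OF x] by linarith
      then show "norm (w x * x i) \<le> (\<rho> * norm_n n y) powr (q - 1) * \<rho>"
        using wb[OF x] by (auto simp: abs_mult intro!: mult_mono)
    qed
  qed (use K_fin in \<open>simp_all, measurable\<close>)
  have inner: "inner_n n d z = (LINT x:K|lborel_n n. w x * inner_n n x z) / h y powr (q - 1)" for z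
  proof -
    have "(LINT x:K|lborel_n n. w x * inner_n n x z) = (LINT x:K|lborel_n n. (\<Sum>i<n. z i * (w x * x i)))"
      by (simp add: inner_n_def sum_distrib_left mult_ac)
    also have "\<dots> = (LINT x|lborel_n n. (\<Sum>i<n. z i * (indicator K x *\<^sub>R (w x * x i))))"
      unfolding set_lebesgue_integral_def
      by (intro Bochner_Integration.integral_cong) (simp_all add: sum_distrib_left mult_ac)
    also have "\<dots> = (\<Sum>i<n. LINT x|lborel_n n. z i * (indicator K x *\<^sub>R (w x * x i)))"
      by (rule Bochner_Integration.integral_sum) (use int in \<open>auto simp: set_integrable_def\<close>)
    also have "\<dots> = (\<Sum>i<n. z i * (LINT x:K|lborel_n n. w x * x i))"
      unfolding set_lebesgue_integral_def by simp
    finally show ?thesis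
      by (simp add: inner_n_def d_def sum_divide_distrib mult.commute)
  qed
  have "inner_n n d z \<le> h z" for z
  proof (rule field_le_epsilon)
    fix e :: real assume e: "e > 0"
    have wm: "(\<lambda>x. \<bar>w x * inner_n n x z\<bar>) \<in> borel_measurable borel"
      by (intro borel_measurable_abs borel_measurable_times w inner_n_measurable) simp_all
    \<comment> \<open>\<open>h z\<close> can be 0; adding \<open>e\<close> gives a positive
      normalisation for Hoelder's inequality.\<close>
    define G where "G = h z + e"
    have G: "G > 0" "h z \<le> G" using e h_nonneg[of z] by (auto simp: G_def)
    have "set_integrable (lborel_n n) K (\<lambda>x. w x * inner_n n x z)"
      unfolding set_integrable_def
    proof (rule integrableI_bounded_set_indicator)
      show "AE x in lborel_n n. x \<in> K \<longrightarrow> norm (w x * inner_n n x z) \<le> (\<rho> * norm_n n y) powr (q - 1) * (\<rho> * norm_n n z)"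
        using wb abs_inner_le by (auto simp: abs_mult intro!: mult_mono)
    qed (use K_fin in \<open>simp_all, measurable\<close>)
    moreover have "set_integrable (lborel_n n) K (\<lambda>x. \<bar>w x * inner_n n x z\<bar>)"
      using set_integrable_abs[OF calculation] .
    ultimately have "(LINT x:K|lborel_n n. w x * inner_n n x z) \<le> (LINT x:K|lborel_n n. \<bar>w x * inner_n n x z\<bar>)"
      by (rule set_integral_mono) auto
    also have "\<dots> = enn2real (\<integral>\<^sup>+x\<in>K. ennreal \<bar>w x * inner_n n x z\<bar> \<partial>lborel_n n)"
      by (rule set_lebesgue_integral_nonneg[OF wm K_borel]) simp
    also have "\<dots> \<le> h y powr (q - 1) * G"
    proof (rule enn2real_leI)
      have "(\<integral>\<^sup>+x\<in>K. ennreal \<bar>w x * inner_n n x z\<bar> \<partial>lborel_n n)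
         \<le> (\<integral>\<^sup>+x. ennreal (\<bar>inner_n n x y\<bar> powr (q - 1) * \<bar>inner_n n x z\<bar>) * indicator K x \<partial>lborel_n n)"
        by (intro nn_integral_mono mult_right_mono ennreal_leI wabs) auto
      also have "\<dots> \<le> ennreal (h y powr (q - 1) * G)" by (rule nn_integral_Hoelder[OF H G])
      finally show "(\<integral>\<^sup>+x\<in>K. ennreal \<bar>w x * inner_n n x z\<bar> \<partial>lborel_n n) \<le> ennreal (h y powr (q - 1) * G)" .
    qed (use G in simp)
    finally show "inner_n n d z \<le> h z + e"
      unfolding inner G_def using H by (simp add: divide_le_eq mult.commute)
  qed
  then have "d \<in> Lq_centroid_body n q K"
    by (simp add: Lq_centroid_body_def d_def topspace_Euclidean_space)
  moreover have "inner_n n d y = h y"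
  proof -
    have "w x * inner_n n x y = \<bar>inner_n n x y\<bar> powr q" for x
    proof (cases "inner_n n x y = 0")
      case False
      then have "w x * inner_n n x y = \<bar>inner_n n x y\<bar> powr (q - 1) * \<bar>inner_n n x y\<bar> powr 1"
        by (simp add: w_def sgn_if abs_if)
      also have "\<dots> = \<bar>inner_n n x y\<bar> powr q" by (simp only: powr_add[symmetric]) simp
      finally show ?thesis .
    qed simp
    then have "(LINT x:K|lborel_n n. w x * inner_n n x y) = (LINT x:K|lborel_n n. \<bar>inner_n n x y\<bar> powr q)" by simp
    also have "\<dots> = h y powr q"
      unfolding h_powr moment_def by (rule set_lebesgue_integral_nonneg) (use K_borel in auto)
    finally have "inner_n n d y = h y powr q / h y powr (q - 1)" by (simp only: inner)
    then show ?thesis using H by (simp add: powr_diff[symmetric])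
  qed
  ultimately show ?thesis by blast
qed

lemma inner_Lq_centroid_body_le: "d \<in> Lq_centroid_body n q K \<Longrightarrow> y \<in> Rn n \<Longrightarrow> inner_n n d y \<le> h y"
  by (simp add: Lq_centroid_body_def)

text \<open>An intersection of half-spaces could have a support function smaller than the prescribed
  one; the supporting point shows that \<open>h y\<close> is attained.\<close>

lemma support_function_eq:
  assumes y: "y \<in> Rn n"
  shows "support_function n (Lq_centroid_body n q K) y = h y"
  unfolding support_function_def
proof (rule cSup_eq_maximum)
  show "h y \<in> (\<lambda>x. inner_n n x y) ` Lq_centroid_body n q K"
    using exists_supporting_point[of y] by (metis imageI)
qed (use inner_Lq_centroid_body_le y in auto)

text \<open>Minkowski's inequality by duality: the functional that supports \<open>h\<close> at the
  sum is linear and bounded by \<open>h\<close> at both summands.\<close>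

lemma h_triangle:
  assumes "x \<in> Rn n" "y \<in> Rn n"
  shows "h (\<lambda>i. x i + y i) \<le> h x + h y"
proof -
  obtain d where d: "d \<in> Lq_centroid_body n q K" "inner_n n d (\<lambda>i. x i + y i) = h (\<lambda>i. x i + y i)"
    using exists_supporting_point by blast
  have "inner_n n d (\<lambda>i. x i + y i) = inner_n n d x + inner_n n d y"
    by (simp add: inner_n_def distrib_left sum.distrib)
  then show ?thesis using inner_Lq_centroid_body_le[OF d(1)] assms d(2) by (metis add_mono)
qed

lemma h_bound:
  assumes "norm_n n y \<le> t"
  shows "h y \<le> ((\<rho> * t) powr q * measure (lborel_n n) K) powr (1 / q)"
proof -
  have "moment y \<le> (\<integral>\<^sup>+x\<in>K. ennreal ((\<rho> * t) powr q) \<partial>lborel_n n)"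
    unfolding moment_def
  proof (rule nn_integral_mono)
    fix x
    have "\<bar>inner_n n x y\<bar> \<le> \<rho> * t" if "x \<in> K"
      using abs_inner_le[OF that, of y] mult_left_mono[OF assms \<rho>_nonneg] by linarith
    then show "ennreal (\<bar>inner_n n x y\<bar> powr q) * indicator K x \<le> ennreal ((\<rho> * t) powr q) * indicator K x"
      using q by (cases "x \<in> K") (auto intro!: ennreal_leI powr_mono2)
  qed
  also have "\<dots> = ennreal ((\<rho> * t) powr q) * emeasure (lborel_n n) K"
    by (rule nn_integral_cmult_indicator) (simp only: sets_lborel_n K_borel)
  also have "\<dots> = ennreal ((\<rho> * t) powr q * measure (lborel_n n) K)"
    using K_fin by (simp add: ennreal_mult emeasure_eq_ennreal_measure)
  finally have "enn2real (moment y) \<le> (\<rho> * t) powr q * measure (lborel_n n) K"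
    by (intro enn2real_leI) auto
  then show ?thesis unfolding h_eq using q by (intro powr_mono2) auto
qed

lemma I1_polar_Z_eq:
  assumes K: "K \<subseteq> Rn n"
  shows "I1_polar_Z n q K = enn2real (\<integral>\<^sup>+x\<in>K. ennreal (h x) \<partial>lborel_n n)"
proof -
  have "I1_polar_Z n q K = (LINT x:K|lborel_n n. h x)"
    unfolding I1_polar_Z_def set_lebesgue_integral_def
    using K support_function_eq by (intro Bochner_Integration.integral_cong) (auto simp: indicator_def)
  also have "\<dots> = enn2real (\<integral>\<^sup>+x\<in>K. ennreal (h x) \<partial>lborel_n n)"
    by (rule set_lebesgue_integral_nonneg[OF h_measurable K_borel h_nonneg])
  finally show ?thesis .
qed

lemma nn_integral_h_finite:
  assumes S: "S \<in> sets borel" "emeasure (lborel_n n) S < \<infinity>" "\<And>x. x \<in> S \<Longrightarrow> norm_n n x \<le> t"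
  shows "(\<integral>\<^sup>+x\<in>S. ennreal (h x) \<partial>lborel_n n) < \<infinity>"
  by (rule nn_set_integral_bounded_finite[OF h_bound S(1,2)]) (rule S(3))

end

section \<open>The isotropic body\<close>

lemma continuous_on_norm_n_diff: "continuous_on S (\<lambda>x. norm_n n (\<lambda>i. x i - a i))"
  unfolding norm_n_def inner_n_def
  by (intro continuous_intros continuous_on_subset[OF continuous_on_product_coordinates] subset_UNIV)

lemma compactin_Euclidean_space_iff: "compactin (Euclidean_space n) S \<longleftrightarrow> compact S \<and> S \<subseteq> Rn n"
  unfolding Euclidean_space_def compactin_subtopology
  by (simp add: euclidean_product_topology topspace_Euclidean_space[symmetric])

lemma compact_box_n: "compact {x :: nat \<Rightarrow> real. \<forall>i. x i \<in> (if i < n then {-t..t} else {0})}"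
proof -
  have "compactin (product_topology (\<lambda>i. euclidean) UNIV) (PiE UNIV (\<lambda>i. if i < n then {-t..t} else {0 :: real}))"
    unfolding compactin_PiE by auto
  moreover have "PiE UNIV (\<lambda>i. if i < n then {-t..t} else {0 :: real})
      = {x :: nat \<Rightarrow> real. \<forall>i. x i \<in> (if i < n then {-t..t} else {0})}"
    by (auto simp: PiE_def Pi_def)
  ultimately show ?thesis by (simp add: euclidean_product_topology)
qed

lemma lborel_n_reflect: "distr (lborel_n n) borel (\<lambda>x i. - x i) = lborel_n n"
proof (rule measure_eqI)
  have m: "(\<lambda>x i. - x i) \<in> lborel_n n \<rightarrow>\<^sub>M (borel :: (nat \<Rightarrow> real) measure)"
    by measurable
  fix X assume "X \<in> sets (distr (lborel_n n) borel (\<lambda>x i. - x i))"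
  then have X: "X \<in> sets borel" by simp
  have "emeasure (distr (lborel_n n) borel (\<lambda>x i. - x i)) X = (\<integral>\<^sup>+x. indicator X x \<partial>distr (lborel_n n) borel (\<lambda>x i. - x i))"
    using X by (intro nn_integral_indicator[symmetric]) simp
  also have "\<dots> = (\<integral>\<^sup>+x. indicator X (\<lambda>i. - x i) \<partial>lborel_n n)"
    by (rule nn_integral_distr[OF m]) (use X in simp)
  also have "\<dots> = (\<integral>\<^sup>+x. indicator X x \<partial>lborel_n n)"
    by (rule nn_integral_lborel_n_reflect) (use X in simp)
  also have "\<dots> = emeasure (lborel_n n) X"
    using X by (intro nn_integral_indicator) simp
  finally show "emeasure (distr (lborel_n n) borel (\<lambda>x i. - x i)) X = emeasure (lborel_n n) X" .
qed simp

text \<open>Reflection preserves the measure and \<open>S\<close> but changes the sign of the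
  coordinate, so the integral is its own negative.\<close>

lemma set_integral_coordinate_symmetric:
  assumes S: "S \<in> sets borel" and sym: "\<And>x. (\<lambda>i. - x i) \<in> S \<longleftrightarrow> x \<in> S"
  shows "(LINT x:S|lborel_n n. x j) = 0"
proof -
  let ?g = "\<lambda>x :: nat \<Rightarrow> real. indicat_real S x *\<^sub>R x j"
  note S[measurable]
  have "integral\<^sup>L (lborel_n n) ?g = integral\<^sup>L (distr (lborel_n n) borel (\<lambda>x i. - x i)) ?g"
    by (simp only: lborel_n_reflect)
  also have "\<dots> = (LINT x|lborel_n n. ?g (\<lambda>i. - x i))"
    by (rule integral_distr) measurable
  also have "\<dots> = (LINT x|lborel_n n. - ?g x)"
    by (intro Bochner_Integration.integral_cong) (auto simp: sym indicator_def)
  also have "\<dots> = - integral\<^sup>L (lborel_n n) ?g" by simp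
  finally show ?thesis unfolding set_lebesgue_integral_def by simp
qed

lemma has_isotropic_constant_unique:
  assumes n: "n > 0" and L: "has_isotropic_constant n S L"
  shows "isotropic_constant n S = L"
  unfolding isotropic_constant_def
proof (rule the_equality[where P = "has_isotropic_constant n S", OF L])
  fix L' assume L': "has_isotropic_constant n S L'"
  have "basis_n 0 \<in> unit_sphere_n n"
    using n norm_basis_n[OF n] by (auto simp: unit_sphere_n_def basis_n_def topspace_Euclidean_space)
  then have "L'\<^sup>2 = L\<^sup>2" using L L' unfolding has_isotropic_constant_def by metis
  then show "L' = L" using L L' by (simp add: has_isotropic_constant_def power2_eq_iff_nonneg)
qed

lemma ennreal_real_le: "ennreal c * ennreal x \<le> ennreal y \<Longrightarrow> 0 \<le> c \<Longrightarrow> 0 \<le> x \<Longrightarrow> 0 \<le> y \<Longrightarrow> c * x \<le> y"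
  by (simp add: ennreal_mult[symmetric])

lemma ennreal_mult_mult: "0 \<le> a \<Longrightarrow> 0 \<le> b \<Longrightarrow> ennreal (a * b) * x = ennreal a * (ennreal b * x)"
  by (simp add: ennreal_mult mult.assoc)

lemma ennreal_double_le: "0 \<le> a \<Longrightarrow> 0 \<le> b \<Longrightarrow> 0 \<le> c \<Longrightarrow> 2 * a \<le> b + c \<Longrightarrow> 2 * ennreal a \<le> ennreal b + ennreal c"
  using ennreal_leI[of "2 * a" "b + c"] by (simp add: ennreal_mult)

lemma inner_n_power2_measurable: "(\<lambda>x. (inner_n n x \<theta>)\<^sup>2) \<in> borel_measurable borel"
  by measurable

text \<open>The triangle inequality bounds \<open>|v|\<close> by the mean of \<open>|u + v|\<close>
  and \<open>|-u + v|\<close>, and \<open>powr q\<close> is monotone and convex. A vanishing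
  argument is treated separately, by \<open>2 \<le> 2 powr q\<close>.\<close>

lemma powr_midpoint_convex:
  fixes u v q :: real
  assumes q: "1 \<le> q"
  shows "2 * \<bar>v\<bar> powr q \<le> \<bar>u + v\<bar> powr q + \<bar>- u + v\<bar> powr q"
proof -
  let ?a = "\<bar>u + v\<bar>" and ?b = "\<bar>- u + v\<bar>"
  have mid: "((a + b) / 2) powr q \<le> (a powr q + b powr q) / 2" if "0 \<le> a" "0 \<le> b" for a b :: real
  proof (cases "a = 0 \<or> b = 0")
    case True
    have half: "(c / 2) powr q \<le> c powr q / 2" if "0 \<le> c" for c :: real
    proof -
      have "(2::real) powr 1 \<le> 2 powr q" by (rule powr_mono) (use q in auto)
      then have "c powr q / 2 powr q \<le> c powr q / 2" by (intro divide_left_mono) auto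
      then show ?thesis using that by (simp add: powr_divide)
    qed
    show ?thesis using True half[of a] half[of b] that by auto
  next
    case False
    then have "((1 - 1 / 2) *\<^sub>R a + (1 / 2) *\<^sub>R b) powr q \<le> (1 - 1 / 2) * a powr q + 1 / 2 * b powr q"
      using that by (intro convex_onD[OF powr_convex[OF q]]) auto
    then show ?thesis by (simp add: add_divide_distrib)
  qed
  have "\<bar>v\<bar> powr q \<le> ((?a + ?b) / 2) powr q"
    using q by (intro powr_mono2) auto
  then show ?thesis using mid[of ?a ?b] by simp
qed

section \<open>The body \<open>C\<close> of volume one\<close>

context isotropic_smoothing begin

definition \<tau> :: real where "\<tau> = 1 / root n V"

text \<open>The dilate of \<open>A\<close> by \<open>\<tau>\<close>, written as a sublevel set of
  \<open>N\<close>: convexity, symmetry and compactness can then be read off from the properties of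
  \<open>N\<close> as a norm.\<close>

definition C :: "(nat \<Rightarrow> real) set" where "C = {x \<in> Rn n. N x \<le> \<tau>}"

lemma \<tau>_pos: "\<tau> > 0"
  using V_pos n_pos by (simp add: \<tau>_def)

lemma \<tau>_power: "\<tau> ^ n = 1 / V"
  unfolding \<tau>_def power_one_over using V_pos n_pos by (simp add: real_root_pow_pos2)

lemma N_scale_nonneg: "0 \<le> c \<Longrightarrow> N (\<lambda>i. c * x i) = c * N x"
  using N_scale[of c x] by (cases "c = 0") auto

lemma scale_mem_C: "(\<lambda>i. \<tau> * x i) \<in> C \<longleftrightarrow> x \<in> A"
proof -
  have "(\<lambda>i. \<tau> * x i) \<in> Rn n \<longleftrightarrow> x \<in> Rn n" using \<tau>_pos by (simp add: topspace_Euclidean_space)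
  then show ?thesis using \<tau>_pos by (simp add: C_def A_def N_scale)
qed

lemma C_Rn: "C \<subseteq> Rn n"
  by (auto simp: C_def)

lemma C_borel: "C \<in> sets borel"
proof -
  have "C = Rn n \<inter> {x \<in> space borel. N x \<le> \<tau>}" by (auto simp: C_def)
  also have "\<dots> \<in> sets borel" by (intro sets.Int Rn_in_borel) measurable
  finally show ?thesis .
qed

lemma nn_integral_C:
  assumes [measurable]: "g \<in> borel_measurable borel"
  shows "(\<integral>\<^sup>+x\<in>C. g x \<partial>lborel_n n) = ennreal (1 / V) * (\<integral>\<^sup>+x\<in>A. g (\<lambda>i. \<tau> * x i) \<partial>lborel_n n)"
proof -
  note C_borel[measurable]
  have "(\<integral>\<^sup>+x\<in>C. g x \<partial>lborel_n n)
      = ennreal (\<tau> ^ n) * (\<integral>\<^sup>+x. g (\<lambda>i. \<tau> * x i) * indicator C (\<lambda>i. \<tau> * x i) \<partial>lborel_n n)"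
    by (rule nn_integral_lborel_n_scale[OF _ \<tau>_pos]) measurable
  then show ?thesis by (simp add: \<tau>_power scale_mem_C indicator_def)
qed

lemma emeasure_C: "emeasure (lborel_n n) C = 1"
proof -
  have "emeasure (lborel_n n) C = (\<integral>\<^sup>+x\<in>C. 1 \<partial>lborel_n n)"
    using C_borel by (simp only: mult_1 nn_integral_indicator sets_lborel_n)
  also have "\<dots> = ennreal (1 / V) * (\<integral>\<^sup>+x\<in>A. 1 \<partial>lborel_n n)"
    by (rule nn_integral_C) simp
  also have "\<dots> = 1"
    using V_pos by (simp only: mult_1 nn_integral_indicator sets_lborel_n A_borel emeasure_A ennreal_mult[symmetric]) (simp add: ennreal_mult[symmetric])
  finally show ?thesis .
qed

lemma C_norm: "x \<in> C \<Longrightarrow> norm_n n x \<le> T * \<tau>"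
  using norm_le_T_N[of x] T_pos by (auto simp: C_def intro: order_trans mult_left_mono)

lemma C_ball: "x \<in> Rn n \<Longrightarrow> norm_n n x \<le> 3 * r / 4 * \<tau> \<Longrightarrow> x \<in> C"
proof -
  assume x: "x \<in> Rn n" "norm_n n x \<le> 3 * r / 4 * \<tau>"
  have "N x \<le> 4 / (3 * r) * norm_n n x" by (rule N_le_norm[OF x(1)])
  also have "\<dots> \<le> 4 / (3 * r) * (3 * r / 4 * \<tau>)" using x(2) r_pos by (intro mult_left_mono) auto
  also have "\<dots> = \<tau>" using r_pos by simp
  finally show ?thesis using x(1) by (simp add: C_def)
qed

text \<open>The triangle inequality, symmetry and \<open>N_le_norm\<close> make \<open>N\<close>
  Lipschitz for the Euclidean norm on \<open>Rn n\<close>.\<close>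

lemma N_continuous_on: "continuous_on (Rn n) N"
  unfolding continuous_on_def
proof
  fix a assume a: "a \<in> Rn n"
  let ?d = "\<lambda>x. 4 / (3 * r) * norm_n n (\<lambda>i. x i - a i)"
  have d: "(?d \<longlongrightarrow> ?d a) (at a within Rn n)"
    using continuous_on_norm_n_diff[of "Rn n" n a] a by (intro tendsto_mult_left) (auto simp: continuous_on_def)
  have "?d a = 0" by simp
  with d have d0: "(?d \<longlongrightarrow> 0) (at a within Rn n)" by (simp only:)
  have "((\<lambda>x. N x - N a) \<longlongrightarrow> 0) (at a within Rn n)"
  proof (rule Lim_null_comparison[OF _ d0])
    show "\<forall>\<^sub>F x in at a within Rn n. norm (N x - N a) \<le> ?d x"
      unfolding eventually_at_filter
    proof (rule always_eventually, intro allI impI)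
      fix x assume x: "x \<in> Rn n"
      have dx: "(\<lambda>i. x i - a i) \<in> Rn n" using x a by (simp add: topspace_Euclidean_space)
      have "N x \<le> N a + N (\<lambda>i. x i - a i)"
        using N_triangle[OF a dx] by simp
      moreover have "N a \<le> N x + N (\<lambda>i. x i - a i)"
        using N_triangle[OF x Rn_minus[OF dx]] N_minus[of "\<lambda>i. x i - a i"] by simp
      ultimately show "norm (N x - N a) \<le> ?d x"
        using N_le_norm[OF dx] by simp
    qed
  qed
  then show "(N \<longlongrightarrow> N a) (at a within Rn n)"
    by (simp only: LIM_zero_iff)
qed

text \<open>Closed by continuity of \<open>N\<close>, and contained in a product of compact
  intervals, which is compact by Tychonoff's theorem.\<close>

lemma C_compact: "compact C"
proof -
  have "closed (Rn n)" using closedin_Euclidean_imp_closed[OF closedin_topspace] by blast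
  then have "closed (Rn n \<inter> N -` {..\<tau>})"
    by (intro continuous_closed_preimage N_continuous_on) auto
  moreover have "C = Rn n \<inter> N -` {..\<tau>}" by (auto simp: C_def)
  ultimately have "closed C" by simp
  moreover have "C \<subseteq> {x. \<forall>i. x i \<in> (if i < n then {-(T * \<tau>)..T * \<tau>} else {0})}"
  proof clarify
    fix x i assume x: "x \<in> C"
    show "x i \<in> (if i < n then {-(T * \<tau>)..T * \<tau>} else {0})"
    proof (cases "i < n")
      case True
      then have "\<bar>x i\<bar> \<le> T * \<tau>" using norm_n_coordinate[OF True, of x] C_norm[OF x] by linarith
      then show ?thesis using True by auto
    next
      case False
      then show ?thesis using x by (auto simp: C_def topspace_Euclidean_space)
    qed
  qed
  ultimately show ?thesis using compact_box_n[of n "T * \<tau>"]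
    by (metis (no_types, lifting) compact_Int_closed inf.absorb_iff2)
qed

lemma C_minus: "(\<lambda>i. - x i) \<in> C \<longleftrightarrow> x \<in> C"
  by (simp add: C_def N_minus topspace_Euclidean_space)

lemma C_symmetric: "symmetric_body C"
  unfolding symmetric_body_def
proof (intro equalityI subsetI)
  fix x assume "x \<in> C"
  then show "x \<in> (\<lambda>x i. - x i) ` C"
    using C_minus[of x] by (intro image_eqI[of _ _ "\<lambda>i. - x i"]) auto
qed (use C_minus in auto)

lemma C_convex: "convex_n C"
  unfolding convex_n_def
proof (intro ballI allI impI)
  fix x y and u v :: real
  assume *: "x \<in> C" "y \<in> C" "0 \<le> u" "0 \<le> v" "u + v = 1"
  then have R: "x \<in> Rn n" "y \<in> Rn n" and le: "N x \<le> \<tau>" "N y \<le> \<tau>" by (auto simp: C_def)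
  have "N (\<lambda>i. u * x i + v * y i) \<le> N (\<lambda>i. u * x i) + N (\<lambda>i. v * y i)"
    using N_triangle[OF Rn_scale[OF R(1), of u] Rn_scale[OF R(2), of v]] .
  also have "\<dots> \<le> u * \<tau> + v * \<tau>"
    using * le by (simp add: N_scale_nonneg add_mono mult_left_mono)
  also have "\<dots> = \<tau>" using *(5) by (simp add: distrib_right[symmetric])
  finally show "(\<lambda>i. u * x i + v * y i) \<in> C"
    using Rn_add[OF Rn_scale[OF R(1), of u] Rn_scale[OF R(2), of v]] by (simp add: C_def)
qed

lemma C_convex_body: "convex_body n C"
  unfolding convex_body_def
proof (intro conjI C_convex)
  show "compactin (Euclidean_space n) C"
    using C_compact C_Rn by (simp add: compactin_Euclidean_space_iff)
  let ?s = "3 * r / 4 * \<tau>"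
  let ?U = "{x \<in> Rn n. norm_n n x < ?s}"
  have "open {x. norm_n n (\<lambda>i. x i - 0) < ?s}"
    by (intro open_Collect_less continuous_on_norm_n_diff continuous_on_const)
  then have "openin (Euclidean_space n) ({x. norm_n n x < ?s} \<inter> Rn n)"
    unfolding Euclidean_space_def by (auto simp: openin_subtopology euclidean_product_topology)
  moreover have "{x. norm_n n x < ?s} \<inter> Rn n \<subseteq> C" using C_ball by auto
  ultimately have "{x. norm_n n x < ?s} \<inter> Rn n \<subseteq> Euclidean_space n interior_of C"
    by (intro interior_of_maximal)
  moreover have "(\<lambda>_. 0) \<in> {x. norm_n n x < ?s} \<inter> Rn n"
    using r_pos \<tau>_pos by simp
  ultimately show "Euclidean_space n interior_of C \<noteq> {}" by blast
qed

lemma C_isotropic_constant: "has_isotropic_constant n C (sqrt (\<tau>\<^sup>2 * M / V))"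
  unfolding has_isotropic_constant_def
proof (intro conjI ballI)
  have pos: "\<tau>\<^sup>2 * M / V > 0" using \<tau>_pos M_bounds V_pos by simp
  then show "0 < sqrt (\<tau>\<^sup>2 * M / V)" by simp
  fix \<theta> assume "\<theta> \<in> unit_sphere_n n"
  then have \<theta>: "norm_n n \<theta> = 1" by (simp add: unit_sphere_n_def)
  have "(LINT x:C|lborel_n n. (inner_n n x \<theta>)\<^sup>2)
      = enn2real (\<integral>\<^sup>+x\<in>C. ennreal ((inner_n n x \<theta>)\<^sup>2) \<partial>lborel_n n)"
    by (rule set_lebesgue_integral_nonneg[OF inner_n_power2_measurable C_borel]) simp
  also have "(\<integral>\<^sup>+x\<in>C. ennreal ((inner_n n x \<theta>)\<^sup>2) \<partial>lborel_n n)
      = ennreal (1 / V) * (\<integral>\<^sup>+x\<in>A. ennreal ((inner_n n (\<lambda>i. \<tau> * x i) \<theta>)\<^sup>2) \<partial>lborel_n n)"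
    by (rule nn_integral_C) measurable
  also have "(\<integral>\<^sup>+x\<in>A. ennreal ((inner_n n (\<lambda>i. \<tau> * x i) \<theta>)\<^sup>2) \<partial>lborel_n n)
      = (\<integral>\<^sup>+x. ennreal (\<tau>\<^sup>2) * (ennreal ((inner_n n x \<theta>)\<^sup>2) * indicator A x) \<partial>lborel_n n)"
    by (intro nn_integral_cong) (simp add: inner_n_scale_left power_mult_distrib ennreal_mult mult.assoc)
  also have "\<dots> = ennreal (\<tau>\<^sup>2) * ennreal M"
    unfolding second_moment_A[OF \<theta>, symmetric] by (rule nn_integral_cmult) measurable
  also have "ennreal (1 / V) * (ennreal (\<tau>\<^sup>2) * ennreal M) = ennreal (\<tau>\<^sup>2 * M / V)"
    using V_pos M_bounds by (simp add: ennreal_mult[symmetric])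
  finally show "(LINT x:C|lborel_n n. (inner_n n x \<theta>)\<^sup>2) = (sqrt (\<tau>\<^sup>2 * M / V))\<^sup>2"
    using pos by simp
qed

lemma C_is_isotropic: "isotropic n C"
  unfolding isotropic_def
  using C_convex_body emeasure_C C_isotropic_constant set_integral_coordinate_symmetric[OF C_borel C_minus] by blast

text \<open>\<open>\<tau> ^ n = 1 / V\<close>, and \<open>V\<close> lies between
  \<open>\<beta>\<close> and \<open>11 \<beta>\<close>. The factor 11 is weakened to
  \<open>11 ^ n\<close>, possible as \<open>n \<ge> 1\<close>, so that n-th roots can be
  taken.\<close>

lemma \<tau>_bounds:
  assumes \<rho>: "\<rho> > 0" "\<beta> = (R / \<rho>) ^ n"
  shows "\<tau> \<le> \<rho> / R" "\<rho> / (11 * R) \<le> \<tau>"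
proof -
  have \<tau>: "\<tau> ^ n = 1 / V" by (rule \<tau>_power)
  have "\<tau> ^ n \<le> 1 / \<beta>" unfolding \<tau> using \<beta>_le_V \<beta>_pos by (intro divide_left_mono) auto
  also have "\<dots> = (\<rho> / R) ^ n" unfolding \<rho>(2) by (simp add: power_divide)
  finally show "\<tau> \<le> \<rho> / R"
    using \<tau>_pos \<rho> R_pos n_pos by (subst (asm) power_mono_iff) auto
  have "(11::real) ^ 1 \<le> 11 ^ n" using n_pos by (intro power_increasing) auto
  then have "11 * \<beta> \<le> 11 ^ n * \<beta>" using \<beta>_pos by simp
  with V_le have V: "V \<le> 11 ^ n * \<beta>" by linarith
  have "(\<rho> / (11 * R)) ^ n = 1 / (11 ^ n * \<beta>)"
    unfolding \<rho>(2) by (simp add: power_divide power_mult_distrib)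
  also have "\<dots> \<le> \<tau> ^ n" unfolding \<tau> using V V_pos \<beta>_pos by (intro divide_left_mono) auto
  finally show "\<rho> / (11 * R) \<le> \<tau>"
    using \<tau>_pos \<rho> R_pos n_pos by (subst (asm) power_mono_iff) auto
qed

section \<open>Comparison of the moments of \<open>K\<close> and \<open>C\<close>\<close>

lemma \<beta>_over_V: "1 / 11 \<le> \<beta> / V"
  using V_le V_pos by (simp add: field_simps)

lemma bounded_set_K: "1 \<le> q \<Longrightarrow> bounded_set n K (T - R) q"
  by unfold_locales (use K_borel K_volume K_norm T_R_nonneg in \<open>simp_all only: infinity_ennreal_def ennreal_one_less_top\<close>)

lemma bounded_set_C: "1 \<le> q \<Longrightarrow> bounded_set n C (T * \<tau>) q"
  by unfold_locales (use C_borel emeasure_C C_norm T_pos \<tau>_pos in \<open>simp_all only: infinity_ennreal_def ennreal_one_less_top mult_nonneg_nonneg less_imp_le\<close>)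

text \<open>From \<open>K\<close> to \<open>f\<close> by convexity, from \<open>f\<close> to
  \<open>A\<close> at the cost of \<open>8 powr q\<close>, and from \<open>A\<close> to
  \<open>C\<close> by dilation. The volume ratio 1/11 is weakened to \<open>1 / 11 powr q\<close>,
  so the q-th root yields \<open>88 = 8 * 11\<close>.\<close>

lemma Lq_moment_C_ge:
  assumes q: "1 \<le> q" "q \<le> real n"
  shows "\<tau> / 88 * Lq_moment n q K y \<le> Lq_moment n q C y"
proof -
  interpret K: bounded_set n K "T - R" q by (rule bounded_set_K[OF q(1)])
  interpret C: bounded_set n C "T * \<tau>" q by (rule bounded_set_C[OF q(1)])
  let ?g = "\<lambda>x. ennreal (\<bar>inner_n n x y\<bar> powr q)"
  have g_scale: "?g (\<lambda>i. c * x i) = ennreal (c powr q) * ?g x" if "c > 0" for c x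
    using that by (simp add: inner_n_scale_left abs_mult powr_mult ennreal_mult)
  have bound: "\<bar>inner_n n x y\<bar> powr q \<le> norm_n n y powr q * norm_n n x powr q" for x
  proof -
    have "\<bar>inner_n n x y\<bar> powr q \<le> (norm_n n x * norm_n n y) powr q"
      using q inner_n_Cauchy_Schwarz by (intro powr_mono2) auto
    then show ?thesis by (simp add: powr_mult mult.commute)
  qed
  have "ennreal \<beta> * K.moment y = emeasure (lborel_n n) B * (\<integral>\<^sup>+x\<in>K. ?g x \<partial>lborel_n n)"
    by (simp add: emeasure_B K.moment_def)
  also have "\<dots> \<le> (\<integral>\<^sup>+x. ?g x * ennreal (f x) \<partial>lborel_n n)"
  proof (rule nn_integral_f_ge)
    fix z b
    have "2 * \<bar>inner_n n z y\<bar> powr q \<le> \<bar>inner_n n b y + inner_n n z y\<bar> powr q + \<bar>- inner_n n b y + inner_n n z y\<bar> powr q"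
      by (rule powr_midpoint_convex[OF q(1)])
    then show "2 * ?g z \<le> ?g (\<lambda>i. b i + z i) + ?g (\<lambda>i. - b i + z i)"
      unfolding inner_n_add_left inner_n_minus_left by (intro ennreal_double_le) auto
  qed measurable
  also have "\<dots> \<le> ennreal (8 powr q) * (\<integral>\<^sup>+x\<in>A. ?g x \<partial>lborel_n n)"
  proof (cases "q \<le> 2")
    case True
    have "(\<integral>\<^sup>+x. ?g x * ennreal (f x) \<partial>lborel_n n) \<le> (\<integral>\<^sup>+x\<in>A. ?g x \<partial>lborel_n n)"
    proof (rule moment_comparison_low[where q = q])
      show "(\<integral>\<^sup>+x\<in>A. ?g x \<partial>lborel_n n) < \<infinity>"
      proof (rule nn_set_integral_bounded_finite[OF _ A_borel A_finite])
        show "\<bar>inner_n n x y\<bar> powr q \<le> norm_n n y powr q * T powr q" if "x \<in> A" for x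
          using A_norm[OF that] q by (intro order_trans[OF bound] mult_left_mono powr_mono2) auto
      qed
    qed (use q True g_scale in \<open>measurable, auto\<close>)
    \<comment> \<open>The low range loses nothing here; the factor is inserted to have one bound for
      all q.\<close>
    moreover have "1 * X \<le> ennreal (8 powr q) * X" for X :: ennreal
      using q by (intro mult_right_mono) (auto simp: ge_one_powr_ge_zero ennreal_ge_1)
    ultimately show ?thesis using order_trans by fastforce
  next
    case False
    then show ?thesis
      by (intro moment_comparison_high[where C = "norm_n n y powr q"])
         (use q g_scale bound in \<open>measurable, auto intro!: ennreal_leI\<close>)
  qed
  finally have 1: "ennreal \<beta> * K.moment y \<le> ennreal (8 powr q) * (\<integral>\<^sup>+x\<in>A. ?g x \<partial>lborel_n n)" .
  have 2: "C.moment y = ennreal (1 / V) * (ennreal (\<tau> powr q) * (\<integral>\<^sup>+x\<in>A. ?g x \<partial>lborel_n n))"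
  proof -
    have "C.moment y = ennreal (1 / V) * (\<integral>\<^sup>+x\<in>A. ?g (\<lambda>i. \<tau> * x i) \<partial>lborel_n n)"
      unfolding C.moment_def by (rule nn_integral_C) measurable
    also have "(\<integral>\<^sup>+x\<in>A. ?g (\<lambda>i. \<tau> * x i) \<partial>lborel_n n)
        = (\<integral>\<^sup>+x. ennreal (\<tau> powr q) * (?g x * indicator A x) \<partial>lborel_n n)"
      unfolding g_scale[OF \<tau>_pos] by (simp only: mult.assoc)
    also have "\<dots> = ennreal (\<tau> powr q) * (\<integral>\<^sup>+x\<in>A. ?g x \<partial>lborel_n n)"
      by (rule nn_integral_cmult) measurable
    finally show ?thesis .
  qed
  have "ennreal (\<beta> * (\<tau> powr q / V)) * K.moment y = ennreal (\<tau> powr q / V) * (ennreal \<beta> * K.moment y)"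
    using \<beta>_pos V_pos by (subst mult.commute[of \<beta>], intro ennreal_mult_mult) auto
  also have "\<dots> \<le> ennreal (\<tau> powr q / V) * (ennreal (8 powr q) * (\<integral>\<^sup>+x\<in>A. ?g x \<partial>lborel_n n))"
    by (intro mult_left_mono 1) auto
  also have "\<dots> = ennreal (8 powr q) * C.moment y"
    unfolding 2 using V_pos by (simp add: ennreal_mult mult_ac divide_inverse)
  finally have "\<beta> * (\<tau> powr q / V) * Lq_moment n q K y powr q \<le> 8 powr q * Lq_moment n q C y powr q"
    unfolding K.moment_eq C.moment_eq using \<beta>_pos V_pos by (simp add: ennreal_mult[symmetric])
  moreover have "(\<tau> / 11) powr q * Lq_moment n q K y powr q \<le> \<beta> * (\<tau> powr q / V) * Lq_moment n q K y powr q"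
  proof (rule mult_right_mono)
    have "(11::real) powr 1 \<le> 11 powr q" by (rule powr_mono) (use q in auto)
    then have "1 / 11 powr q \<le> 1 / (11::real)" by simp
    also have "\<dots> \<le> \<beta> / V" by (rule \<beta>_over_V)
    finally have "\<tau> powr q * (1 / 11 powr q) \<le> \<tau> powr q * (\<beta> / V)" by (intro mult_left_mono) auto
    then show "(\<tau> / 11) powr q \<le> \<beta> * (\<tau> powr q / V)" using \<tau>_pos by (simp add: powr_divide mult_ac)
  qed simp
  ultimately have "(\<tau> / 11) powr q * Lq_moment n q K y powr q \<le> 8 powr q * Lq_moment n q C y powr q"
    by linarith
  moreover have "(\<tau> / 11 * Lq_moment n q K y) powr q = (\<tau> / 11) powr q * Lq_moment n q K y powr q"
    by (rule powr_mult)
  moreover have "(8 * Lq_moment n q C y) powr q = 8 powr q * Lq_moment n q C y powr q"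
    by (rule powr_mult)
  ultimately have "(\<tau> / 11 * Lq_moment n q K y) powr q \<le> (8 * Lq_moment n q C y) powr q"
    by (simp only:)
  then have "\<tau> / 11 * Lq_moment n q K y \<le> 8 * Lq_moment n q C y"
    using q \<tau>_pos K.h_nonneg[of y] C.h_nonneg[of y] powr_less_mono2[of q "8 * Lq_moment n q C y" "\<tau> / 11 * Lq_moment n q K y"]
    by (meson less_le_trans linorder_not_le mult_nonneg_nonneg not_less_iff_gr_or_eq zero_le_numeral zero_less_one)
  then show ?thesis by simp
qed

text \<open>The support function of the centroid body of \<open>K\<close> is convex and homogeneous
  of degree 1, so the passage from \<open>K\<close> over \<open>f\<close> and \<open>A\<close> to
  \<open>C\<close> applies to it with exponent 1, without the factor 8. One \<open>\<tau>\<close>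
  comes from dilating its argument, the other from \<open>Lq_moment_C_ge\<close>, and
  \<open>968 = 88 * 11\<close>.\<close>

lemma I1_polar_Z_le:
  assumes q: "1 \<le> q" "q \<le> real n"
  shows "\<tau>\<^sup>2 / 968 * I1_polar_Z n q K \<le> I1_polar_Z n q C"
proof -
  interpret K: bounded_set n K "T - R" q by (rule bounded_set_K[OF q(1)])
  interpret C: bounded_set n C "T * \<tau>" q by (rule bounded_set_C[OF q(1)])
  note [measurable] = K.h_measurable C.h_measurable
  let ?k = "\<lambda>x. ennreal (K.h x)"
  have Kint: "(\<integral>\<^sup>+x\<in>K. ?k x \<partial>lborel_n n) = ennreal (I1_polar_Z n q K)"
    using K.nn_integral_h_finite[OF K.K_borel K.K_fin K.K_norm]
    by (simp add: K.I1_polar_Z_eq[OF K_Rn] top.not_eq_extremum)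
  have Cint: "(\<integral>\<^sup>+x\<in>C. ennreal (C.h x) \<partial>lborel_n n) = ennreal (I1_polar_Z n q C)"
    using C.nn_integral_h_finite[OF C.K_borel C.K_fin C.K_norm]
    by (simp add: C.I1_polar_Z_eq[OF C_Rn] top.not_eq_extremum)
  have "ennreal \<beta> * ennreal (I1_polar_Z n q K) = emeasure (lborel_n n) B * (\<integral>\<^sup>+x\<in>K. ?k x \<partial>lborel_n n)"
    by (simp only: emeasure_B Kint)
  also have "\<dots> \<le> (\<integral>\<^sup>+x. ?k x * ennreal (f x) \<partial>lborel_n n)"
  proof (rule nn_integral_f_ge)
    fix y b assume yb: "y \<in> Rn n" "b \<in> Rn n"
    have "2 * K.h y = K.h (\<lambda>i. 2 * y i)" by (simp add: K.h_scale)
    also have "(\<lambda>i. 2 * y i) = (\<lambda>i. (b i + y i) + (- b i + y i))" by auto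
    also have "K.h \<dots> \<le> K.h (\<lambda>i. b i + y i) + K.h (\<lambda>i. - b i + y i)"
      using yb by (intro K.h_triangle) (auto simp: topspace_Euclidean_space)
    finally show "2 * ?k y \<le> ?k (\<lambda>i. b i + y i) + ?k (\<lambda>i. - b i + y i)"
      by (intro ennreal_double_le K.h_nonneg)
  qed measurable
  also have "\<dots> \<le> (\<integral>\<^sup>+x\<in>A. ?k x \<partial>lborel_n n)"
  proof (rule moment_comparison_low[where q = 1])
    show "?k (\<lambda>i. c * x i) = ennreal (c powr 1) * ?k x" if "c > 0" for c x
      using that by (simp add: K.h_scale ennreal_mult K.h_nonneg)
    show "(\<integral>\<^sup>+x\<in>A. ?k x \<partial>lborel_n n) < \<infinity>"
      by (rule K.nn_integral_h_finite[OF A_borel A_finite A_norm])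
    show "?k \<in> borel_measurable borel" by measurable
  qed auto
  finally have 1: "ennreal \<beta> * ennreal (I1_polar_Z n q K) \<le> (\<integral>\<^sup>+x\<in>A. ?k x \<partial>lborel_n n)" .
  have I: "0 \<le> I1_polar_Z n q K" "0 \<le> I1_polar_Z n q C"
    by (simp_all add: K.I1_polar_Z_eq[OF K_Rn] C.I1_polar_Z_eq[OF C_Rn])
  have "ennreal (\<tau> / 88 * (\<tau> / V) * \<beta>) * ennreal (I1_polar_Z n q K)
      = ennreal (\<tau> / 88 * (\<tau> / V)) * (ennreal \<beta> * ennreal (I1_polar_Z n q K))"
    using \<tau>_pos V_pos \<beta>_pos by (intro ennreal_mult_mult) auto
  also have "\<dots> \<le> ennreal (\<tau> / 88 * (\<tau> / V)) * (\<integral>\<^sup>+x\<in>A. ?k x \<partial>lborel_n n)"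
    by (intro mult_left_mono 1) auto
  also have "\<dots> = ennreal (1 / V) * (\<integral>\<^sup>+x\<in>A. ennreal (\<tau> / 88) * ?k (\<lambda>i. \<tau> * x i) \<partial>lborel_n n)"
  proof -
    have "(\<integral>\<^sup>+x\<in>A. ennreal (\<tau> / 88) * ?k (\<lambda>i. \<tau> * x i) \<partial>lborel_n n)
        = (\<integral>\<^sup>+x. ennreal (\<tau> / 88 * \<tau>) * (?k x * indicator A x) \<partial>lborel_n n)"
    proof (rule nn_integral_cong)
      fix x
      have "?k (\<lambda>i. \<tau> * x i) = ennreal \<tau> * ?k x"
        using \<tau>_pos by (simp add: K.h_scale ennreal_mult K.h_nonneg)
      then show "ennreal (\<tau> / 88) * ?k (\<lambda>i. \<tau> * x i) * indicator A x = ennreal (\<tau> / 88 * \<tau>) * (?k x * indicator A x)"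
        using ennreal_mult_mult[of "\<tau> / 88" \<tau> "?k x * indicator A x"] \<tau>_pos by (simp add: mult.assoc)
    qed
    also have "\<dots> = ennreal (\<tau> / 88 * \<tau>) * (\<integral>\<^sup>+x\<in>A. ?k x \<partial>lborel_n n)"
      by (rule nn_integral_cmult) measurable
    finally show ?thesis
      using \<tau>_pos V_pos by (simp add: mult.assoc[symmetric] ennreal_mult[symmetric]) (simp add: mult_ac)
  qed
  also have "\<dots> = (\<integral>\<^sup>+x\<in>C. ennreal (\<tau> / 88) * ?k x \<partial>lborel_n n)"
    by (rule nn_integral_C[symmetric]) measurable
  also have "\<dots> \<le> (\<integral>\<^sup>+x\<in>C. ennreal (C.h x) \<partial>lborel_n n)"
  proof (intro nn_integral_mono mult_right_mono)
    fix x
    have "ennreal (\<tau> / 88) * ?k x = ennreal (\<tau> / 88 * K.h x)"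
      using \<tau>_pos K.h_nonneg by (intro ennreal_mult[symmetric]) auto
    also have "\<dots> \<le> ennreal (C.h x)" by (rule ennreal_leI[OF Lq_moment_C_ge[OF q]])
    finally show "ennreal (\<tau> / 88) * ?k x \<le> ennreal (C.h x)" .
  qed auto
  also have "\<dots> = ennreal (I1_polar_Z n q C)" by (rule Cint)
  finally have 2: "\<tau> / 88 * (\<tau> / V) * \<beta> * I1_polar_Z n q K \<le> I1_polar_Z n q C"
    by (rule ennreal_real_le) (use \<tau>_pos V_pos \<beta>_pos I in auto)
  have "\<tau>\<^sup>2 / 968 = \<tau>\<^sup>2 / 88 * (1 / 11)" by simp
  also have "\<dots> \<le> \<tau>\<^sup>2 / 88 * (\<beta> / V)" by (intro mult_left_mono \<beta>_over_V) auto
  also have "\<dots> = \<tau> / 88 * (\<tau> / V) * \<beta>" by (simp add: power2_eq_square)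
  finally show ?thesis using 2 I(1) mult_right_mono order_trans by blast
qed

end

text \<open>Both conclusions rest on the squared norm having integral
  \<open>n L\<^sup>2 = r\<^sup>2\<close> over \<open>K\<close>. Its root mean square
  \<open>r\<close> cannot exceed the radius bound \<open>\<gamma> r\<close>, hence
  \<open>\<gamma> \<ge> 1\<close>; and at most a quarter of \<open>K\<close> lies beyond
  \<open>2 r\<close>.\<close>

lemma isotropic_smoothing_of_isotropic:
  assumes n: "n \<ge> 1" and K: "isotropic n K" "symmetric_body K" and \<gamma>: "\<gamma> > 0"
    and circ: "circumradius n K \<le> \<gamma> * sqrt (real n) * isotropic_constant n K"
  defines "L \<equiv> isotropic_constant n K"
  shows "isotropic_smoothing n K (3 * (sqrt (real n) * L)) (sqrt (real n) * L) ((\<gamma> + 3) * (sqrt (real n) * L)) L"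
    and "\<gamma> \<ge> 1"
proof -
  have n0: "n > 0" using n by simp
  obtain L' where L': "has_isotropic_constant n K L'" using K(1) by (auto simp: isotropic_def)
  then have "L' = L" using has_isotropic_constant_unique[OF n0 L'] by (simp add: L_def)
  with L' have L: "L > 0" "\<And>\<theta>. \<theta> \<in> unit_sphere_n n \<Longrightarrow> (LINT x:K|lborel_n n. (inner_n n x \<theta>)\<^sup>2) = L\<^sup>2"
    by (auto simp: has_isotropic_constant_def)
  define r where "r = sqrt (real n) * L"
  have r: "r > 0" using n0 L by (simp add: r_def)
  have cb: "compact K" "K \<subseteq> Rn n" "convex_n K" and vol: "emeasure (lborel_n n) K = 1"
    using K(1) by (auto simp: isotropic_def convex_body_def compactin_Euclidean_space_iff)
  have KB: "K \<in> sets borel" using cb(1) by (intro borel_closed compact_imp_closed)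
  have "compact (norm_n n ` K)"
    using continuous_on_norm_n_diff[of K n "\<lambda>_. 0"] cb(1) by (intro compact_continuous_image) auto
  then have bdd: "bdd_above (norm_n n ` K)" by (intro bounded_imp_bdd_above compact_imp_bounded)
  have norm: "norm_n n y \<le> \<gamma> * r" if "y \<in> K" for y
    using cSUP_upper[OF that bdd] circ by (simp add: circumradius_def r_def L_def mult.assoc)
  have iso: "(\<integral>\<^sup>+y\<in>K. ennreal ((inner_n n y \<theta>)\<^sup>2) \<partial>lborel_n n) = ennreal (L\<^sup>2)"
    if \<theta>: "norm_n n \<theta> = 1" for \<theta>
  proof -
    \<comment> \<open>The locale quantifies over all sequences with
      \<open>norm_n n \<theta> = 1\<close>; cutting off after coordinate \<open>n\<close> puts
      \<open>\<theta>\<close> on the sphere in \<open>Rn n\<close> without changing inner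
      products.\<close>
    let ?\<theta> = "zero_ext n \<theta>"
    have inner: "inner_n n y ?\<theta> = inner_n n y \<theta>" for y by (simp add: inner_n_def zero_ext_def)
    have "norm_n n ?\<theta> = norm_n n \<theta>" by (simp add: norm_n_def inner_n_def zero_ext_def)
    then have "?\<theta> \<in> unit_sphere_n n" using \<theta> by (simp add: unit_sphere_n_def zero_ext_def topspace_Euclidean_space)
    then have "L\<^sup>2 = (LINT y:K|lborel_n n. (inner_n n y \<theta>)\<^sup>2)" using L(2)[of ?\<theta>] by (simp add: inner)
    also have "\<dots> = enn2real (\<integral>\<^sup>+y\<in>K. ennreal ((inner_n n y \<theta>)\<^sup>2) \<partial>lborel_n n)"
      by (rule set_lebesgue_integral_nonneg[OF inner_n_power2_measurable KB]) simp
    finally have "enn2real (\<integral>\<^sup>+y\<in>K. ennreal ((inner_n n y \<theta>)\<^sup>2) \<partial>lborel_n n) = L\<^sup>2" ..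
    moreover have "(\<integral>\<^sup>+y\<in>K. ennreal ((inner_n n y \<theta>)\<^sup>2) \<partial>lborel_n n) < \<infinity>"
    proof (rule nn_set_integral_bounded_finite[OF _ KB])
      show "(inner_n n y \<theta>)\<^sup>2 \<le> (\<gamma> * r)\<^sup>2" if "y \<in> K" for y
      proof -
        have "\<bar>inner_n n y \<theta>\<bar> \<le> \<gamma> * r" using inner_n_Cauchy_Schwarz[of n y \<theta>] norm[OF that] \<theta> by simp
        then show ?thesis using power_mono[of "\<bar>inner_n n y \<theta>\<bar>" "\<gamma> * r" 2] by simp
      qed
    qed (simp add: vol)
    ultimately show ?thesis by (metis ennreal_enn2real infinity_ennreal_def)
  qed
  have mom: "(\<integral>\<^sup>+y\<in>K. ennreal ((norm_n n y)\<^sup>2) \<partial>lborel_n n) = ennreal (r\<^sup>2)"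
  proof -
    note KB[measurable]
    have "(\<integral>\<^sup>+y\<in>K. ennreal ((norm_n n y)\<^sup>2) \<partial>lborel_n n)
      = (\<Sum>i<n. \<integral>\<^sup>+y\<in>K. ennreal ((inner_n n y (basis_n i))\<^sup>2) \<partial>lborel_n n)"
      unfolding ennreal_norm_n_power2 sum_distrib_right by (rule nn_integral_sum) measurable
    also have "\<dots> = ennreal (real n * L\<^sup>2)"
      by (simp add: iso norm_basis_n ennreal_of_nat_eq_real_of_nat ennreal_mult)
    finally show ?thesis by (simp add: r_def power_mult_distrib)
  qed
  show "\<gamma> \<ge> 1"
  proof -
    have "ennreal (r\<^sup>2) \<le> (\<integral>\<^sup>+y\<in>K. ennreal ((\<gamma> * r)\<^sup>2) \<partial>lborel_n n)"
      unfolding mom[symmetric] using norm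
      by (intro nn_integral_mono) (auto simp: indicator_def intro!: ennreal_leI power_mono)
    also have "\<dots> = ennreal ((\<gamma> * r)\<^sup>2) * emeasure (lborel_n n) K"
      by (rule nn_integral_cmult_indicator) (simp only: sets_lborel_n KB)
    finally have "ennreal (r\<^sup>2) \<le> ennreal ((\<gamma> * r)\<^sup>2)" by (simp only: vol mult_1_right)
    then have "r\<^sup>2 \<le> (\<gamma> * r)\<^sup>2" by (simp only: ennreal_le_iff zero_le_power2)
    then have "r \<le> \<gamma> * r" by (rule power2_le_imp_le) (rule mult_nonneg_nonneg[OF less_imp_le[OF \<gamma>] less_imp_le[OF r]])
    then have "1 * r \<le> \<gamma> * r" by (simp only: mult_1)
    then show ?thesis by (rule mult_right_le_imp_le[OF _ r])
  qed
  have core: "3 / 4 \<le> measure (lborel_n n) {y \<in> K. norm_n n y \<le> 3 * r - r}"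
  proof -
    note KB[measurable]
    let ?G = "{y \<in> K. norm_n n y \<le> 3 * r - r}"
    have G: "?G \<in> sets borel" by measurable
    have "ennreal 1 = (\<integral>\<^sup>+y. indicator K y \<partial>lborel_n n)" using vol KB by simp
    also have "\<dots> \<le> (\<integral>\<^sup>+y. indicator ?G y + ennreal (1 / (4 * r\<^sup>2)) * (ennreal ((norm_n n y)\<^sup>2) * indicator K y) \<partial>lborel_n n)"
    proof (rule nn_integral_mono)
      fix y
      show "indicator K y \<le> indicator ?G y + ennreal (1 / (4 * r\<^sup>2)) * (ennreal ((norm_n n y)\<^sup>2) * indicator K y)"
      proof (cases "y \<in> K \<and> y \<notin> ?G")
        case True
        then have "(2 * r)\<^sup>2 \<le> (norm_n n y)\<^sup>2" using r by (intro power_mono) auto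
        then have "1 \<le> 1 / (4 * r\<^sup>2) * (norm_n n y)\<^sup>2" using r by (simp add: power_mult_distrib)
        then have "ennreal 1 \<le> ennreal (1 / (4 * r\<^sup>2) * (norm_n n y)\<^sup>2)" by (rule ennreal_leI)
        then have "1 \<le> ennreal (1 / (4 * r\<^sup>2)) * ennreal ((norm_n n y)\<^sup>2)" by (subst (asm) ennreal_mult) auto
        then show ?thesis using True by simp
      qed (auto simp: indicator_def)
    qed
    also have "\<dots> = emeasure (lborel_n n) ?G + ennreal (1 / (4 * r\<^sup>2)) * ennreal (r\<^sup>2)"
      unfolding mom[symmetric] using G by (subst nn_integral_add) (simp_all add: nn_integral_cmult)
    also have "\<dots> = ennreal (measure (lborel_n n) ?G + 1 / 4)"
    proof -
      have "emeasure (lborel_n n) ?G \<le> emeasure (lborel_n n) K"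
        by (rule emeasure_mono) (auto simp: KB)
      then have "emeasure (lborel_n n) ?G \<noteq> top" using vol by (auto simp: top_unique)
      then show ?thesis using r by (simp add: emeasure_eq_ennreal_measure ennreal_mult[symmetric] ennreal_plus[symmetric] del: ennreal_plus)
    qed
    finally have "1 \<le> measure (lborel_n n) ?G + 1 / 4" by (subst (asm) ennreal_le_iff) auto
    then show ?thesis by simp
  qed
  show "isotropic_smoothing n K (3 * (sqrt (real n) * L)) (sqrt (real n) * L) ((\<gamma> + 3) * (sqrt (real n) * L)) L"
    unfolding r_def[symmetric]
    by unfold_locales (use n0 KB cb K(2) vol r core norm L(1) iso in \<open>auto simp: distrib_right r_def[symmetric]\<close>)
qed

text \<open>\<open>\<tau>\<close> lies between \<open>1 / (264 L)\<close> and
  \<open>1 / (6 L)\<close>, from the bounds \<open>sqrt n / 8\<close> and \<open>sqrt n / 2\<close>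
  on \<open>\<rho>\<close>, from \<open>R = 3 r\<close> and from the factor 11. So the squared
  isotropic constant is at most 10/36, and \<open>67465728 = 264\<^sup>2 * 968\<close>. The inner
  radius is \<open>3 r / 4\<close> times \<open>\<rho> / (33 r)\<close>, that is
  \<open>\<rho> / 44\<close>. The outer one is \<open>(\<gamma> + 3) / 3\<close> times
  \<open>\<rho>\<close>, where \<open>\<gamma> \<ge> 1\<close> absorbs the 3.\<close>

lemma isotropic_body_with_bounded_constant:
  assumes n: "n \<ge> 1" and K: "isotropic n K" "symmetric_body K" and \<gamma>: "\<gamma> > 0"
    and circ: "circumradius n K \<le> \<gamma> * sqrt (real n) * isotropic_constant n K"
  shows "\<exists>C. isotropic n C \<and> symmetric_body C \<and> isotropic_constant n C \<le> 1 \<and>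
    scale_set (1 / 44) (volume_one_ball n) \<subseteq> C \<and> C \<subseteq> scale_set (4 / 3 * \<gamma>) (volume_one_ball n) \<and>
    (\<forall>q. 1 \<le> q \<and> q \<le> real n \<longrightarrow>
      I1_polar_Z n q K \<le> 67465728 * I1_polar_Z n q C * (isotropic_constant n K)\<^sup>2)"
proof -
  have n0: "n > 0" using n by simp
  define L where "L = isotropic_constant n K"
  define r where "r = sqrt (real n) * L"
  interpret S: isotropic_smoothing n K "3 * r" r "(\<gamma> + 3) * r" L
    unfolding r_def L_def by (rule isotropic_smoothing_of_isotropic[OF n K \<gamma> circ])
  have \<gamma>1: "\<gamma> \<ge> 1" by (rule isotropic_smoothing_of_isotropic(2)[OF n K \<gamma> circ])
  have r: "r > 0" by (rule S.r_pos)
  have L: "L > 0" by (rule S.L_pos)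
  obtain \<rho> where \<rho>: "volume_one_ball n = ball_n n \<rho>" "sqrt (real n) / 8 \<le> \<rho>" "\<rho> \<le> sqrt (real n) / 2"
    "\<And>t. t > 0 \<Longrightarrow> measure (lborel_n n) {z. norm_n n z \<le> t} = (t / \<rho>) ^ n"
    using volume_one_ball[OF n0] by blast
  have sn: "sqrt (real n) > 0" using n0 by simp
  have \<rho>0: "\<rho> > 0" using \<rho>(2) sn by linarith
  have \<beta>: "S.\<beta> = (3 * r / \<rho>) ^ n" unfolding S.\<beta>_def using \<rho>(4)[of "3 * r"] r by simp
  note \<tau> = S.\<tau>_bounds[OF \<rho>0 \<beta>]
  have const: "isotropic_constant n S.C \<le> 1"
  proof -
    have MV: "S.M / S.V \<le> 10 * L\<^sup>2"
    proof -
      have "S.M \<le> 10 * L\<^sup>2 * S.\<beta>" by (rule S.M_bounds)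
      also have "\<dots> \<le> 10 * L\<^sup>2 * S.V" by (intro mult_left_mono S.\<beta>_le_V) simp
      finally show ?thesis using S.V_pos by (simp add: field_simps)
    qed
    have "S.\<tau> \<le> \<rho> / (3 * r)" by (rule \<tau>(1))
    also have "\<dots> \<le> sqrt (real n) / 2 / (3 * r)" using \<rho>(3) r by (intro divide_right_mono) auto
    also have "\<dots> = 1 / (6 * L)" using sn L by (simp add: r_def)
    finally have "S.\<tau>\<^sup>2 \<le> (1 / (6 * L))\<^sup>2" using S.\<tau>_pos by (intro power_mono) auto
    then have "S.\<tau>\<^sup>2 * (S.M / S.V) \<le> (1 / (6 * L))\<^sup>2 * (10 * L\<^sup>2)"
      using MV S.M_bounds S.V_pos by (intro mult_mono) auto
    then have "S.\<tau>\<^sup>2 * S.M / S.V \<le> (1 / (6 * L))\<^sup>2 * (10 * L\<^sup>2)" by simp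
    also have "\<dots> \<le> 1" using L by (simp add: power_divide power_mult_distrib)
    finally have "sqrt (S.\<tau>\<^sup>2 * S.M / S.V) \<le> 1" by simp
    then show ?thesis using has_isotropic_constant_unique[OF n0 S.C_isotropic_constant] by simp
  qed
  have inner_ball: "scale_set (1 / 44) (volume_one_ball n) \<subseteq> S.C"
  proof
    fix x assume "x \<in> scale_set (1 / 44) (volume_one_ball n)"
    then obtain y where y: "y \<in> Rn n" "norm_n n y \<le> \<rho>" "x = (\<lambda>i. 1 / 44 * y i)"
      by (auto simp: scale_set_def \<rho>(1) ball_n_def)
    have "norm_n n x \<le> \<rho> / 44" using y(2,3) by (simp only: norm_n_scale)
    also have "\<rho> / 44 = 3 * r / 4 * (\<rho> / (11 * (3 * r)))" using r by simp
    also have "\<dots> \<le> 3 * r / 4 * S.\<tau>" using \<tau>(2) r by (intro mult_left_mono) auto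
    finally show "x \<in> S.C" using S.C_ball[of x] y(1,3) by (simp add: Rn_scale Rn_divide)
  qed
  have outer_ball: "S.C \<subseteq> scale_set (4 / 3 * \<gamma>) (volume_one_ball n)"
  proof
    fix x assume x: "x \<in> S.C"
    have "norm_n n x \<le> (\<gamma> + 3) * r * S.\<tau>" by (rule S.C_norm[OF x])
    also have "\<dots> \<le> (\<gamma> + 3) * r * (\<rho> / (3 * r))" using \<tau>(1) r \<gamma> by (intro mult_left_mono) auto
    also have "\<dots> = (\<gamma> + 3) / 3 * \<rho>" using r by simp
    also have "\<dots> \<le> 4 / 3 * \<gamma> * \<rho>" using \<gamma>1 \<rho>0 by (intro mult_right_mono) auto
    finally have nx: "norm_n n x \<le> 4 / 3 * \<gamma> * \<rho>" .
    define c where "c = 4 / 3 * \<gamma>"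
    have c: "c > 0" using \<gamma> by (simp add: c_def)
    have "norm_n n (\<lambda>i. x i / c) \<le> \<rho>"
      using nx c unfolding norm_n_divide c_def[symmetric] by (simp add: pos_divide_le_eq mult.commute)
    then have mem: "(\<lambda>i. x i / c) \<in> ball_n n \<rho>"
      using S.C_Rn x by (auto simp: ball_n_def intro: Rn_divide)
    show "x \<in> scale_set (4 / 3 * \<gamma>) (volume_one_ball n)"
      unfolding scale_set_def \<rho>(1) c_def[symmetric]
      by (rule image_eqI[OF _ mem]) (use c in auto)
  qed
  have "I1_polar_Z n q K \<le> 67465728 * I1_polar_Z n q S.C * (isotropic_constant n K)\<^sup>2" if q: "1 \<le> q" "q \<le> real n" for q
  proof -
    interpret Kq: bounded_set n K "(\<gamma> + 3) * r - 3 * r" q by (rule S.bounded_set_K[OF q(1)])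
    have I: "0 \<le> I1_polar_Z n q K" by (simp add: Kq.I1_polar_Z_eq[OF S.K_Rn])
    have "1 / (264 * L) = sqrt (real n) / 8 / (11 * (3 * r))" using sn by (simp add: r_def)
    also have "\<dots> \<le> \<rho> / (11 * (3 * r))" using \<rho>(2) r by (intro divide_right_mono) auto
    also have "\<dots> \<le> S.\<tau>" by (rule \<tau>(2))
    finally have "(1 / (264 * L))\<^sup>2 \<le> S.\<tau>\<^sup>2" using L by (intro power_mono) auto
    then have "(1 / (264 * L))\<^sup>2 / 968 * I1_polar_Z n q K \<le> S.\<tau>\<^sup>2 / 968 * I1_polar_Z n q K"
      using I by (intro mult_right_mono divide_right_mono) auto
    also have "\<dots> \<le> I1_polar_Z n q S.C" by (rule S.I1_polar_Z_le[OF q])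
    finally have "(1 / (264 * L))\<^sup>2 / 968 * I1_polar_Z n q K \<le> I1_polar_Z n q S.C" .
    then show ?thesis using L unfolding L_def[symmetric]
      by (simp add: power_divide power_mult_distrib field_simps)
  qed
  then show ?thesis using S.C_is_isotropic S.C_symmetric const inner_ball outer_ball by blast
qed

theorem proposition6p2:
  shows "\<exists>c6 c7 c8 c9 :: real. c6 > 0 \<and> c7 > 0 \<and> c8 > 0 \<and> c9 > 0 \<and>
    (\<forall>(n::nat) (K :: (nat \<Rightarrow> real) set) (\<gamma>::real).
       n \<ge> 1 \<longrightarrow> isotropic n K \<longrightarrow> symmetric_body K \<longrightarrow> \<gamma> > 0 \<longrightarrow>
       circumradius n K \<le> \<gamma> * sqrt (real n) * isotropic_constant n K \<longrightarrow>
       (\<exists>C :: (nat \<Rightarrow> real) set. isotropic n C \<and> symmetric_body C \<and>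
          isotropic_constant n C \<le> c6 \<and>
          scale_set c7 (volume_one_ball n) \<subseteq> C \<and>
          C \<subseteq> scale_set (c8 * \<gamma>) (volume_one_ball n) \<and>
          (\<forall>q::real. 1 \<le> q \<and> q \<le> real n \<longrightarrow>
             I1_polar_Z n q K \<le> c9 * I1_polar_Z n q C * (isotropic_constant n K)\<^sup>2)))"
proof -
  have pos: "(1::real) > 0" "(1 / 44 :: real) > 0" "(4 / 3 :: real) > 0" "(67465728 :: real) > 0" by simp_all
  show ?thesis
    by (rule exI[of _ 1], rule exI[of _ "1 / 44"], rule exI[of _ "4 / 3"], rule exI[of _ 67465728])
       (intro conjI pos allI impI isotropic_body_with_bounded_constant)
qed

end
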